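(* Let $K$ be an algebraically closed field of characteristic $p\ge 0$, let $k,n\ge2$ be integers with $(k-1)(n-1)\ge 2$ and, if $p>0$, with $k$ relatively prime to $p$, and let $\lambda_1,\ldots,\lambda_{n-2}\in K\setminus\{0,1\}$ be pairwise different. Then the collection $$\mathcal{B}^{can}=\{\theta_{r;\alpha_3,\ldots,\alpha_{n+1}}\}_{(r;\alpha_3,\ldots,\alpha_{n+1})\in I_{k,n}}$$ is a basis of the $K$-vector space $H^{1,0}(C^k_{\lambda_1,\ldots,\lambda_{n-2}})$ of holomorphic forms of $C^k_{\lambda_1,\ldots,\lambda_{n-2}}$.
   Context: $C^k_{\lambda_1,\ldots,\lambda_{n-2}}\subset\mathbb{P}^n_K$ is the non-singular irreducible projective curve with equations $$x_1^k+x_2^k+x_3^k=0,\quad \lambda_1x_1^k+x_2^k+x_4^k=0,\ \ldots,\ \lambda_{n-2}x_1^k+x_2^k+x_{n+1}^k=0$$ (for $n=2$ it is the Fermat curve $x_1^k+x_2^k+x_3^k=0$). On it set $y_j=x_j/x_1$ for $j=2,\ldots,n+1$ and $z=y_2=x_2/x_1$. For $r\in\mathbb{Z}$ and $\alpha_3,\ldots,\alpha_{n+1}\in\{0,1,\ldots,k-1\}$ put $$\theta_{r;\alpha_3,\ldots,\alpha_{n+1}}=\frac{z^r\,dz}{y_3^{\alpha_3}y_4^{\alpha_4}\cdots y_{n+1}^{\alpha_{n+1}}},$$ a meromorphic (rational) differential form. Let $$I_{k,n}=\{(r;\alpha_3,\ldots,\alpha_{n+1}): r,\alpha_j\in\mathbb{Z},\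 \alpha_j\in\{0,1,\ldots,k-1\},\ 0\le r\le \alpha_3+\cdots+\alpha_{n+1}-2\}.$$ $H^{1,0}(X)=H^0(X,\Omega^1)$ denotes the space of holomorphic (everywhere regular) one-forms on the curve $X$. The collection $\mathcal{B}^{can}$ is called the standard basis. *)

theory Defs
  imports
    "HOL-Library.Poly_Mapping"
    "HOL-Library.FuncSet"
    "HOL-Computational_Algebra.Polynomial"
    "HOL-Algebra.QuotRing"
    "Jordan_Normal_Form.VS_Connect"
begin

section \<open>Forms and projective sets\<close>

text \<open>Polynomials in variables indexed by \<^typ>\<open>nat\<close>; a monomial is its exponent vector.
  The homogeneous coordinates of \<open>P^n\<close> are numbered \<open>1, \<dots>, n + 1\<close>.\<close>

type_synonym 'a mpoly = "(nat \<Rightarrow>\<^sub>0 nat) \<Rightarrow>\<^sub>0 'a"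

definition Const :: "'a::comm_ring_1 \<Rightarrow> 'a mpoly" where
  "Const c = Poly_Mapping.single 0 c"

definition Var :: "nat \<Rightarrow> 'a::comm_ring_1 mpoly" where
  "Var i = Poly_Mapping.single (Poly_Mapping.single i 1) 1"

definition mpoly_eval :: "(nat \<Rightarrow> 'a::comm_ring_1) \<Rightarrow> 'a mpoly \<Rightarrow> 'a" where
  "mpoly_eval x p = (\<Sum>m\<in>Poly_Mapping.keys p. Poly_Mapping.lookup p m * (\<Prod>i\<in>Poly_Mapping.keys m. x i ^ Poly_Mapping.lookup m i))"

definition forms :: "nat \<Rightarrow> nat \<Rightarrow> 'a::comm_ring_1 mpoly set" where
  "forms n d = {p. \<forall>m\<in>Poly_Mapping.keys p. Poly_Mapping.keys m \<subseteq> {1..n+1} \<and> (\<Sum>i\<in>Poly_Mapping.keys m. Poly_Mapping.lookup m i) = d}"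

text \<open>A vector of \<open>K^(n+1)\<close> is a function that is zero off \<open>{1..n+1}\<close>; a point of \<open>P^n\<close> is
  the set of all its vectors of homogeneous coordinates.\<close>

definition homog_vectors :: "nat \<Rightarrow> (nat \<Rightarrow> 'a::field) set" where
  "homog_vectors n = {x. (\<forall>i. i \<notin> {1..n+1} \<longrightarrow> x i = 0) \<and> (\<exists>i. x i \<noteq> 0)}"

definition proportional :: "nat \<Rightarrow> ((nat \<Rightarrow> 'a::field) \<times> (nat \<Rightarrow> 'a)) set" where
  "proportional n = {(x, y). x \<in> homog_vectors n \<and> y \<in> homog_vectors n \<and>
      (\<exists>c. c \<noteq> 0 \<and> y = (\<lambda>i. c * x i))}"

definition proj_space :: "nat \<Rightarrow> (nat \<Rightarrow> 'a::field) set set" where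
  "proj_space n = homog_vectors n // proportional n"

definition vanishes_at :: "'a::field mpoly \<Rightarrow> (nat \<Rightarrow> 'a) set \<Rightarrow> bool" where
  "vanishes_at f P \<longleftrightarrow> (\<forall>x\<in>P. mpoly_eval x f = 0)"

definition zero_locus :: "nat \<Rightarrow> 'a::field mpoly set \<Rightarrow> (nat \<Rightarrow> 'a) set set" where
  "zero_locus n E = {P \<in> proj_space n. \<forall>f\<in>E. vanishes_at f P}"

section \<open>Rational functions on a projective variety\<close>

text \<open>For an irreducible closed set \<open>X\<close> of \<open>P^n\<close> over an algebraically closed field, the function
  field \<open>K(X)\<close> consists of the fractions \<open>g/h\<close> of forms of equal degree, with \<open>h\<close> not identically
  zero on \<open>X\<close>, where \<open>g/h = g'/h'\<close> iff \<open>g h' - g' h\<close> belongs to the homogeneous ideal of \<open>X\<close>,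
  i.e. vanishes on \<open>X\<close>.\<close>

definition fractions :: "nat \<Rightarrow> (nat \<Rightarrow> 'a::field) set set \<Rightarrow> ('a mpoly \<times> 'a mpoly) set" where
  "fractions n X = {(g, h). (\<exists>d. g \<in> forms n d \<and> h \<in> forms n d) \<and> (\<exists>P\<in>X. \<not> vanishes_at h P)}"

definition fraction_rel ::
  "nat \<Rightarrow> (nat \<Rightarrow> 'a::field) set set \<Rightarrow> (('a mpoly \<times> 'a mpoly) \<times> ('a mpoly \<times> 'a mpoly)) set" where
  "fraction_rel n X = {((g, h), (g', h')). (g, h) \<in> fractions n X \<and> (g', h') \<in> fractions n X \<and>
      (\<forall>P\<in>X. vanishes_at (g * h' - g' * h) P)}"

definition frac ::
  "nat \<Rightarrow> (nat \<Rightarrow> 'a::field) set set \<Rightarrow> 'a mpoly \<Rightarrow> 'a mpoly \<Rightarrow> ('a mpoly \<times> 'a mpoly) set" where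
  "frac n X g h = fraction_rel n X `` {(g, h)}"

definition function_field ::
  "nat \<Rightarrow> (nat \<Rightarrow> 'a::field) set set \<Rightarrow> ('a mpoly \<times> 'a mpoly) set ring" where
  "function_field n X =
    \<lparr>carrier = fractions n X // fraction_rel n X,
     mult = (\<lambda>a b. \<Union>(g, h)\<in>a. \<Union>(g', h')\<in>b. frac n X (g * g') (h * h')),
     one = frac n X 1 1,
     zero = frac n X 0 1,
     add = (\<lambda>a b. \<Union>(g, h)\<in>a. \<Union>(g', h')\<in>b. frac n X (g * h' + g' * h) (h * h'))\<rparr>"

definition const_fun ::
  "nat \<Rightarrow> (nat \<Rightarrow> 'a::field) set set \<Rightarrow> 'a \<Rightarrow> ('a mpoly \<times> 'a mpoly) set" where
  "const_fun n X c = frac n X (Const c) 1"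

definition local_ring ::
  "nat \<Rightarrow> (nat \<Rightarrow> 'a::field) set set \<Rightarrow> (nat \<Rightarrow> 'a) set \<Rightarrow> ('a mpoly \<times> 'a mpoly) set set" where
  "local_ring n X P = {a \<in> carrier (function_field n X). \<exists>(g, h)\<in>a. \<not> vanishes_at h P}"

section \<open>Kaehler differentials\<close>

text \<open>For a commutative ring \<open>F\<close> and a subring \<open>A\<close>, \<open>\<Omega>\<close> is the free \<open>F\<close>-module on symbols
  \<open>\<delta> x\<close> (\<open>x \<in> F\<close>) modulo the relations making \<open>\<delta>\<close> an \<open>A\<close>-linear derivation.\<close>

definition free_module :: "('f, 'm) ring_scheme \<Rightarrow> ('f, 'f \<Rightarrow> 'f) module" where
  "free_module F = (ring.func_space F (carrier F))
    \<lparr>carrier := {u \<in> carrier F \<rightarrow>\<^sub>E carrier F. finite {x \<in> carrier F. u x \<noteq> \<zero>\<^bsub>F\<^esub>}}\<rparr>"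

definition symbol :: "('f, 'm) ring_scheme \<Rightarrow> 'f \<Rightarrow> 'f \<Rightarrow> 'f" where
  "symbol F x = (\<lambda>y\<in>carrier F. if y = x then \<one>\<^bsub>F\<^esub> else \<zero>\<^bsub>F\<^esub>)"

definition kaehler_relations :: "('f, 'm) ring_scheme \<Rightarrow> 'f set \<Rightarrow> ('f \<Rightarrow> 'f) set" where
  "kaehler_relations F A = (let M = free_module F; \<delta> = symbol F in
     {\<delta> (x \<oplus>\<^bsub>F\<^esub> y) \<ominus>\<^bsub>M\<^esub> (\<delta> x \<oplus>\<^bsub>M\<^esub> \<delta> y) | x y. x \<in> carrier F \<and> y \<in> carrier F} \<union>
     {\<delta> (x \<otimes>\<^bsub>F\<^esub> y) \<ominus>\<^bsub>M\<^esub> (x \<odot>\<^bsub>M\<^esub> \<delta> y \<oplus>\<^bsub>M\<^esub> y \<odot>\<^bsub>M\<^esub> \<delta> x) | x y. x \<in> carrier F \<and> y \<in> carrier F} \<union>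
     \<delta> ` A)"

definition kaehler_submodule :: "('f, 'm) ring_scheme \<Rightarrow> 'f set \<Rightarrow> ('f \<Rightarrow> 'f) set" where
  "kaehler_submodule F A = LinearCombinations.module.span F (free_module F) (kaehler_relations F A)"

text \<open>The fields \<open>mult\<close> and \<open>one\<close> of a module record carry no meaning.\<close>

definition quotient_module :: "('f, 'b) module \<Rightarrow> 'b set \<Rightarrow> ('f, 'b set) module" where
  "quotient_module M N =
    \<lparr>carrier = a_rcosets\<^bsub>M\<^esub> N, mult = (\<lambda>_ _. N), one = N, zero = N, add = set_add M,
     smult = (\<lambda>a C. \<Union>u\<in>C. N +>\<^bsub>M\<^esub> (a \<odot>\<^bsub>M\<^esub> u))\<rparr>"

definition kaehler :: "('f, 'm) ring_scheme \<Rightarrow> 'f set \<Rightarrow> ('f, ('f \<Rightarrow> 'f) set) module" where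
  "kaehler F A = quotient_module (free_module F) (kaehler_submodule F A)"

definition kaehler_d :: "('f, 'm) ring_scheme \<Rightarrow> 'f set \<Rightarrow> 'f \<Rightarrow> ('f \<Rightarrow> 'f) set" where
  "kaehler_d F A x = kaehler_submodule F A +>\<^bsub>free_module F\<^esub> symbol F x"

section \<open>Meromorphic and holomorphic forms on a curve\<close>

type_synonym 'a ratfun = "('a mpoly \<times> 'a mpoly) set"
type_synonym 'a diff_form = "('a ratfun \<Rightarrow> 'a ratfun) set"

definition mero_forms ::
  "nat \<Rightarrow> (nat \<Rightarrow> 'a::field) set set \<Rightarrow> ('a ratfun, 'a diff_form) module" where
  "mero_forms n X = kaehler (function_field n X) (range (const_fun n X))"

definition differential ::
  "nat \<Rightarrow> (nat \<Rightarrow> 'a::field) set set \<Rightarrow> 'a ratfun \<Rightarrow> 'a diff_form" where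
  "differential n X = kaehler_d (function_field n X) (range (const_fun n X))"

text \<open>A form is regular at \<open>P\<close> if it is a finite sum of terms \<open>f dg\<close> with \<open>f\<close> and \<open>g\<close> in the local
  ring at \<open>P\<close>.\<close>

definition regular_at ::
  "nat \<Rightarrow> (nat \<Rightarrow> 'a::field) set set \<Rightarrow> 'a diff_form \<Rightarrow> (nat \<Rightarrow> 'a) set \<Rightarrow> bool" where
  "regular_at n X \<omega> P \<longleftrightarrow>
     \<omega> \<in> LinearCombinations.module.span ((function_field n X)\<lparr>carrier := local_ring n X P\<rparr>)
           (mero_forms n X) (differential n X ` local_ring n X P)"

definition holomorphic_forms ::
  "nat \<Rightarrow> (nat \<Rightarrow> 'a::field) set set \<Rightarrow> ('a, 'a diff_form) module" where
  "holomorphic_forms n X = (let \<Omega> = mero_forms n X in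
    \<lparr>carrier = {\<omega> \<in> carrier \<Omega>. \<forall>P\<in>X. regular_at n X \<omega> P},
     mult = mult \<Omega>, one = one \<Omega>, zero = zero \<Omega>, add = add \<Omega>,
     smult = (\<lambda>c \<omega>. const_fun n X c \<odot>\<^bsub>\<Omega>\<^esub> \<omega>)\<rparr>)"

section \<open>Generalized Fermat curves\<close>

text \<open>The parameters \<open>\<lambda>_1, \<dots>, \<lambda>_(n-2)\<close> are \<open>lam 1, \<dots>, lam (n - 2)\<close>; other values of \<open>lam\<close>
  are ignored.\<close>

definition gen_fermat_curve ::
  "nat \<Rightarrow> nat \<Rightarrow> (nat \<Rightarrow> 'a::field) \<Rightarrow> (nat \<Rightarrow> 'a) set set" where
  "gen_fermat_curve k n lam = zero_locus n
     (insert (Var 1 ^ k + Var 2 ^ k + Var 3 ^ k)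
        ((\<lambda>i. Const (lam i) * Var 1 ^ k + Var 2 ^ k + Var (i + 3) ^ k) ` {1..n-2}))"

definition y_coord :: "nat \<Rightarrow> (nat \<Rightarrow> 'a::field) set set \<Rightarrow> nat \<Rightarrow> 'a ratfun" where
  "y_coord n X j = frac n X (Var j) (Var 1)"

definition theta ::
  "nat \<Rightarrow> (nat \<Rightarrow> 'a::field) set set \<Rightarrow> int \<times> (nat \<Rightarrow> nat) \<Rightarrow> 'a diff_form" where
  "theta n X = (\<lambda>(r, \<alpha>). let F = function_field n X; y = y_coord n X; z = y 2 in
     (z [^]\<^bsub>F\<^esub> r \<otimes>\<^bsub>F\<^esub> inv\<^bsub>F\<^esub> (\<Otimes>\<^bsub>F\<^esub>j\<in>{3..n+1}. y j [^]\<^bsub>F\<^esub> \<alpha> j)) \<odot>\<^bsub>mero_forms n X\<^esub> differential n X z)"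

text \<open>The sum is taken in \<^typ>\<open>int\<close>, so that no \<open>r\<close> is admitted when it is less than 2.\<close>

definition theta_index :: "nat \<Rightarrow> nat \<Rightarrow> (int \<times> (nat \<Rightarrow> nat)) set" where
  "theta_index k n = {(r, \<alpha>). \<alpha> \<in> {3..n+1} \<rightarrow>\<^sub>E {0..k-1} \<and>
      0 \<le> r \<and> r \<le> (\<Sum>j=3..n+1. int (\<alpha> j)) - 2}"

end

theory Submission
  imports Defs "HOL-Computational_Algebra.Formal_Laurent_Series"
begin

text \<open>The affine part of the curve is given by \<open>y_j^k = - (\<mu>_j + z^k)\<close> for \<open>j = 3, \<dots>, n + 1\<close>, with distinct
  nonzero \<open>\<mu>_j\<close>. Its function field is generated over \<open>K(z)\<close> by \<open>k\<close>-th roots, with the group of all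
  substitutions \<open>y_j \<mapsto> \<zeta>_j y_j\<close> (\<open>\<zeta>_j^k = 1\<close>) acting, and a meromorphic form is uniquely a sum
  \<open>\<Sum>\<alpha>. f_\<alpha>(z) dz / \<Prod>j. y_j^\<alpha>_j\<close> with \<open>0 \<le> \<alpha>_j < k\<close> and rational functions \<open>f_\<alpha>\<close>. The summands are
  the isotypical parts for the group. As the group permutes the points of the curve, the form is regular
  everywhere iff every summand is, and for one summand this is a matter of orders. Where \<open>y_l = 0\<close>, the
  function \<open>y_l\<close> is a local parameter and \<open>dz\<close> has a zero of order \<open>k - 1\<close>, which is at least \<open>\<alpha>_l\<close> but
  cannot make up for a pole of \<open>f_\<alpha>\<close>, as that has order at least \<open>k\<close>; over all other finite values of \<open>z\<close> the
  \<open>y_j\<close> are units. Hence \<open>f_\<alpha>\<close> is a polynomial, and at infinity, where \<open>dz\<close> has a double pole and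
  every \<open>y_j\<close> a simple one, regularity says \<open>deg f_\<alpha> \<le> \<Sum>j. \<alpha>_j - 2\<close>. So the monomials \<open>z^r\<close> with
  \<open>0 \<le> r \<le> \<Sum>j. \<alpha>_j - 2\<close> give a basis.

  Everything is computed in the field of formal Laurent series in one variable \<open>u\<close>. A nonconstant solution
  \<open>x\<close> of the equations in Laurent series embeds the function field into that field, and it sends a form
  \<open>f dg\<close> to the coefficient \<open>f(x) g(x)'\<close> of \<open>du\<close>. Every point of the curve is the centre of such a
  solution (\<open>branch_unramified\<close>, \<open>branch_ramified\<close>, \<open>branch_infinity\<close>), because units have \<open>k\<close>-th roots among the
  power series when \<open>k\<close> is invertible; regular forms are sent to power series
  (\<open>regular_integral\<close>). That the function field is a field, that is, that the curve is irreducible, is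
  \<open>coord_vanish\<close>: a polynomial in the coordinates that vanishes along a single nonconstant solution
  vanishes on the whole curve. That the differentials are one-dimensional over the function field follows from
  \<open>k y_j^(k - 1) dy_j = - k z^(k - 1) dz\<close> (\<open>all_multiples\<close>).

  With these tools, \<open>theta_regular\<close> shows that the proposed forms are regular, \<open>theta_coeff_independent\<close>
  separates them by averaging over the group, and \<open>regular_in_W\<close> decomposes a regular form, splitting off one
  coordinate at a time (\<open>from_W_main\<close>) until only the analysis of orders for rational functions of \<open>z\<close>
  remains.\<close>

section \<open>Quotient modules and Kaehler differentials\<close>

locale quotient_of_module = Module.module R M for R (structure) and M :: "('a, 'c) module" (structure) +
  fixes N
  assumes submod: "submodule R N M"
begin

abbreviation "Q \<equiv> quotient_module M N"

lemma N_subset: "N \<subseteq> carrier M"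
  using submod by (rule submodule.subset)

lemma abelian_subgroup_N: "abelian_subgroup N M"
proof (rule abelian_subgroupI3)
  show "additive_subgroup N M"
  proof (intro additive_subgroup.intro subgroup.intro)
    show "N \<subseteq> carrier (add_monoid M)" using N_subset by simp
    fix x y assume "x \<in> N" "y \<in> N"
    then show "x \<otimes>\<^bsub>add_monoid M\<^esub> y \<in> N" using submodule.m_closed[OF submod] by simp
  next
    show "\<one>\<^bsub>add_monoid M\<^esub> \<in> N" using submodule.zero_closed[OF submod] by simp
  next
    fix x assume x: "x \<in> N"
    then have xM: "x \<in> carrier M" using N_subset by auto
    have "(\<ominus>\<^bsub>R\<^esub> \<one>\<^bsub>R\<^esub>) \<odot>\<^bsub>M\<^esub> x \<in> N" using submodule.smult_closed[OF submod] x by simp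
    then have "\<ominus>\<^bsub>M\<^esub> x \<in> N" using smult_l_minus[OF R.one_closed xM] smult_one[OF xM] by simp
    then show "inv\<^bsub>add_monoid M\<^esub> x \<in> N" by (simp add: a_inv_def)
  qed
qed (rule M.abelian_group_axioms)

interpretation sub: abelian_subgroup N M by (rule abelian_subgroup_N)

lemma carrier_Q: "carrier Q = (\<lambda>u. N +>\<^bsub>M\<^esub> u) ` carrier M"
  by (auto simp: quotient_module_def A_RCOSETS_def')

lemma coset_in_Q [simp]: "u \<in> carrier M \<Longrightarrow> N +>\<^bsub>M\<^esub> u \<in> carrier Q"
  by (auto simp: carrier_Q)

lemma add_Q: "u \<in> carrier M \<Longrightarrow> v \<in> carrier M \<Longrightarrow>
    (N +>\<^bsub>M\<^esub> u) \<oplus>\<^bsub>Q\<^esub> (N +>\<^bsub>M\<^esub> v) = N +>\<^bsub>M\<^esub> (u \<oplus>\<^bsub>M\<^esub> v)"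
  using sub.a_rcos_sum by (simp add: quotient_module_def)

lemma zero_Q: "\<zero>\<^bsub>Q\<^esub> = N +>\<^bsub>M\<^esub> \<zero>\<^bsub>M\<^esub>"
  using sub.a_rcos_const[OF submodule.zero_closed[OF submod]] by (simp add: quotient_module_def)

lemma coset_eq_iff:
  assumes "u \<in> carrier M" "v \<in> carrier M"
  shows "N +>\<^bsub>M\<^esub> u = N +>\<^bsub>M\<^esub> v \<longleftrightarrow> u \<ominus>\<^bsub>M\<^esub> v \<in> N"
proof
  assume "N +>\<^bsub>M\<^esub> u = N +>\<^bsub>M\<^esub> v"
  then have "u \<in> N +>\<^bsub>M\<^esub> v" using sub.a_rcos_self[OF assms(1)] by simp
  then show "u \<ominus>\<^bsub>M\<^esub> v \<in> N" using sub.a_rcos_module[of v u] assms by (simp add: a_minus_def M.abelian_group_axioms)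
next
  assume "u \<ominus>\<^bsub>M\<^esub> v \<in> N"
  then have "u \<in> N +>\<^bsub>M\<^esub> v"
    using sub.a_rcos_module[of v u] assms by (simp add: a_minus_def M.abelian_group_axioms)
  then show "N +>\<^bsub>M\<^esub> u = N +>\<^bsub>M\<^esub> v"
    using sub.a_repr_independence'[of u v] assms by simp
qed

text \<open>The representatives of a coset differ by elements of \<open>N\<close>, and \<open>N\<close> is stable under scalars, so that the
  union over the representatives is one coset.\<close>

lemma smult_Q:
  assumes a: "a \<in> carrier R" and u: "u \<in> carrier M"
  shows "a \<odot>\<^bsub>Q\<^esub> (N +>\<^bsub>M\<^esub> u) = N +>\<^bsub>M\<^esub> (a \<odot>\<^bsub>M\<^esub> u)"
proof -
  have "N +>\<^bsub>M\<^esub> (a \<odot>\<^bsub>M\<^esub> w) = N +>\<^bsub>M\<^esub> (a \<odot>\<^bsub>M\<^esub> u)" if w: "w \<in> N +>\<^bsub>M\<^esub> u" for w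
  proof -
    have wM: "w \<in> carrier M" using w u sub.a_elemrcos_carrier by blast
    have "w \<ominus>\<^bsub>M\<^esub> u \<in> N"
      using sub.a_rcos_module[of u w] w u wM M.abelian_group_axioms by (simp add: a_minus_def)
    then have "a \<odot>\<^bsub>M\<^esub> (w \<ominus>\<^bsub>M\<^esub> u) \<in> N" using a submodule.smult_closed[OF submod] by simp
    then have "(a \<odot>\<^bsub>M\<^esub> w) \<ominus>\<^bsub>M\<^esub> (a \<odot>\<^bsub>M\<^esub> u) \<in> N"
      using a u wM by (simp add: a_minus_def smult_r_distr smult_r_minus)
    then show ?thesis using coset_eq_iff a u wM by simp
  qed
  moreover have "u \<in> N +>\<^bsub>M\<^esub> u" using u by (rule sub.a_rcos_self)
  ultimately have "(\<Union>w\<in>N +>\<^bsub>M\<^esub> u. N +>\<^bsub>M\<^esub> (a \<odot>\<^bsub>M\<^esub> w)) = N +>\<^bsub>M\<^esub> (a \<odot>\<^bsub>M\<^esub> u)" by blast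
  then show ?thesis by (simp add: quotient_module_def)
qed

lemma module_Q: "Module.module R Q"
proof (rule module_criteria)
  show "cring R" by (rule R.cring_axioms)
  show "\<zero>\<^bsub>Q\<^esub> \<in> carrier Q" by (simp add: zero_Q)
  show "\<forall>v w. v \<in> carrier Q \<and> w \<in> carrier Q \<longrightarrow> v \<oplus>\<^bsub>Q\<^esub> w \<in> carrier Q"
    by (auto simp: carrier_Q add_Q)
  show "\<forall>v\<in>carrier Q. \<exists>neg_v\<in>carrier Q. v \<oplus>\<^bsub>Q\<^esub> neg_v = \<zero>\<^bsub>Q\<^esub>"
  proof
    fix v assume "v \<in> carrier Q"
    then obtain u where u: "u \<in> carrier M" "v = N +>\<^bsub>M\<^esub> u" by (auto simp: carrier_Q)
    then have "v \<oplus>\<^bsub>Q\<^esub> (N +>\<^bsub>M\<^esub> (\<ominus>\<^bsub>M\<^esub> u)) = \<zero>\<^bsub>Q\<^esub>" by (simp add: add_Q zero_Q M.r_neg)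
    then show "\<exists>neg_v\<in>carrier Q. v \<oplus>\<^bsub>Q\<^esub> neg_v = \<zero>\<^bsub>Q\<^esub>" using u by auto
  qed
  show "\<forall>c v. c \<in> carrier R \<and> v \<in> carrier Q \<longrightarrow> c \<odot>\<^bsub>Q\<^esub> v \<in> carrier Q"
    by (auto simp: carrier_Q smult_Q)
  show "\<forall>v w. v \<in> carrier Q \<and> w \<in> carrier Q \<longrightarrow> v \<oplus>\<^bsub>Q\<^esub> w = w \<oplus>\<^bsub>Q\<^esub> v"
    by (auto simp: carrier_Q add_Q M.a_comm)
  show "\<forall>v w x. v \<in> carrier Q \<and> w \<in> carrier Q \<and> x \<in> carrier Q \<longrightarrow>
      v \<oplus>\<^bsub>Q\<^esub> w \<oplus>\<^bsub>Q\<^esub> x = v \<oplus>\<^bsub>Q\<^esub> (w \<oplus>\<^bsub>Q\<^esub> x)"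
    by (auto simp: carrier_Q add_Q M.a_assoc)
  show "\<forall>v\<in>carrier Q. v \<oplus>\<^bsub>Q\<^esub> \<zero>\<^bsub>Q\<^esub> = v"
    by (auto simp: carrier_Q add_Q zero_Q)
  show "\<forall>a b v. a \<in> carrier R \<and> b \<in> carrier R \<and> v \<in> carrier Q \<longrightarrow>
      (a \<otimes>\<^bsub>R\<^esub> b) \<odot>\<^bsub>Q\<^esub> v = a \<odot>\<^bsub>Q\<^esub> (b \<odot>\<^bsub>Q\<^esub> v)"
    by (auto simp: carrier_Q smult_Q smult_assoc1)
  show "\<forall>v\<in>carrier Q. \<one>\<^bsub>R\<^esub> \<odot>\<^bsub>Q\<^esub> v = v"
    by (auto simp: carrier_Q smult_Q)
  show "\<forall>a b v. a \<in> carrier R \<and> b \<in> carrier R \<and> v \<in> carrier Q \<longrightarrow>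
      (a \<oplus>\<^bsub>R\<^esub> b) \<odot>\<^bsub>Q\<^esub> v = a \<odot>\<^bsub>Q\<^esub> v \<oplus>\<^bsub>Q\<^esub> b \<odot>\<^bsub>Q\<^esub> v"
    by (auto simp: carrier_Q smult_Q add_Q smult_l_distr)
  show "\<forall>a v w. a \<in> carrier R \<and> v \<in> carrier Q \<and> w \<in> carrier Q \<longrightarrow>
      a \<odot>\<^bsub>Q\<^esub> (v \<oplus>\<^bsub>Q\<^esub> w) = a \<odot>\<^bsub>Q\<^esub> v \<oplus>\<^bsub>Q\<^esub> a \<odot>\<^bsub>Q\<^esub> w"
    by (auto simp: carrier_Q smult_Q add_Q smult_r_distr)
qed

end

context cring begin

lemma free_module_simps:
  "carrier (free_module R) =
     {u \<in> carrier R \<rightarrow>\<^sub>E carrier R. finite {x \<in> carrier R. u x \<noteq> \<zero>}}"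
  "add (free_module R) = (\<lambda>u v. \<lambda>x\<in>carrier R. u x \<oplus> v x)"
  "zero (free_module R) = (\<lambda>x\<in>carrier R. \<zero>)"
  "c \<odot>\<^bsub>free_module R\<^esub> u = (\<lambda>x\<in>carrier R. c \<otimes> u x)"
  by (simp_all add: free_module_def func_space_def)

lemma module_free_module: "Module.module R (free_module R)"
proof -
  have "submodule R {u \<in> carrier R \<rightarrow>\<^sub>E carrier R. finite {x \<in> carrier R. u x \<noteq> \<zero>}}
      (func_space (carrier R))"
  proof (rule submodule.intro)
    show "Module.module R (func_space (carrier R))" by (rule func_space_is_module)
  next
    show "{u \<in> carrier R \<rightarrow>\<^sub>E carrier R. finite {x \<in> carrier R. u x \<noteq> \<zero>}}
        \<subseteq> carrier (func_space (carrier R))" by (auto simp: func_space_def)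
  next
    fix v w
    assume v: "v \<in> {u \<in> carrier R \<rightarrow>\<^sub>E carrier R. finite {x \<in> carrier R. u x \<noteq> \<zero>}}"
      and w: "w \<in> {u \<in> carrier R \<rightarrow>\<^sub>E carrier R. finite {x \<in> carrier R. u x \<noteq> \<zero>}}"
    have "finite {x \<in> carrier R. v x \<oplus> w x \<noteq> \<zero>}"
      by (rule finite_subset[of _ "{x \<in> carrier R. v x \<noteq> \<zero>} \<union> {x \<in> carrier R. w x \<noteq> \<zero>}"])
        (use v w in auto)
    then show "v \<oplus>\<^bsub>func_space (carrier R)\<^esub> w
        \<in> {u \<in> carrier R \<rightarrow>\<^sub>E carrier R. finite {x \<in> carrier R. u x \<noteq> \<zero>}}"
      using v w by (auto simp: func_space_def PiE_mem cong: conj_cong)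
  next
    show "\<zero>\<^bsub>func_space (carrier R)\<^esub>
        \<in> {u \<in> carrier R \<rightarrow>\<^sub>E carrier R. finite {x \<in> carrier R. u x \<noteq> \<zero>}}"
      by (auto simp: func_space_def cong: conj_cong)
  next
    fix c v
    assume c: "c \<in> carrier R"
      and v: "v \<in> {u \<in> carrier R \<rightarrow>\<^sub>E carrier R. finite {x \<in> carrier R. u x \<noteq> \<zero>}}"
    have "finite {x \<in> carrier R. c \<otimes> v x \<noteq> \<zero>}"
      by (rule finite_subset[of _ "{x \<in> carrier R. v x \<noteq> \<zero>}"]) (use c v in auto)
    then show "c \<odot>\<^bsub>func_space (carrier R)\<^esub> v
        \<in> {u \<in> carrier R \<rightarrow>\<^sub>E carrier R. finite {x \<in> carrier R. u x \<noteq> \<zero>}}"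
      using c v by (auto simp: func_space_def PiE_mem cong: conj_cong)
  qed
  then show ?thesis
    unfolding free_module_def by (rule module.submodule_is_module[OF func_space_is_module])
qed

lemma symbol_closed [simp]: "x \<in> carrier R \<Longrightarrow> symbol R x \<in> carrier (free_module R)"
proof -
  assume x: "x \<in> carrier R"
  have "finite {y \<in> carrier R. (if y = x then \<one> else \<zero>) \<noteq> \<zero>}"
    by (rule finite_subset[of _ "{x}"]) auto
  then show ?thesis by (auto simp: free_module_simps symbol_def cong: conj_cong)
qed

text \<open>The support is finite, and subtracting a multiple of a symbol removes one element from it.\<close>

lemma free_module_induct [consumes 1, case_names zero step]:
  assumes u: "u \<in> carrier (free_module R)"
    and zero: "P \<zero>\<^bsub>free_module R\<^esub>"
    and step: "\<And>a x v. a \<in> carrier R \<Longrightarrow> x \<in> carrier R \<Longrightarrow> v \<in> carrier (free_module R) \<Longrightarrow> P v \<Longrightarrow>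
      P (a \<odot>\<^bsub>free_module R\<^esub> symbol R x \<oplus>\<^bsub>free_module R\<^esub> v)"
  shows "P u"
proof -
  have "finite {x \<in> carrier R. u x \<noteq> \<zero>}" using u by (simp add: free_module_simps)
  then show ?thesis using u
  proof (induction "{x \<in> carrier R. u x \<noteq> \<zero>}" arbitrary: u rule: finite_induct)
    case empty
    then have "u = \<zero>\<^bsub>free_module R\<^esub>"
      by (auto simp: free_module_simps fun_eq_iff restrict_def PiE_def extensional_def)
    then show ?case using zero by simp
  next
    case (insert x S)
    have xS: "x \<in> carrier R" "u x \<noteq> \<zero>" using insert.hyps(4) by auto
    have uu: "u \<in> carrier R \<rightarrow>\<^sub>E carrier R" using insert.prems by (simp add: free_module_simps)
    then have ux: "u x \<in> carrier R" using xS by auto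
    define v where "v = (\<lambda>y\<in>carrier R. if y = x then \<zero> else u y)"
    have S: "S = {y \<in> carrier R. v y \<noteq> \<zero>}"
      using insert.hyps(2,4) by (auto simp: v_def)
    have vM: "v \<in> carrier (free_module R)"
      using uu insert.hyps(1) S by (auto simp: free_module_simps v_def)
    have "P v" using insert.hyps(3)[OF S vM] .
    moreover have "u = u x \<odot>\<^bsub>free_module R\<^esub> symbol R x \<oplus>\<^bsub>free_module R\<^esub> v"
    proof
      fix y show "u y = (u x \<odot>\<^bsub>free_module R\<^esub> symbol R x \<oplus>\<^bsub>free_module R\<^esub> v) y"
      proof (cases "y \<in> carrier R")
        case True
        then have "u y \<in> carrier R" using uu by auto
        then show ?thesis using True xS ux by (simp add: free_module_simps symbol_def v_def)
      next
        case False
        then show ?thesis using uu by (auto simp: free_module_simps PiE_def extensional_def)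
      qed
    qed
    ultimately show ?case using step[OF ux xS(1) vM] by metis
  qed
qed

end

text \<open>Requiring \<open>\<one> \<in> A\<close> makes \<open>d \<one> = \<zero>\<close> one of the relations; differentials of inverses are computed
  from it.\<close>

locale kaehler_module = F: field F for F (structure) +
  fixes A
  assumes A_closed: "A \<subseteq> carrier F" and one_A: "\<one> \<in> A"
begin

abbreviation "FM \<equiv> free_module F"
abbreviation "N \<equiv> kaehler_submodule F A"
abbreviation "\<Omega> \<equiv> kaehler F A"
abbreviation "d \<equiv> kaehler_d F A"

sublocale FM: Module.module F FM by (rule F.module_free_module)

lemma relations_closed: "kaehler_relations F A \<subseteq> carrier FM"
proof -
  have "symbol F (x \<oplus> y) \<ominus>\<^bsub>FM\<^esub> (symbol F x \<oplus>\<^bsub>FM\<^esub> symbol F y) \<in> carrier FM"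
    "symbol F (x \<otimes> y) \<ominus>\<^bsub>FM\<^esub> (x \<odot>\<^bsub>FM\<^esub> symbol F y \<oplus>\<^bsub>FM\<^esub> y \<odot>\<^bsub>FM\<^esub> symbol F x) \<in> carrier FM"
    if "x \<in> carrier F" "y \<in> carrier F" for x y
    using that by simp_all
  then show ?thesis using A_closed by (fastforce simp: kaehler_relations_def Let_def)
qed

lemma N_def: "N = FM.span (kaehler_relations F A)"
  by (simp add: kaehler_submodule_def)

lemma submodule_N: "submodule F N FM"
  unfolding N_def by (rule FM.span_is_submodule[OF relations_closed])

sublocale Q: quotient_of_module F FM N
  by (rule quotient_of_module.intro[OF FM.module_axioms quotient_of_module_axioms.intro[OF submodule_N]])

lemma \<Omega>_eq: "\<Omega> = quotient_module FM N"
  by (simp add: kaehler_def)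

sublocale \<Omega>: Module.module F \<Omega>
  unfolding \<Omega>_eq by (rule Q.module_Q)

lemma d_closed [simp]: "x \<in> carrier F \<Longrightarrow> d x \<in> carrier \<Omega>"
  by (simp add: kaehler_d_def \<Omega>_eq)

lemma relation_in_N: "u \<in> kaehler_relations F A \<Longrightarrow> u \<in> N"
  using FM.in_own_span[OF relations_closed] by (auto simp: N_def)

lemma d_add:
  assumes "x \<in> carrier F" "y \<in> carrier F"
  shows "d (x \<oplus> y) = d x \<oplus>\<^bsub>\<Omega>\<^esub> d y"
proof -
  have "symbol F (x \<oplus> y) \<ominus>\<^bsub>FM\<^esub> (symbol F x \<oplus>\<^bsub>FM\<^esub> symbol F y) \<in> N"
    by (rule relation_in_N) (use assms in \<open>unfold kaehler_relations_def Let_def, blast\<close>)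
  then show ?thesis using assms
    by (simp add: kaehler_d_def \<Omega>_eq Q.add_Q Q.coset_eq_iff)
qed

lemma d_mult:
  assumes "x \<in> carrier F" "y \<in> carrier F"
  shows "d (x \<otimes> y) = x \<odot>\<^bsub>\<Omega>\<^esub> d y \<oplus>\<^bsub>\<Omega>\<^esub> y \<odot>\<^bsub>\<Omega>\<^esub> d x"
proof -
  have "symbol F (x \<otimes> y) \<ominus>\<^bsub>FM\<^esub> (x \<odot>\<^bsub>FM\<^esub> symbol F y \<oplus>\<^bsub>FM\<^esub> y \<odot>\<^bsub>FM\<^esub> symbol F x) \<in> N"
    by (rule relation_in_N) (use assms in \<open>unfold kaehler_relations_def Let_def, blast\<close>)
  then show ?thesis using assms
    by (simp add: kaehler_d_def \<Omega>_eq Q.add_Q Q.smult_Q Q.coset_eq_iff)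
qed

lemma d_const: "a \<in> A \<Longrightarrow> d a = \<zero>\<^bsub>\<Omega>\<^esub>"
proof -
  assume a: "a \<in> A"
  then have aF: "a \<in> carrier F" using A_closed by auto
  have mz: "\<ominus>\<^bsub>FM\<^esub> \<zero>\<^bsub>FM\<^esub> = \<zero>\<^bsub>FM\<^esub>"
    by (rule FM.M.minus_equality) simp_all
  have "symbol F a \<in> N"
    by (rule relation_in_N) (use a in \<open>unfold kaehler_relations_def Let_def, blast\<close>)
  then have "symbol F a \<ominus>\<^bsub>FM\<^esub> \<zero>\<^bsub>FM\<^esub> \<in> N" 
    unfolding a_minus_def mz using aF by simp
  then show ?thesis using aF by (simp add: kaehler_d_def \<Omega>_eq Q.zero_Q Q.coset_eq_iff)
qed

lemma \<Omega>_induct [consumes 1, case_names zero step]: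
  assumes \<omega>: "\<omega> \<in> carrier \<Omega>"
    and P0: "P \<zero>\<^bsub>\<Omega>\<^esub>"
    and *: "\<And>a x \<eta>. a \<in> carrier F \<Longrightarrow> x \<in> carrier F \<Longrightarrow> \<eta> \<in> carrier \<Omega> \<Longrightarrow> P \<eta> \<Longrightarrow>
      P (a \<odot>\<^bsub>\<Omega>\<^esub> d x \<oplus>\<^bsub>\<Omega>\<^esub> \<eta>)"
  shows "P \<omega>"
proof -
  obtain u where u: "u \<in> carrier FM" "\<omega> = N +>\<^bsub>FM\<^esub> u"
    using \<omega> by (auto simp: \<Omega>_eq Q.carrier_Q)
  have "P (N +>\<^bsub>FM\<^esub> u)" using u(1)
  proof (induction rule: F.free_module_induct)
    case zero
    then show ?case using P0 by (simp add: \<Omega>_eq Q.zero_Q)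
  next
    case (step a x v)
    have "N +>\<^bsub>FM\<^esub> (a \<odot>\<^bsub>FM\<^esub> symbol F x \<oplus>\<^bsub>FM\<^esub> v) = a \<odot>\<^bsub>\<Omega>\<^esub> d x \<oplus>\<^bsub>\<Omega>\<^esub> (N +>\<^bsub>FM\<^esub> v)"
      using step.hyps by (simp add: kaehler_d_def \<Omega>_eq Q.add_Q Q.smult_Q)
    then show ?case using *[of a x "N +>\<^bsub>FM\<^esub> v"] step by (simp add: \<Omega>_eq)
  qed
  then show ?thesis using u by simp
qed

text \<open>For \<open>F\<close> a function field and \<open>z\<close> a separating element this is all of \<open>F\<close>. The lemmas below show that it is a
  subfield which is closed under extraction of roots of suitable degree; that is how the module of
  differentials is seen to be generated by \<open>d z\<close>.\<close>

definition diff_multiples :: "'a \<Rightarrow> 'a set" where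
  "diff_multiples z = {x \<in> carrier F. \<exists>f\<in>carrier F. d x = f \<odot>\<^bsub>\<Omega>\<^esub> d z}"

context
  fixes z assumes z: "z \<in> carrier F"
begin

lemma diff_multiples_self: "z \<in> diff_multiples z"
proof -
  have "d z = \<one> \<odot>\<^bsub>\<Omega>\<^esub> d z" using z by simp
  then show ?thesis unfolding diff_multiples_def using z by blast
qed

lemma diff_multiples_const: "a \<in> A \<Longrightarrow> a \<in> diff_multiples z"
proof -
  assume a: "a \<in> A"
  have "d a = \<zero> \<odot>\<^bsub>\<Omega>\<^esub> d z" using z a by (simp add: d_const)
  then show ?thesis unfolding diff_multiples_def using a A_closed by blast
qed

lemma diff_multiples_add: "x \<in> diff_multiples z \<Longrightarrow> y \<in> diff_multiples z \<Longrightarrow> x \<oplus> y \<in> diff_multiples z"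
proof -
  assume "x \<in> diff_multiples z" "y \<in> diff_multiples z"
  then obtain f g where *: "x \<in> carrier F" "y \<in> carrier F" "f \<in> carrier F" "g \<in> carrier F"
    "d x = f \<odot>\<^bsub>\<Omega>\<^esub> d z" "d y = g \<odot>\<^bsub>\<Omega>\<^esub> d z" by (auto simp: diff_multiples_def)
  then have "d (x \<oplus> y) = (f \<oplus> g) \<odot>\<^bsub>\<Omega>\<^esub> d z" using z by (simp add: d_add \<Omega>.smult_l_distr)
  then show ?thesis unfolding diff_multiples_def using * by blast
qed

lemma diff_multiples_mult: "x \<in> diff_multiples z \<Longrightarrow> y \<in> diff_multiples z \<Longrightarrow> x \<otimes> y \<in> diff_multiples z"
proof -
  assume "x \<in> diff_multiples z" "y \<in> diff_multiples z"
  then obtain f g where *: "x \<in> carrier F" "y \<in> carrier F" "f \<in> carrier F" "g \<in> carrier F"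
    "d x = f \<odot>\<^bsub>\<Omega>\<^esub> d z" "d y = g \<odot>\<^bsub>\<Omega>\<^esub> d z" by (auto simp: diff_multiples_def)
  then have "d (x \<otimes> y) = (x \<otimes> g \<oplus> y \<otimes> f) \<odot>\<^bsub>\<Omega>\<^esub> d z"
    using z by (simp add: d_mult \<Omega>.smult_l_distr \<Omega>.smult_assoc1)
  then show ?thesis unfolding diff_multiples_def using * by blast
qed

lemma smult_cancel:
  assumes "a \<in> carrier F" "a \<noteq> \<zero>" "\<omega> \<in> carrier \<Omega>" "a \<odot>\<^bsub>\<Omega>\<^esub> \<omega> = f \<odot>\<^bsub>\<Omega>\<^esub> \<eta>" "f \<in> carrier F" "\<eta> \<in> carrier \<Omega>"
  shows "\<omega> = (inv a \<otimes> f) \<odot>\<^bsub>\<Omega>\<^esub> \<eta>"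
proof -
  have U: "a \<in> Units F" using assms by (simp add: F.field_Units)
  have "\<omega> = (inv a \<otimes> a) \<odot>\<^bsub>\<Omega>\<^esub> \<omega>" using U assms(3) by simp
  also have "\<dots> = inv a \<odot>\<^bsub>\<Omega>\<^esub> (a \<odot>\<^bsub>\<Omega>\<^esub> \<omega>)"
    using assms(1,3) U by (intro \<Omega>.smult_assoc1) simp_all
  also have "\<dots> = (inv a \<otimes> f) \<odot>\<^bsub>\<Omega>\<^esub> \<eta>"
    unfolding assms(4) using assms(5,6) U by (intro \<Omega>.smult_assoc1[symmetric]) simp_all
  finally show ?thesis .
qed

text \<open>Solve \<open>\<zero> = d (x \<otimes> inv x)\<close> for \<open>d (inv x)\<close>.\<close>

lemma diff_multiples_inv: "x \<in> diff_multiples z \<Longrightarrow> x \<noteq> \<zero> \<Longrightarrow> inv x \<in> diff_multiples z"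
proof -
  assume "x \<in> diff_multiples z" and x0: "x \<noteq> \<zero>"
  then obtain f where *: "x \<in> carrier F" "f \<in> carrier F" "d x = f \<odot>\<^bsub>\<Omega>\<^esub> d z"
    by (auto simp: diff_multiples_def)
  have U: "x \<in> Units F" using * x0 by (simp add: F.field_Units)
  have ix: "inv x \<in> carrier F" using U by simp
  have "x \<odot>\<^bsub>\<Omega>\<^esub> d (inv x) \<oplus>\<^bsub>\<Omega>\<^esub> inv x \<odot>\<^bsub>\<Omega>\<^esub> d x = d (x \<otimes> inv x)"
    using * ix by (simp add: d_mult)
  also have "\<dots> = \<zero>\<^bsub>\<Omega>\<^esub>" using U one_A by (simp add: d_const)
  finally have "x \<odot>\<^bsub>\<Omega>\<^esub> d (inv x) = \<ominus>\<^bsub>\<Omega>\<^esub> (inv x \<odot>\<^bsub>\<Omega>\<^esub> d x)"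
    using * ix z \<Omega>.M.minus_equality by simp
  also have "\<dots> = (\<ominus> (inv x \<otimes> f)) \<odot>\<^bsub>\<Omega>\<^esub> d z"
    using * ix z by (simp add: \<Omega>.smult_l_minus \<Omega>.smult_assoc1)
  finally have "d (inv x) = (inv x \<otimes> \<ominus> (inv x \<otimes> f)) \<odot>\<^bsub>\<Omega>\<^esub> d z"
    by (rule smult_cancel[rotated 3]) (use * ix z x0 in auto)
  then show ?thesis unfolding diff_multiples_def using * ix by blast
qed

lemma d_pow:
  assumes "y \<in> carrier F"
  shows "d (y [^] Suc m) = (add_pow F (Suc m) (y [^] m)) \<odot>\<^bsub>\<Omega>\<^esub> d y"
proof (induction m)
  case 0
  then show ?case using assms by simp
next
  case (Suc m)
  have "d (y [^] Suc (Suc m)) = d (y [^] Suc m \<otimes> y)" by simp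
  also have "\<dots> = y [^] Suc m \<odot>\<^bsub>\<Omega>\<^esub> d y \<oplus>\<^bsub>\<Omega>\<^esub> y \<odot>\<^bsub>\<Omega>\<^esub> (add_pow F (Suc m) (y [^] m) \<odot>\<^bsub>\<Omega>\<^esub> d y)"
    using assms Suc by (subst d_mult) auto
  also have "\<dots> = (y [^] Suc m \<oplus> add_pow F (Suc m) (y [^] m) \<otimes> y) \<odot>\<^bsub>\<Omega>\<^esub> d y"
    using assms by (simp add: \<Omega>.smult_l_distr \<Omega>.smult_assoc1 F.m_comm del: F.add.nat_pow_Suc)
  also have "y [^] Suc m \<oplus> add_pow F (Suc m) (y [^] m) \<otimes> y = add_pow F (Suc (Suc m)) (y [^] Suc m)"
    using assms by (simp add: F.add_pow_ldistr F.a_comm F.l_distr)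
  finally show ?case .
qed

text \<open>The Leibniz rule gives \<open>(m + 1) y^m dy = d (y^(m + 1))\<close>, and by hypothesis the scalar on the left is
  invertible. This is where the characteristic must not divide the exponent.\<close>

lemma diff_multiples_root:
  assumes y: "y \<in> carrier F" and ym: "y [^] Suc m \<in> diff_multiples z"
    and nz: "add_pow F (Suc m) (y [^] m) \<noteq> \<zero>"
  shows "y \<in> diff_multiples z"
proof -
  obtain f where f: "f \<in> carrier F" "d (y [^] Suc m) = f \<odot>\<^bsub>\<Omega>\<^esub> d z"
    using ym by (auto simp: diff_multiples_def)
  have "d y = (inv (add_pow F (Suc m) (y [^] m)) \<otimes> f) \<odot>\<^bsub>\<Omega>\<^esub> d z"
    by (rule smult_cancel) (use nz y f z d_pow[OF y] in auto)
  moreover have "inv (add_pow F (Suc m) (y [^] m)) \<otimes> f \<in> carrier F"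
    using nz y f by (auto simp: F.field_Units intro!: F.m_closed)
  ultimately show ?thesis unfolding diff_multiples_def using y by blast
qed

lemma \<Omega>_eq_multiples:
  assumes "diff_multiples z = carrier F" and "\<omega> \<in> carrier \<Omega>"
  shows "\<exists>f\<in>carrier F. \<omega> = f \<odot>\<^bsub>\<Omega>\<^esub> d z"
  using assms(2)
proof (induction rule: \<Omega>_induct)
  case zero
  have "\<zero>\<^bsub>\<Omega>\<^esub> = \<zero> \<odot>\<^bsub>\<Omega>\<^esub> d z" using z by simp
  then show ?case by blast
next
  case (step a x \<eta>)
  then have "x \<in> diff_multiples z" using assms(1) by simp
  then obtain f g where fg: "f \<in> carrier F" "g \<in> carrier F" "\<eta> = f \<odot>\<^bsub>\<Omega>\<^esub> d z" "d x = g \<odot>\<^bsub>\<Omega>\<^esub> d z"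
    using step.IH unfolding diff_multiples_def by blast
  have "a \<odot>\<^bsub>\<Omega>\<^esub> d x \<oplus>\<^bsub>\<Omega>\<^esub> \<eta> = (a \<otimes> g \<oplus> f) \<odot>\<^bsub>\<Omega>\<^esub> d z"
    using step.hyps fg z by (simp add: \<Omega>.smult_l_distr \<Omega>.smult_assoc1)
  then show ?case using step.hyps fg by (metis F.a_closed F.m_closed)
qed

end

end

text \<open>A derivation \<open>D\<close> into a field on which \<open>F\<close> acts through \<open>T\<close>. By the universal property of differentials it
  extends to forms, with \<open>f dg\<close> going to \<open>T f * D g\<close>; the target is a field type, in which identities between
  forms become ordinary computations.\<close>

locale kaehler_realization = kaehler_module F A for F (structure) and A +
  fixes T D :: "'a \<Rightarrow> 'k::field"
  assumes T_add: "x \<in> carrier F \<Longrightarrow> y \<in> carrier F \<Longrightarrow> T (x \<oplus> y) = T x + T y"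
    and T_mult: "x \<in> carrier F \<Longrightarrow> y \<in> carrier F \<Longrightarrow> T (x \<otimes> y) = T x * T y"
    and T_one: "T \<one> = 1"
    and D_add: "x \<in> carrier F \<Longrightarrow> y \<in> carrier F \<Longrightarrow> D (x \<oplus> y) = D x + D y"
    and D_mult: "x \<in> carrier F \<Longrightarrow> y \<in> carrier F \<Longrightarrow> D (x \<otimes> y) = T x * D y + T y * D x"
    and D_const: "a \<in> A \<Longrightarrow> D a = 0"
begin

lemma T_zero: "T \<zero> = 0"
proof -
  have "T \<zero> + 0 = T \<zero> + T \<zero>" using T_add[of \<zero> \<zero>] by simp
  then show ?thesis by (simp only: add_left_cancel)
qed

definition free_realize :: "('a \<Rightarrow> 'a) \<Rightarrow> 'k" where
  "free_realize u = (\<Sum>x | x \<in> carrier F \<and> u x \<noteq> \<zero>. T (u x) * D x)"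

lemma free_realize_superset:
  assumes "finite S" "S \<subseteq> carrier F" "{x. x \<in> carrier F \<and> u x \<noteq> \<zero>} \<subseteq> S"
  shows "free_realize u = (\<Sum>x\<in>S. T (u x) * D x)"
  unfolding free_realize_def using assms by (intro sum.mono_neutral_left) (auto simp: T_zero)

lemma free_realize_add:
  assumes "u \<in> carrier FM" "v \<in> carrier FM"
  shows "free_realize (u \<oplus>\<^bsub>FM\<^esub> v) = free_realize u + free_realize v"
proof -
  let ?S = "{x \<in> carrier F. u x \<noteq> \<zero>} \<union> {x \<in> carrier F. v x \<noteq> \<zero>}"
  have fin: "finite ?S" and sub: "?S \<subseteq> carrier F" using assms by (auto simp: F.free_module_simps)
  have cl: "u x \<in> carrier F" "v x \<in> carrier F" if "x \<in> carrier F" for x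
    using that assms by (auto simp: F.free_module_simps)
  have "free_realize (u \<oplus>\<^bsub>FM\<^esub> v) = (\<Sum>x\<in>?S. T ((u \<oplus>\<^bsub>FM\<^esub> v) x) * D x)"
    by (rule free_realize_superset[OF fin sub]) (auto simp: F.free_module_simps)
  also have "\<dots> = (\<Sum>x\<in>?S. T (u x) * D x + T (v x) * D x)"
    using cl by (intro sum.cong) (auto simp: F.free_module_simps T_add distrib_right)
  also have "\<dots> = free_realize u + free_realize v"
    using free_realize_superset[OF fin sub, of u] free_realize_superset[OF fin sub, of v]
    by (simp add: sum.distrib)
  finally show ?thesis .
qed

lemma free_realize_smult:
  assumes "a \<in> carrier F" "u \<in> carrier FM"
  shows "free_realize (a \<odot>\<^bsub>FM\<^esub> u) = T a * free_realize u"
proof -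
  let ?S = "{x \<in> carrier F. u x \<noteq> \<zero>}"
  have fin: "finite ?S" and sub: "?S \<subseteq> carrier F" using assms by (auto simp: F.free_module_simps)
  have cl: "u x \<in> carrier F" if "x \<in> carrier F" for x
    using that assms by (auto simp: F.free_module_simps)
  have "free_realize (a \<odot>\<^bsub>FM\<^esub> u) = (\<Sum>x\<in>?S. T ((a \<odot>\<^bsub>FM\<^esub> u) x) * D x)"
    by (rule free_realize_superset[OF fin sub]) (use assms in \<open>auto simp: F.free_module_simps\<close>)
  also have "\<dots> = (\<Sum>x\<in>?S. T a * (T (u x) * D x))"
    using cl assms by (intro sum.cong) (auto simp: F.free_module_simps T_mult mult_ac)
  also have "\<dots> = T a * free_realize u"
    using free_realize_superset[OF fin sub, of u] by (simp add: sum_distrib_left)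
  finally show ?thesis .
qed

lemma free_realize_symbol: "x \<in> carrier F \<Longrightarrow> free_realize (symbol F x) = D x"
  using free_realize_superset[of "{x}" "symbol F x"]
  by (auto simp: symbol_def T_one split: if_splits)

lemma free_realize_minus:
  assumes "u \<in> carrier FM" "v \<in> carrier FM"
  shows "free_realize (u \<ominus>\<^bsub>FM\<^esub> v) = free_realize u - free_realize v"
proof -
  have "u = (u \<ominus>\<^bsub>FM\<^esub> v) \<oplus>\<^bsub>FM\<^esub> v"
    using assms by (simp add: a_minus_def FM.M.a_assoc FM.M.l_neg)
  then have "free_realize u = free_realize (u \<ominus>\<^bsub>FM\<^esub> v) + free_realize v"
    using assms free_realize_add[of "u \<ominus>\<^bsub>FM\<^esub> v" v] by simp
  then show ?thesis by simp
qed

lemma free_realize_zero: "free_realize \<zero>\<^bsub>FM\<^esub> = 0"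
  using free_realize_superset[of "{}" "\<zero>\<^bsub>FM\<^esub>"] by (auto simp: F.free_module_simps)

text \<open>The three kinds of relations are the three properties required of \<open>D\<close>, and the elements that are sent to
  \<open>0\<close> form a submodule.\<close>

lemma free_realize_N: "u \<in> N \<Longrightarrow> free_realize u = 0"
proof -
  let ?K = "{u \<in> carrier FM. free_realize u = 0}"
  have "submodule F ?K FM"
  proof (rule submodule.intro)
    show "Module.module F FM" by (rule FM.module_axioms)
    show "?K \<subseteq> carrier FM" by auto
    show "\<zero>\<^bsub>FM\<^esub> \<in> ?K" by (simp add: free_realize_zero)
  qed (auto simp: free_realize_add free_realize_smult)
  moreover have "kaehler_relations F A \<subseteq> ?K"
    using relations_closed A_closed D_const
    by (auto simp: kaehler_relations_def Let_def free_realize_minus free_realize_add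
        free_realize_smult free_realize_symbol D_add D_mult subset_iff)
  ultimately have "N \<subseteq> ?K" unfolding N_def by (rule FM.span_is_subset[rotated])
  then show "u \<in> N \<Longrightarrow> free_realize u = 0" by auto
qed

definition realize :: "('a \<Rightarrow> 'a) set \<Rightarrow> 'k" where
  "realize \<omega> = free_realize (SOME u. u \<in> carrier FM \<and> \<omega> = N +>\<^bsub>FM\<^esub> u)"

lemma realize_coset: "u \<in> carrier FM \<Longrightarrow> realize (N +>\<^bsub>FM\<^esub> u) = free_realize u"
proof -
  assume u: "u \<in> carrier FM"
  let ?v = "SOME v. v \<in> carrier FM \<and> N +>\<^bsub>FM\<^esub> u = N +>\<^bsub>FM\<^esub> v"
  have v: "?v \<in> carrier FM \<and> N +>\<^bsub>FM\<^esub> u = N +>\<^bsub>FM\<^esub> ?v"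
    by (rule someI[of _ u]) (use u in auto)
  then have "u \<ominus>\<^bsub>FM\<^esub> ?v \<in> N" using Q.coset_eq_iff u by blast
  then have "free_realize u - free_realize ?v = 0"
    using free_realize_N free_realize_minus[of u ?v] u v by simp
  then show ?thesis by (simp add: realize_def)
qed

lemma realize_add:
  "\<omega> \<in> carrier \<Omega> \<Longrightarrow> \<eta> \<in> carrier \<Omega> \<Longrightarrow> realize (\<omega> \<oplus>\<^bsub>\<Omega>\<^esub> \<eta>) = realize \<omega> + realize \<eta>"
  by (auto simp: \<Omega>_eq Q.carrier_Q Q.add_Q realize_coset free_realize_add)

lemma realize_smult:
  "a \<in> carrier F \<Longrightarrow> \<omega> \<in> carrier \<Omega> \<Longrightarrow> realize (a \<odot>\<^bsub>\<Omega>\<^esub> \<omega>) = T a * realize \<omega>"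
  by (auto simp: \<Omega>_eq Q.carrier_Q Q.smult_Q realize_coset free_realize_smult)

lemma realize_d: "x \<in> carrier F \<Longrightarrow> realize (d x) = D x"
  by (simp add: kaehler_d_def realize_coset free_realize_symbol)

lemma realize_zero: "realize \<zero>\<^bsub>\<Omega>\<^esub> = 0"
  by (simp add: \<Omega>_eq Q.zero_Q realize_coset free_realize_zero)

text \<open>A form \<open>f dz\<close> is sent to \<open>T f * D z\<close>, from which \<open>f\<close> can be recovered.\<close>

lemma realize_inj:
  assumes z: "z \<in> carrier F" and all: "diff_multiples z = carrier F" and Dz: "D z \<noteq> 0"
    and injT: "inj_on T (carrier F)"
  shows "inj_on realize (carrier \<Omega>)"
proof (rule inj_onI)
  fix \<omega> \<eta> assume *: "\<omega> \<in> carrier \<Omega>" "\<eta> \<in> carrier \<Omega>" "realize \<omega> = realize \<eta>"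
  obtain f g where fg: "f \<in> carrier F" "g \<in> carrier F" "\<omega> = f \<odot>\<^bsub>\<Omega>\<^esub> d z" "\<eta> = g \<odot>\<^bsub>\<Omega>\<^esub> d z"
    using \<Omega>_eq_multiples[OF z all] * by metis
  then have "T f * D z = T g * D z" using * z by (simp add: realize_smult realize_d)
  then have "f = g" using Dz fg injT by (auto dest: inj_onD)
  then show "\<omega> = \<eta>" using fg by simp
qed

end

section \<open>Roots of unity\<close>

abbreviation unity_roots :: "nat \<Rightarrow> 'a::field set" where
  "unity_roots k \<equiv> {\<zeta>. \<zeta> ^ k = 1}"

lemma finite_unity_roots: "k > 0 \<Longrightarrow> finite (unity_roots k :: 'a::field set)"
proof -
  assume k: "k > 0"
  have "monom 1 k - 1 \<noteq> (0 :: 'a poly)"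
  proof
    assume "monom 1 k - 1 = (0 :: 'a poly)"
    then have "coeff (monom 1 k - 1 :: 'a poly) k = 0" by simp
    then show False using k by simp
  qed
  then have "finite {x. poly (monom 1 k - 1 :: 'a poly) x = 0}" by (rule poly_roots_finite)
  then show ?thesis by (simp add: poly_monom)
qed

text \<open>The polynomial \<open>X^k - 1\<close> splits, and a multiple root \<open>a\<close> of it would satisfy \<open>k * a^(k - 1) = 0\<close>.\<close>

lemma card_unity_roots:
  assumes k: "k > 0" and kne: "of_nat k \<noteq> (0::'a::alg_closed_field)"
  shows "card (unity_roots k :: 'a set) = k"
proof -
  let ?p = "monom 1 k - 1 :: 'a poly"
  have deg: "degree ?p = k"
  proof -
    have "degree (monom 1 k + (- 1) :: 'a poly) = degree (monom 1 k :: 'a poly)"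
      by (rule degree_add_eq_left) (use k in \<open>simp add: degree_monom_eq\<close>)
    then show ?thesis by (simp add: degree_monom_eq)
  qed
  have p0: "?p \<noteq> 0" using deg k by auto
  define c where "c = lead_coeff ?p"
  have c0: "c \<noteq> 0" using p0 by (simp only: c_def leading_coeff_0_iff) simp
  obtain A where A: "size A = degree ?p" "?p = smult c (\<Prod>x\<in>#A. [:-x, 1:])"
    using alg_closed_imp_factorization[OF p0] unfolding c_def by blast
  have roots: "poly ?p a = 0 \<longleftrightarrow> a \<in># A" for a
  proof -
    have "poly (\<Prod>x\<in>#A. [:-x, 1:]) a = 0 \<longleftrightarrow> a \<in># A"
      by (induction A) auto
    then show ?thesis using A(2) c0 by (metis mult_eq_0_iff poly_smult)
  qed
  have cnt: "count A a \<le> 1" for a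
  proof (rule ccontr)
    assume "\<not> count A a \<le> 1"
    then have "2 \<le> count A a" by simp
    then have "replicate_mset 2 a \<subseteq># A" by (simp add: count_le_replicate_mset_subset_eq)
    then obtain B where B: "A = replicate_mset 2 a + B" by (metis mset_subset_eq_exists_conv)
    define r where "r = smult c (\<Prod>x\<in>#B. [:-x, 1:])"
    have "smult c (\<Prod>x\<in>#A. [:-x, 1:]) = [:-a,1:] * ([:-a,1:] * r)"
      unfolding r_def B by (simp only: numeral_2_eq_2 replicate_mset_Suc replicate_mset_0 image_mset_union
          image_mset_add_mset image_mset_empty prod_mset.union prod_mset.add_mset prod_mset.empty
          mult_smult_right mult.assoc mult_1_left)
    then have pr: "?p = [:-a,1:] * ([:-a,1:] * r)" using A(2) by (rule trans[rotated])
    have "poly (pderiv ([:-a,1:] * ([:-a,1:] * r))) a = 0"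
      unfolding pderiv_mult[of "[:-a,1:]"] by simp
    then have "poly (pderiv ?p) a = 0" by (simp only: pr)
    moreover have "poly (pderiv ?p) a = of_nat k * a ^ (k - 1)"
      by (simp add: pderiv_diff pderiv_monom poly_monom pderiv_1)
    ultimately have "a = 0" using kne by simp
    moreover have "poly ?p a = 0" using pr by (metis mult_eq_0_iff poly_eq_0_iff_dvd dvd_triv_left)
    ultimately show False using k by (simp add: poly_monom power_0_left)
  qed
  have "A = mset_set (set_mset A)"
  proof (rule multiset_eqI)
    fix a show "count A a = count (mset_set (set_mset A)) a"
      using cnt[of a] by (cases "a \<in># A") (auto simp: not_in_iff count_mset_set' order_antisym Suc_leI)
  qed
  then have "size A = card (set_mset A)" by (metis size_mset_set)
  moreover have "set_mset A = unity_roots k" using roots by (auto simp: poly_monom)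
  ultimately show ?thesis using A(1) deg by simp
qed

text \<open>If \<open>k\<close> does not divide \<open>i\<close>, then some \<open>\<xi>\<close> among the roots has \<open>\<xi>^i \<noteq> 1\<close>, since \<open>X^(i mod k) - 1\<close> has fewer
  than \<open>k\<close> zeros; multiplication by \<open>\<xi>\<close> permutes the roots and multiplies the sum by \<open>\<xi>^i\<close>.\<close>

lemma sum_unity_roots:
  assumes k: "k > 0" and kne: "of_nat k \<noteq> (0::'a::alg_closed_field)"
  shows "(\<Sum>\<zeta>\<in>unity_roots k. \<zeta> ^ i :: 'a) = (if k dvd i then of_nat k else 0)"
proof (cases "k dvd i")
  case True
  then have "(\<Sum>\<zeta>\<in>unity_roots k. \<zeta> ^ i :: 'a) = (\<Sum>\<zeta>\<in>(unity_roots k :: 'a set). 1)"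
    by (intro sum.cong) (auto simp: power_mult elim!: dvdE)
  then show ?thesis using True card_unity_roots[OF assms] by simp
next
  case False
  have "\<exists>\<xi>\<in>(unity_roots k :: 'a set). \<xi> ^ i \<noteq> 1"
  proof (rule ccontr)
    assume "\<not> ?thesis"
    then have all: "\<xi> ^ i = 1" if "\<xi> ^ k = 1" for \<xi> :: 'a using that by auto
    have "\<xi> ^ (i mod k) = 1" if "\<xi> \<in> unity_roots k" for \<xi> :: 'a
    proof -
      have "\<xi> ^ i = \<xi> ^ (k * (i div k) + i mod k)" by simp
      also have "\<dots> = \<xi> ^ (i mod k)" using that by (simp only: power_add power_mult) simp
      finally show ?thesis using that all by auto
    qed
    then have sub: "(unity_roots k :: 'a set) \<subseteq> {x. poly (monom 1 (i mod k) - 1 :: 'a poly) x = 0}"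
      by (auto simp: poly_monom)
    have m: "0 < i mod k" "i mod k < k" using False k by (auto simp: dvd_eq_mod_eq_0)
    let ?q = "monom 1 (i mod k) - 1 :: 'a poly"
    have "coeff ?q (i mod k) = 1" using m by simp
    then have q0: "?q \<noteq> 0" by (metis coeff_0 zero_neq_one)
    have "degree ?q \<le> i mod k" by (intro degree_diff_le) (auto simp: degree_monom_eq)
    then have "card {x. poly ?q x = 0} \<le> i mod k" using card_poly_roots_bound[OF q0] by simp
    then have "card (unity_roots k :: 'a set) \<le> i mod k"
      using card_mono[OF poly_roots_finite[OF q0] sub] by simp
    then show False using card_unity_roots[OF assms] m by simp
  qed
  then obtain \<xi> :: 'a where \<xi>: "\<xi> ^ k = 1" "\<xi> ^ i \<noteq> 1" by auto
  then have \<xi>0: "\<xi> \<noteq> 0" using k by (auto simp: power_0_left)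
  let ?S = "\<Sum>\<zeta>\<in>unity_roots k. \<zeta> ^ i :: 'a"
  have "?S = (\<Sum>\<zeta>\<in>unity_roots k. (\<xi> * \<zeta>) ^ i)"
    by (rule sum.reindex_bij_witness[of _ "\<lambda>\<zeta>. \<xi> * \<zeta>" "\<lambda>\<zeta>. \<zeta> / \<xi>"])
      (use \<xi> \<xi>0 in \<open>auto simp: power_mult_distrib power_divide\<close>)
  also have "\<dots> = \<xi> ^ i * ?S" by (simp add: power_mult_distrib sum_distrib_left)
  finally have "(1 - \<xi> ^ i) * ?S = 0" by (simp add: algebra_simps)
  then show ?thesis using \<xi> False by auto
qed

section \<open>Roots of power series\<close>

text \<open>The series \<open>(1 + X)^k - 1\<close> starts with \<open>k * X\<close>, so it has a compositional inverse \<open>R\<close>, and \<open>1 + R\<close> is a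
  \<open>k\<close>-th root of \<open>1 + X\<close>. Substitute \<open>A / A(0) - 1\<close> for \<open>X\<close>.\<close>

lemma fps_root_exists:
  fixes A :: "'a::field fps"
  assumes kne: "of_nat k \<noteq> (0::'a)" and A: "A $ 0 \<noteq> 0" and b: "b ^ k = A $ 0"
  shows "\<exists>B. B $ 0 = b \<and> B ^ k = A"
proof -
  let ?G = "(1 + fps_X) ^ k - 1 :: 'a fps"
  let ?R = "fps_inv ?G"
  have k: "k > 0" using kne by (cases k) auto
  have G0: "?G $ 0 = 0" by (simp add: fps_power_zeroth)
  have "fps_deriv ?G $ 0 = of_nat k" using k
    by (simp add: fps_deriv_power' fps_power_zeroth)
  then have G1: "?G $ 1 \<noteq> 0" using kne by (simp add: fps_deriv_nth)
  have R0: "?R $ 0 = 0" by (simp add: fps_inv_def)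
  have "(1 + fps_X) oo ?R = 1 + ?R" by (simp add: fps_compose_add_distrib R0)
  then have "(1 + ?R) ^ k = (1 + fps_X) ^ k oo ?R" using fps_compose_power[OF R0, of "1 + fps_X" k] by simp
  also have "\<dots> = (?G oo ?R) + 1" by (simp add: fps_compose_sub_distrib)
  also have "\<dots> = 1 + fps_X" using fps_inv_right[OF G0 G1] by simp
  finally have 1: "(1 + ?R) ^ k = 1 + fps_X" .
  define C where "C = fps_const (inverse (A $ 0)) * A - 1"
  have C0: "C $ 0 = 0" using A by (simp add: C_def)
  define B where "B = fps_const b * ((1 + ?R) oo C)"
  have "B ^ k = fps_const (b ^ k) * ((1 + fps_X) oo C)"
    by (simp add: B_def power_mult_distrib fps_compose_power[OF C0] 1 fps_const_power)
  also have "\<dots> = A" using b A C0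
    by (simp add: fps_compose_add_distrib C_def mult.assoc[symmetric])
  finally have "B ^ k = A" .
  moreover have "B $ 0 = b" by (simp add: B_def R0)
  ultimately show ?thesis by blast
qed

section \<open>Integral Laurent series and polynomial substitution\<close>

abbreviation integral :: "'a::zero fls \<Rightarrow> bool" where
  "integral f \<equiv> 0 \<le> fls_subdegree f"

lemma integral_add: "integral f \<Longrightarrow> integral g \<Longrightarrow> integral (f + g :: 'a::ab_group_add fls)"
  using fls_plus_subdegree[of f g] by (cases "f + g = 0") auto

lemma integral_mult: "integral f \<Longrightarrow> integral g \<Longrightarrow> integral (f * g :: 'a::field fls)"
  by (cases "f = 0 \<or> g = 0") auto

lemma integral_sum: "(\<And>i. i \<in> I \<Longrightarrow> integral (f i)) \<Longrightarrow> integral (\<Sum>i\<in>I. f i :: 'a::field fls)"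
  by (induction I rule: infinite_finite_induct) (auto intro: integral_add)

lemma integral_prod: "(\<And>i. i \<in> I \<Longrightarrow> integral (f i)) \<Longrightarrow> integral (\<Prod>i\<in>I. f i :: 'a::field fls)"
  by (induction I rule: infinite_finite_induct) (auto intro: integral_mult)

lemma integral_fps: "integral (fps_to_fls f)"
  by (rule fls_subdegree_fls_to_fps_gt0)

definition fpoly :: "'a::field poly \<Rightarrow> 'a fls \<Rightarrow> 'a fls" where
  "fpoly p t = poly (map_poly fls_const p) t"

lemma fpoly_0 [simp]: "fpoly 0 t = 0"
  by (simp add: fpoly_def)

lemma fpoly_pCons [simp]: "fpoly (pCons a p) t = fls_const a + t * fpoly p t"
  by (simp add: fpoly_def map_poly_pCons)

lemma fpoly_1 [simp]: "fpoly 1 t = 1"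
  by (simp add: one_pCons)

lemma fpoly_add: "fpoly (p + q) t = fpoly p t + fpoly q t"
  by (induction p q rule: poly_induct2) (auto simp: algebra_simps fls_plus_const[symmetric])

lemma fpoly_smult: "fpoly (smult c p) t = fls_const c * fpoly p t"
  by (induction p) (auto simp: algebra_simps)

lemma fpoly_mult: "fpoly (p * q) t = fpoly p t * fpoly q t"
  by (induction p) (auto simp: fpoly_add fpoly_smult algebra_simps)

lemma fpoly_power: "fpoly (p ^ m) t = fpoly p t ^ m"
  by (induction m) (auto simp: fpoly_mult)

lemma fpoly_const: "fpoly p (fls_const a) = fls_const (poly p a)"
  by (induction p) (auto simp: fls_plus_const[symmetric])

lemma fpoly_altdef: "fpoly p t = (\<Sum>i\<le>degree p. fls_const (coeff p i) * t ^ i)"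
proof -
  have "degree (map_poly fls_const p) = degree p" by (rule degree_map_poly) auto
  then show ?thesis by (simp add: fpoly_def poly_altdef coeff_map_poly)
qed

text \<open>Over an algebraically closed field \<open>p\<close> is a product of linear factors, one of which must vanish at \<open>t\<close>.\<close>

lemma fpoly_eq_0_imp_const:
  fixes p :: "'a::alg_closed_field poly"
  assumes "p \<noteq> 0" "fpoly p t = 0"
  shows "t \<in> range fls_const"
  using assms
proof (induction "degree p" arbitrary: p)
  case 0
  then obtain c where "p = [:c:]" using degree_eq_zeroE by metis
  then show ?case using 0 by simp
next
  case (Suc m)
  then obtain a where "poly p a = 0" using alg_closed_imp_poly_has_root[of p] by auto
  then obtain q where q: "p = [:-a,1:] * q" by (metis poly_eq_0_iff_dvd dvdE)
  then have "q \<noteq> 0" using Suc by auto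
  then have "degree p = Suc (degree q)" unfolding q by (subst degree_mult_eq) auto
  then have dq: "m = degree q" using Suc by simp
  have "(t - fls_const a) * fpoly q t = 0" using Suc.prems(2) unfolding q fpoly_mult
    by (simp add: algebra_simps)
  then show ?case using Suc.hyps(1)[OF dq \<open>q \<noteq> 0\<close>] by auto
qed

lemma integral_fpoly: "integral t \<Longrightarrow> integral (fpoly p t)"
  by (induction p) (auto intro!: integral_add integral_mult)

text \<open>Together with the next two lemmas this gives the order of \<open>p(t)\<close> for a series \<open>t\<close> that is close to a
  non-root of \<open>p\<close>, close to a root, or has a simple pole.\<close>

lemma fpoly_at_nonroot:
  assumes "poly q a \<noteq> 0" and "t = fls_const a + s" and "s = 0 \<or> fls_subdegree s > 0"
  shows "fls_subdegree (fpoly q t) = 0" "fpoly q t \<noteq> 0"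
proof -
  have t: "integral t" using assms(2,3) by (auto intro!: integral_add)
  obtain r where r: "q = [:-a,1:] * r + [:poly q a:]"
    using synthetic_div_correct'[of a q] by metis
  have "fpoly q t = fpoly [:-a,1:] t * fpoly r t + fpoly [:poly q a:] t"
    by (subst r) (simp only: fpoly_add fpoly_mult)
  then have "fpoly q t = fls_const (poly q a) + s * fpoly r t"
    by (simp add: assms(2))
  moreover have "fls_nth (s * fpoly r t) i = 0" if "i \<le> 0" for i
  proof (cases "s * fpoly r t = 0")
    case False
    then have "fls_subdegree (s * fpoly r t) > 0"
      using assms(3) integral_fpoly[OF t, of r] by auto
    then show ?thesis using that by (intro fls_eq0_below_subdegree) simp
  qed auto
  ultimately have *: "fls_nth (fpoly q t) i = (if i = 0 then poly q a else 0)" if "i \<le> 0" for i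
    using that by simp
  show "fls_subdegree (fpoly q t) = 0" by (rule fls_subdegree_eqI) (use * assms(1) in auto)
  show "fpoly q t \<noteq> 0" using *[of 0] assms(1) by auto
qed

lemma fpoly_at_root:
  assumes "poly q a = 0" and "t = fls_const a + s" and "fls_subdegree s \<ge> e" "e > 0"
    and nz: "fpoly q t \<noteq> 0"
  shows "fls_subdegree (fpoly q t) \<ge> e"
proof -
  have t: "integral t" using assms(2-4) by (auto intro!: integral_add)
  obtain r where r: "q = [:-a,1:] * r" using assms(1) by (metis poly_eq_0_iff_dvd dvdE)
  have "fpoly q t = fpoly [:-a,1:] t * fpoly r t"
    by (subst r) (simp only: fpoly_mult)
  then have *: "fpoly q t = s * fpoly r t" by (simp add: assms(2))
  then show ?thesis using nz assms(3) integral_fpoly[OF t, of r] by simp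
qed

lemma fpoly_at_pole:
  assumes "p \<noteq> 0" and "fls_subdegree t = -1"
  shows "fls_subdegree (fpoly p t) = - int (degree p) \<and> fpoly p t \<noteq> 0"
  using assms(1)
proof (induction p)
  case (pCons a p)
  show ?case
  proof (cases "p = 0")
    case True
    then show ?thesis using pCons by auto
  next
    case False
    have t0: "t \<noteq> 0" using assms(2) by auto
    have sd: "fls_subdegree (t * fpoly p t) = - int (degree p) - 1" and nz: "t * fpoly p t \<noteq> 0"
      using pCons.IH[OF False] assms(2) t0 by auto
    let ?g = "t * fpoly p t"
    have *: "fls_nth (fls_const a + ?g) i = fls_nth ?g i" if "i < 0" for i using that by simp
    have "fls_subdegree (fls_const a + ?g) = - int (degree p) - 1"
      by (rule fls_subdegree_eqI)
        (use * sd nz nth_fls_subdegree_nonzero[OF nz] in \<open>auto simp: sd\<close>)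
    moreover have "fls_const a + ?g \<noteq> 0" using calculation by auto
    ultimately show ?thesis using False by simp
  qed
qed simp

lemma fls_const_sum: "fls_const (\<Sum>i\<in>I. f i) = (\<Sum>i\<in>I. fls_const (f i :: 'a::comm_ring_1))"
  by (induction I rule: infinite_finite_induct) (auto simp: fls_plus_const[symmetric])

text \<open>The sum over all roots of unity annihilates the powers of \<open>\<zeta>\<close> whose exponent is not a multiple of \<open>k\<close>. As
  \<open>\<zeta>^(k - i) = \<zeta>^(- i)\<close>, only the term with \<open>j = i\<close> survives.\<close>

lemma unity_average:
  fixes c :: "nat \<Rightarrow> 'a::alg_closed_field fls"
  assumes k: "k > 0" and kne: "of_nat k \<noteq> (0::'a)" and i: "i < k"
  shows "(\<Sum>\<zeta>\<in>unity_roots k. fls_const \<zeta> ^ (k - i) * (\<Sum>j<k. c j * fls_const \<zeta> ^ j))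
    = fls_const (of_nat k) * c i"
proof -
  have "(\<Sum>\<zeta>\<in>unity_roots k. fls_const \<zeta> ^ (k - i) * (\<Sum>j<k. c j * fls_const \<zeta> ^ j))
      = (\<Sum>\<zeta>\<in>unity_roots k. \<Sum>j<k. c j * fls_const (\<zeta> ^ (k - i + j)))"
    by (simp add: sum_distrib_left fls_const_power[symmetric] power_add mult_ac)
  also have "\<dots> = (\<Sum>j<k. c j * fls_const (\<Sum>\<zeta>\<in>unity_roots k. \<zeta> ^ (k - i + j)))"
    by (subst sum.swap) (simp add: sum_distrib_left fls_const_sum)
  also have "\<dots> = (\<Sum>j<k. c j * fls_const (if j = i then of_nat k else 0))"
  proof (intro sum.cong refl)
    fix j assume "j \<in> {..<k}"
    then have j: "j < k" by simp
    have "k dvd (k - i + j) \<longleftrightarrow> j = i"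
    proof
      assume "k dvd (k - i + j)"
      then obtain q where q: "k - i + j = k * q" by blast
      have "0 < k * q" "k * q < k * 2" using q i j by linarith+
      then have "0 < q" "q < 2" by simp_all
      then have "q = 1" by simp
      then show "j = i" using q i by simp
    qed (use i in simp)
    then show "c j * fls_const (\<Sum>\<zeta>\<in>unity_roots k. \<zeta> ^ (k - i + j))
        = c j * fls_const (if j = i then of_nat k else 0)"
      using sum_unity_roots[OF k kne, of "k - i + j"] by simp
  qed
  also have "\<dots> = (\<Sum>j<k. if j = i then fls_const (of_nat k) * c i else 0)"
    by (intro sum.cong refl) auto
  also have "\<dots> = fls_const (of_nat k) * c i"
    using i by (simp add: sum.delta)
  finally show ?thesis .
qed

lemma const_term_mult:
  assumes "integral f" "integral g"
  shows "fls_nth (f * g) 0 = fls_nth f 0 * fls_nth (g :: 'a::field fls) 0"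
proof -
  have "f * g = fps_to_fls (fls_regpart f * fls_regpart g)"
    using assms by (simp add: fls_times_fps_to_fls)
  then show ?thesis by simp
qed

lemma const_term_power:
  assumes "integral (f :: 'a::field fls)"
  shows "fls_nth (f ^ m) 0 = fls_nth f 0 ^ m \<and> integral (f ^ m)"
  by (induction m) (use assms in \<open>auto simp: const_term_mult intro!: integral_mult\<close>)

lemma const_term_prod:
  assumes "\<And>i. i \<in> I \<Longrightarrow> integral (f i :: 'a::field fls)"
  shows "fls_nth (\<Prod>i\<in>I. f i) 0 = (\<Prod>i\<in>I. fls_nth (f i) 0)"
  using assms
proof (induction I rule: infinite_finite_induct)
  case (insert i I)
  then show ?case by (simp add: const_term_mult integral_prod)
qed auto

lemma const_term_fpoly:
  assumes "integral t" shows "fls_nth (fpoly p t) 0 = poly p (fls_nth t 0)"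
  by (induction p) (use assms in \<open>auto simp: const_term_mult integral_fpoly\<close>)

lemma fls_root_exists:
  fixes A :: "'a::field fls"
  assumes kne: "of_nat k \<noteq> (0::'a)" and A: "integral A" "fls_nth A 0 \<noteq> 0" and b: "b ^ k = fls_nth A 0"
  shows "\<exists>B. integral B \<and> fls_nth B 0 = b \<and> B ^ k = A"
proof -
  obtain B where B: "fps_nth B 0 = b" "B ^ k = fls_regpart A"
    using fps_root_exists[OF kne, of "fls_regpart A" b] A b by auto
  have "fps_to_fls B ^ k = A"
    using A(1) by (simp add: fps_to_fls_power[symmetric] B(2))
  then show ?thesis using B(1) integral_fps[of B] by (intro exI[of _ "fps_to_fls B"]) auto
qed

lemma fpoly_compose_power:
  "d > 0 \<Longrightarrow> fpoly p (fls_compose_power t d) = fls_compose_power (fpoly p t) d"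
  by (induction p) (auto simp: fls_compose_power_const_left)

text \<open>The \<open>i\<close>-th summand contains only exponents congruent to \<open>i\<close> modulo \<open>k\<close>, so there is no cancellation
  between different summands.\<close>

lemma compose_power_direct:
  fixes c :: "nat \<Rightarrow> 'a::field fls"
  assumes k: "k > 0" and z: "(\<Sum>i<k. fls_compose_power (c i) k * fls_X ^ i) = 0" and i: "i < k"
  shows "c i = 0"
proof (rule fls_eqI)
  fix l
  have *: "fls_nth (fls_compose_power (c j) k * fls_X ^ j) (int k * l + int i)
      = (if j = i then fls_nth (c i) l else 0)" if "j < k" for j
  proof -
    have "int k dvd int k * l + int i - int j \<longleftrightarrow> j = i"
    proof
      assume "int k dvd int k * l + int i - int j"
      then have "int k dvd int i - int j"
        by (metis add_diff_eq dvd_add_right_iff dvd_triv_left)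
      moreover have "\<bar>int i - int j\<bar> < int k" using that i by linarith
      ultimately have "int i - int j = 0" using dvd_imp_le_int[of "int i - int j" "int k"] by force
      then show "j = i" by simp
    qed simp
    then show ?thesis using k
      by (auto simp: fls_X_power_times_conv_shift(2) fls_nth_compose_power)
  qed
  have "0 = fls_nth (\<Sum>j<k. fls_compose_power (c j) k * fls_X ^ j) (int k * l + int i)"
    using z by simp
  also have "\<dots> = (\<Sum>j<k. if j = i then fls_nth (c i) l else 0)"
    unfolding fls_nth_sum using * by (intro sum.cong) auto
  also have "\<dots> = fls_nth (c i) l" using i by (simp add: sum.delta)
  finally show "fls_nth (c i) l = fls_nth 0 l" by simp
qed

section \<open>Solutions of the curve equations in Laurent series\<close>

text \<open>Polynomials in the coordinates \<open>x 2, \<dots>, x m\<close>, taken as functions in order that the same polynomial can be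
  evaluated at points with constant coordinates and along Laurent series.\<close>

inductive_set coord :: "nat \<Rightarrow> ((nat \<Rightarrow> 'a::field fls) \<Rightarrow> 'a fls) set" for m :: nat where
  const: "(\<lambda>_. fls_const c) \<in> coord m"
| var: "2 \<le> j \<Longrightarrow> j \<le> m \<Longrightarrow> (\<lambda>x. x j) \<in> coord m"
| add: "f \<in> coord m \<Longrightarrow> g \<in> coord m \<Longrightarrow> (\<lambda>x. f x + g x) \<in> coord m"
| mult: "f \<in> coord m \<Longrightarrow> g \<in> coord m \<Longrightarrow> (\<lambda>x. f x * g x) \<in> coord m"

lemma coord_0: "(\<lambda>_. 0) \<in> coord m" using coord.const[of 0] by simp
lemma coord_1: "(\<lambda>_. 1) \<in> coord m" using coord.const[of 1] by simp

lemma coord_sum: "(\<And>i. i \<in> I \<Longrightarrow> f i \<in> coord m) \<Longrightarrow> (\<lambda>x. \<Sum>i\<in>I. f i x) \<in> coord m"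
  by (induction I rule: infinite_finite_induct) (auto intro: coord_0 coord.add)

lemma coord_prod: "(\<And>i. i \<in> I \<Longrightarrow> f i \<in> coord m) \<Longrightarrow> (\<lambda>x. \<Prod>i\<in>I. f i x) \<in> coord m"
  by (induction I rule: infinite_finite_induct) (auto intro: coord_1 coord.mult)

lemma coord_power: "f \<in> coord m \<Longrightarrow> (\<lambda>x. f x ^ i) \<in> coord m"
  by (induction i) (auto intro: coord_1 coord.mult)

lemma coord_fpoly: "f \<in> coord m \<Longrightarrow> (\<lambda>x. fpoly p (f x)) \<in> coord m"
  by (induction p) (auto intro: coord_0 coord.const coord.add coord.mult)

lemma coord_mono: "f \<in> coord m \<Longrightarrow> m \<le> m' \<Longrightarrow> f \<in> coord m'"
  by (induction rule: coord.induct) (auto intro: coord.intros)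

lemma coord_local: "f \<in> coord m \<Longrightarrow> (\<And>i. 2 \<le> i \<Longrightarrow> i \<le> m \<Longrightarrow> x i = y i) \<Longrightarrow> f x = f y"
  by (induction rule: coord.induct) auto

text \<open>For \<open>\<zeta>\<close> a \<open>k\<close>-th root of unity this is an automorphism of the curve.\<close>

definition twist :: "nat \<Rightarrow> 'a::field \<Rightarrow> (nat \<Rightarrow> 'a fls) \<Rightarrow> nat \<Rightarrow> 'a fls" where
  "twist j \<zeta> x = x(j := fls_const \<zeta> * x j)"

lemma coord_twist: "f \<in> coord m \<Longrightarrow> (\<lambda>x. f (twist j \<zeta> x)) \<in> coord m"
proof (induction rule: coord.induct)
  case (var i)
  then show ?case by (cases "i = j") (auto simp: twist_def intro: coord.intros)
qed (auto intro: coord.intros)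

lemma coord_base: "f \<in> coord 2 \<Longrightarrow> \<exists>p. \<forall>x. f x = fpoly p (x 2)"
proof (induction rule: coord.induct)
  case (const c)
  show ?case by (rule exI[of _ "[:c:]"]) simp
next
  case (var j)
  then have "j = 2" by simp
  then show ?case by (intro exI[of _ "[:0,1:]"]) simp
qed (metis fpoly_add, metis fpoly_mult)

lemma coord_compose_power:
  "f \<in> coord m \<Longrightarrow> d > 0 \<Longrightarrow> f (\<lambda>i. fls_compose_power (x i) d) = fls_compose_power (f x) d"
  by (induction rule: coord.induct) (auto simp: fls_compose_power_const_left)

text \<open>The parameters of the affine curve \<open>x_j^k = - (\<mu>_j + x_2^k)\<close>, \<open>3 \<le> j \<le> n + 1\<close>. The polynomial in \<open>x_2\<close> on
  the right is called \<open>radicand j\<close> below.\<close>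

locale fermat_series =
  fixes k n :: nat and \<mu> :: "nat \<Rightarrow> 'a::alg_closed_field"
  assumes k2: "k \<ge> 2" and n2: "n \<ge> 2" and kne: "of_nat k \<noteq> (0::'a)"
    and \<mu>0: "\<And>j. 3 \<le> j \<Longrightarrow> j \<le> n + 1 \<Longrightarrow> \<mu> j \<noteq> 0" and \<mu>_inj: "inj_on \<mu> {3..n+1}"
begin

lemma k0: "k > 0" using k2 by simp

definition radicand :: "nat \<Rightarrow> 'a poly" where
  "radicand j = - (monom 1 k + [:\<mu> j:])"

lemma poly_radicand: "poly (radicand j) a = - (\<mu> j + a ^ k)"
  by (simp add: radicand_def poly_monom)

lemma fpoly_radicand: "fpoly (radicand j) t = - (fls_const (\<mu> j) + t ^ k)"
proof -
  have "fpoly (monom 1 k) t = t ^ k"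
    using fpoly_power[of "[:0,1:]" k t] by (simp add: monom_altdef)
  moreover have "radicand j = smult (- 1) (monom 1 k + [:\<mu> j:])" by (simp add: radicand_def)
  moreover have "fls_const (- 1 :: 'a) = - 1" by (metis fls_const_1 fls_const_uminus)
  ultimately show ?thesis by (simp only: fpoly_smult fpoly_add) simp
qed

lemma radicand_nonzero: "radicand j \<noteq> 0"
proof
  assume "radicand j = 0"
  then have "coeff (radicand j) k = 0" by simp
  then show False using k0 by (simp add: radicand_def coeff_pCons split: nat.splits)
qed

definition Sol :: "nat \<Rightarrow> (nat \<Rightarrow> 'a fls) set" where
  "Sol m = {x. x 1 = 1 \<and> (\<forall>j\<in>{3..m}. x j ^ k = fpoly (radicand j) (x 2))}"

abbreviation nonconst :: "(nat \<Rightarrow> 'a fls) \<Rightarrow> bool" where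
  "nonconst x \<equiv> x 2 \<notin> range fls_const"

lemma Sol_mono: "x \<in> Sol m' \<Longrightarrow> m \<le> m' \<Longrightarrow> x \<in> Sol m"
  by (auto simp: Sol_def)

lemma Sol_upd: "2 \<le> m \<Longrightarrow> x \<in> Sol m \<Longrightarrow> y ^ k = fpoly (radicand (Suc m)) (x 2) \<Longrightarrow> x(Suc m := y) \<in> Sol (Suc m)"
  by (auto simp: Sol_def le_Suc_eq)

lemma twist_Sol: "3 \<le> j \<Longrightarrow> \<zeta> ^ k = 1 \<Longrightarrow> x \<in> Sol m \<Longrightarrow> twist j \<zeta> x \<in> Sol m"
  by (auto simp: Sol_def twist_def power_mult_distrib fls_const_power[symmetric])

lemma twist_twist: "twist j \<zeta> (twist j \<xi> x) = twist j (\<zeta> * \<xi>) x"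
  by (auto simp: twist_def fls_const_mult_const[symmetric] mult_ac simp del: fls_const_mult_const)

lemma twist_1 [simp]: "twist j 1 x = x"
  by (auto simp: twist_def)

text \<open>The equation replaces \<open>x (m + 1)^k\<close> by a polynomial in \<open>x 2\<close>. In the case of a product, \<open>e l i j\<close> is
  the coefficient of \<open>x (m + 1)^l\<close> in \<open>x (m + 1)^(i + j)\<close> after this replacement.\<close>

lemma coord_reduce:
  assumes "f \<in> coord (Suc m)" "2 \<le> m"
  shows "\<exists>g. (\<forall>i. g i \<in> coord m) \<and>
    (\<forall>x\<in>Sol (Suc m). f x = (\<Sum>i<k. g i x * x (Suc m) ^ i))"
  using assms(1)
proof (induction rule: coord.induct)
  case (const c)
  let ?g = "\<lambda>(i::nat) x. if i = 0 then fls_const c else 0 :: 'a fls"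
  have "?g i \<in> coord m" for i by (cases i) (auto intro: coord.const coord_0)
  moreover have "fls_const c = (\<Sum>i<k. ?g i x * x (Suc m) ^ i)" for x
    using k0 by (simp add: if_distrib[of "\<lambda>u. u * _"] sum.delta cong: if_cong)
  ultimately show ?case by - (rule exI[of _ ?g], blast)
next
  case (var j)
  show ?case
  proof (cases "j = Suc m")
    case True
    let ?g = "\<lambda>(i::nat) x. if i = 1 then 1 else 0 :: 'a fls"
    have "?g i \<in> coord m" for i by (cases "i = 1") (auto intro: coord_1 coord_0)
    moreover have "x j = (\<Sum>i<k. ?g i x * x (Suc m) ^ i)" for x
      using k2 True by (simp add: if_distrib[of "\<lambda>u. u * _"] sum.delta cong: if_cong)
    ultimately show ?thesis by - (rule exI[of _ ?g], blast)
  next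
    case False
    let ?g = "\<lambda>(i::nat) x. if i = 0 then x j else 0 :: 'a fls"
    have "?g i \<in> coord m" for i using False var by (cases i) (auto intro: coord.var coord_0)
    moreover have "x j = (\<Sum>i<k. ?g i x * x (Suc m) ^ i)" for x
      using k0 by (simp add: if_distrib[of "\<lambda>u. u * _"] sum.delta cong: if_cong)
    ultimately show ?thesis by - (rule exI[of _ ?g], blast)
  qed
next
  case (add f f')
  obtain g where g: "\<forall>i. g i \<in> coord m" "\<forall>x\<in>Sol (Suc m). f x = (\<Sum>i<k. g i x * x (Suc m) ^ i)"
    using add.IH(1) by blast
  obtain g' where g': "\<forall>i. g' i \<in> coord m" "\<forall>x\<in>Sol (Suc m). f' x = (\<Sum>i<k. g' i x * x (Suc m) ^ i)"
    using add.IH(2) by blast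
  show ?case
    by (rule exI[of _ "\<lambda>i x. g i x + g' i x"])
      (use g g' in \<open>auto simp: distrib_right sum.distrib intro: coord.add\<close>)
next
  case (mult f f')
  obtain g where g: "\<forall>i. g i \<in> coord m" "\<forall>x\<in>Sol (Suc m). f x = (\<Sum>i<k. g i x * x (Suc m) ^ i)"
    using mult.IH(1) by blast
  obtain g' where g': "\<forall>i. g' i \<in> coord m" "\<forall>x\<in>Sol (Suc m). f' x = (\<Sum>i<k. g' i x * x (Suc m) ^ i)"
    using mult.IH(2) by blast
  let ?h = "\<lambda>x. fpoly (radicand (Suc m)) (x 2)"
  define e :: "nat \<Rightarrow> nat \<Rightarrow> nat \<Rightarrow> (nat \<Rightarrow> 'a fls) \<Rightarrow> 'a fls" where
    "e = (\<lambda>l i j x. if i + j = l then 1 else if i + j = l + k then ?h x else 0)"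
  have e_coord: "e l i j \<in> coord m" for l i j
  proof -
    have "?h \<in> coord m" using assms(2) by (intro coord_fpoly coord.var) auto
    then show ?thesis unfolding e_def
      by (cases "i + j = l"; cases "i + j = l + k") (simp_all add: coord_0 coord_1)
  qed
  have e_sum: "x (Suc m) ^ (i + j) = (\<Sum>l<k. e l i j x * x (Suc m) ^ l)"
    if x: "x \<in> Sol (Suc m)" and ij: "i < k" "j < k" for x i j
  proof (cases "i + j < k")
    case True
    have "(\<Sum>l<k. e l i j x * x (Suc m) ^ l) = (\<Sum>l<k. if l = i + j then x (Suc m) ^ (i + j) else 0)"
      using True by (intro sum.cong) (auto simp: e_def)
    then show ?thesis using True by (simp add: sum.delta)
  next
    case False
    have "(\<Sum>l<k. e l i j x * x (Suc m) ^ l)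
        = (\<Sum>l<k. if l = i + j - k then ?h x * x (Suc m) ^ (i + j - k) else 0)"
      using False ij by (intro sum.cong) (auto simp: e_def)
    also have "\<dots> = ?h x * x (Suc m) ^ (i + j - k)" using False ij by (simp add: sum.delta)
    also have "?h x = x (Suc m) ^ k" using x assms(2) by (auto simp: Sol_def)
    also have "x (Suc m) ^ k * x (Suc m) ^ (i + j - k) = x (Suc m) ^ (i + j)"
      using False by (simp add: power_add[symmetric])
    finally show ?thesis by simp
  qed
  define G where "G = (\<lambda>l x. \<Sum>i<k. \<Sum>j<k. g i x * g' j x * e l i j x)"
  have "G l \<in> coord m" for l
    unfolding G_def by (intro coord_sum coord.mult g(1)[rule_format] g'(1)[rule_format] e_coord)
  moreover have "f x * f' x = (\<Sum>l<k. G l x * x (Suc m) ^ l)" if x: "x \<in> Sol (Suc m)" for x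
  proof -
    have "f x * f' x = (\<Sum>i<k. \<Sum>j<k. g i x * g' j x * x (Suc m) ^ (i + j))"
      unfolding g(2)[rule_format, OF x] g'(2)[rule_format, OF x] sum_product
      by (intro sum.cong refl) (simp add: power_add mult_ac)
    also have "\<dots> = (\<Sum>i<k. \<Sum>j<k. \<Sum>l<k. g i x * g' j x * e l i j x * x (Suc m) ^ l)"
      using e_sum[OF x] by (intro sum.cong refl) (simp add: sum_distrib_left mult.assoc)
    also have "\<dots> = (\<Sum>i<k. \<Sum>l<k. \<Sum>j<k. g i x * g' j x * e l i j x * x (Suc m) ^ l)"
      by (intro sum.cong refl sum.swap)
    also have "\<dots> = (\<Sum>l<k. \<Sum>i<k. \<Sum>j<k. g i x * g' j x * e l i j x * x (Suc m) ^ l)"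
      by (rule sum.swap)
    also have "\<dots> = (\<Sum>l<k. G l x * x (Suc m) ^ l)"
      by (simp add: G_def sum_distrib_right)
    finally show ?thesis .
  qed
  ultimately show ?case by - (rule exI[of _ G], blast)
qed

lemma sum_twist:
  assumes m: "2 \<le> m" and g: "\<And>i. g i \<in> coord m"
    and f: "\<And>x. x \<in> Sol (Suc m) \<Longrightarrow> f x = (\<Sum>i<k. g i x * x (Suc m) ^ i)"
    and x: "x \<in> Sol (Suc m)" and \<zeta>: "\<zeta> ^ k = 1"
  shows "f (twist (Suc m) \<zeta> x) = (\<Sum>i<k. (g i x * x (Suc m) ^ i) * fls_const \<zeta> ^ i)"
proof -
  have "twist (Suc m) \<zeta> x \<in> Sol (Suc m)" using twist_Sol[OF _ \<zeta> x] m by simp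
  moreover have "g i (twist (Suc m) \<zeta> x) = g i x" for i
    by (rule coord_local[OF g]) (auto simp: twist_def)
  ultimately show ?thesis using f by (simp add: twist_def power_mult_distrib mult_ac)
qed

text \<open>The twists multiply the \<open>i\<close>-th term by \<open>\<zeta>^i\<close>; orthogonality of the roots of unity extracts it.\<close>

lemma twist_average:
  assumes m: "2 \<le> m" and g: "\<And>i. g i \<in> coord m"
    and f: "\<And>x. x \<in> Sol (Suc m) \<Longrightarrow> f x = (\<Sum>i<k. g i x * x (Suc m) ^ i)"
    and x: "x \<in> Sol (Suc m)" and i: "i < k"
  shows "(\<Sum>\<zeta>\<in>unity_roots k. fls_const \<zeta> ^ (k - i) * f (twist (Suc m) \<zeta> x))
    = fls_const (of_nat k) * (g i x * x (Suc m) ^ i)"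
proof -
  have "(\<Sum>\<zeta>\<in>unity_roots k. fls_const \<zeta> ^ (k - i) * f (twist (Suc m) \<zeta> x))
      = (\<Sum>\<zeta>\<in>unity_roots k. fls_const \<zeta> ^ (k - i) * (\<Sum>j<k. (g j x * x (Suc m) ^ j) * fls_const \<zeta> ^ j))"
  proof (rule sum.cong[OF refl])
    fix \<zeta> :: 'a assume "\<zeta> \<in> unity_roots k"
    then have \<zeta>: "\<zeta> ^ k = 1" by simp
    show "fls_const \<zeta> ^ (k - i) * f (twist (Suc m) \<zeta> x)
        = fls_const \<zeta> ^ (k - i) * (\<Sum>j<k. (g j x * x (Suc m) ^ j) * fls_const \<zeta> ^ j)"
      by (rule arg_cong, rule sum_twist[OF m g f x \<zeta>])
  qed
  also have "\<dots> = fls_const (of_nat k) * (g i x * x (Suc m) ^ i)"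
    by (rule unity_average[OF k0 kne i])
  finally show ?thesis .
qed

text \<open>Twisting permutes the factors of the norm, so only the term of degree zero of its reduction survives, and
  that term does not involve \<open>x (m + 1)\<close>.\<close>

lemma coord_norm:
  assumes f: "f \<in> coord (Suc m)" and m: "2 \<le> m"
  shows "\<exists>N\<in>coord m. \<forall>x\<in>Sol (Suc m). (\<Prod>\<zeta>\<in>unity_roots k. f (twist (Suc m) \<zeta> x)) = N x"
proof -
  let ?F = "\<lambda>x. \<Prod>\<zeta>\<in>unity_roots k. f (twist (Suc m) \<zeta> x)"
  have F_coord: "?F \<in> coord (Suc m)" by (intro coord_prod coord_twist f)
  obtain g where "\<forall>i. g i \<in> coord m"
    and "\<forall>x\<in>Sol (Suc m). ?F x = (\<Sum>i<k. g i x * x (Suc m) ^ i)"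
    using coord_reduce[OF F_coord m] by blast
  then have g: "\<And>i. g i \<in> coord m"
    and F: "\<And>x. x \<in> Sol (Suc m) \<Longrightarrow> ?F x = (\<Sum>i<k. g i x * x (Suc m) ^ i)" by blast+
  have inv: "?F (twist (Suc m) \<xi> x) = ?F x" if \<xi>: "\<xi> ^ k = 1" for \<xi> x
  proof -
    have "\<xi> \<noteq> 0" using \<xi> k0 by (auto simp: power_0_left)
    then show ?thesis unfolding twist_twist
      by (intro prod.reindex_bij_witness[of _ "\<lambda>\<zeta>. \<zeta> / \<xi>" "\<lambda>\<zeta>. \<zeta> * \<xi>"])
        (use \<xi> in \<open>auto simp: power_mult_distrib power_divide\<close>)
  qed
  have vanish: "g i x * x (Suc m) ^ i = 0" if x: "x \<in> Sol (Suc m)" and i: "i < k" "i \<noteq> 0" for x i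
  proof -
    have "fls_const (of_nat k) * (g i x * x (Suc m) ^ i)
        = (\<Sum>\<zeta>\<in>unity_roots k. fls_const \<zeta> ^ (k - i) * ?F (twist (Suc m) \<zeta> x))"
      by (rule twist_average[OF m g F x i(1), symmetric])
    also have "\<dots> = (\<Sum>\<zeta>\<in>unity_roots k. fls_const (\<zeta> ^ (k - i)) * ?F x)"
      by (intro sum.cong refl) (simp add: inv fls_const_power)
    also have "\<dots> = fls_const (\<Sum>\<zeta>\<in>unity_roots k. \<zeta> ^ (k - i)) * ?F x"
      by (simp add: fls_const_sum sum_distrib_right)
    also have "\<dots> = 0"
    proof -
      have "\<not> k dvd k - i" using i by (auto dest: dvd_imp_le)
      then show ?thesis using sum_unity_roots[OF k0 kne, of "k - i"] by simp
    qed
    finally show ?thesis using kne by simp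
  qed
  have "?F x = g 0 x" if x: "x \<in> Sol (Suc m)" for x
  proof -
    have "?F x = (\<Sum>i<k. if i = 0 then g 0 x else 0)"
      unfolding F[OF x] using vanish[OF x] by (intro sum.cong) auto
    then show ?thesis using k0 by (simp add: sum.delta)
  qed
  then show ?thesis using g by blast
qed

end

lemma integral_compose_power:
  assumes "integral f" "d > 0"
  shows "integral (fls_compose_power f d)" "fls_nth (fls_compose_power f d) 0 = fls_nth f 0"
proof -
  show "integral (fls_compose_power f d)"
    by (rule fls_subdegree_ge0I) (use assms in \<open>auto simp: fls_nth_compose_power elim!: dvdE simp: mult_less_0_iff\<close>)
qed (use assms in \<open>simp add: fls_nth_compose_power\<close>)

lemma unit_subdegree: "integral f \<Longrightarrow> fls_nth f 0 \<noteq> 0 \<Longrightarrow> fls_subdegree f = 0"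
  by (rule fls_subdegree_eqI) auto

context fermat_series
begin

lemma fpoly_nonconst: "nonconst x \<Longrightarrow> q \<noteq> 0 \<Longrightarrow> fpoly q (x 2) \<noteq> 0"
  using fpoly_eq_0_imp_const by blast

lemma roots_over:
  assumes t: "integral t" and p: "\<And>j. j \<in> {3..n+1} \<Longrightarrow> p j ^ k = poly (radicand j) (fls_nth t 0)"
  shows "\<exists>y. \<forall>j\<in>{3..n+1}. p j \<noteq> 0 \<longrightarrow>
    integral (y j) \<and> fls_nth (y j) 0 = p j \<and> y j ^ k = fpoly (radicand j) t"
proof (rule bchoice, intro ballI)
  fix j assume j: "j \<in> {3..n+1}"
  show "\<exists>y. p j \<noteq> 0 \<longrightarrow> integral y \<and> fls_nth y 0 = p j \<and> y ^ k = fpoly (radicand j) t"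
  proof (cases "p j = 0")
    case False
    have "fls_nth (fpoly (radicand j) t) 0 = p j ^ k" using p[OF j] const_term_fpoly[OF t] by simp
    then have "\<exists>B. integral B \<and> fls_nth B 0 = p j \<and> B ^ k = fpoly (radicand j) t"
      using False by (intro fls_root_exists[OF kne integral_fpoly[OF t]]) simp_all
    then show ?thesis by blast
  qed simp
qed

text \<open>The homogeneous coordinates \<open>s * x i\<close> of the point \<open>x\<close> specialize to \<open>p\<close> when the variable of the series is set
  to \<open>0\<close>.\<close>

definition centered :: "(nat \<Rightarrow> 'a fls) \<Rightarrow> (nat \<Rightarrow> 'a) \<Rightarrow> bool" where
  "centered x p \<longleftrightarrow> (\<exists>s. \<forall>i\<in>{1..n+1}. integral (s * x i) \<and> fls_nth (s * x i) 0 = p i)"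

text \<open>Here \<open>z - p 2\<close> is a local parameter and all radicands are units, which have \<open>k\<close>-th roots.\<close>

lemma branch_unramified:
  assumes p1: "p 1 = 1" and p: "\<And>j. j \<in> {3..n+1} \<Longrightarrow> p j ^ k = poly (radicand j) (p 2) \<and> p j \<noteq> 0"
  shows "\<exists>x\<in>Sol (n+1). nonconst x \<and> centered x p \<and> x 2 = fls_const (p 2) + fls_X \<and>
    (\<forall>j\<in>{3..n+1}. fls_subdegree (x j) = 0)"
proof -
  define t where "t = fls_const (p 2) + fls_X"
  have t: "integral t" "fls_nth t 0 = p 2" by (auto simp: t_def intro!: integral_add)
  obtain y where y: "\<forall>j\<in>{3..n+1}. p j \<noteq> 0 \<longrightarrow>
      integral (y j) \<and> fls_nth (y j) 0 = p j \<and> y j ^ k = fpoly (radicand j) t"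
    using roots_over[OF t(1), of p] p t(2) by auto
  define x where "x = (\<lambda>i::nat. if i = 1 then 1 else if i = 2 then t else y i)"
  have "x \<in> Sol (n+1)" using y p by (auto simp: Sol_def x_def)
  moreover have "nonconst x"
  proof
    assume "x 2 \<in> range fls_const"
    then obtain c where "t = fls_const c" by (auto simp: x_def)
    then have "fls_nth t 1 = 0" by simp
    then show False by (simp add: t_def)
  qed
  moreover have "centered x p" unfolding centered_def
  proof (intro exI[of _ 1] ballI)
    fix i assume i: "i \<in> {1..n+1}"
    show "integral (1 * x i) \<and> fls_nth (1 * x i) 0 = p i"
    proof (cases "i \<in> {3..n+1}")
      case True then show ?thesis using y p[OF True] by (auto simp: x_def)
    next
      case False
      then have "i = 1 \<or> i = 2" using i by auto
      then show ?thesis using t p1 by (auto simp: x_def)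
    qed
  qed
  moreover have "fls_subdegree (x j) = 0" if "j \<in> {3..n+1}" for j
    using y p[OF that] that unit_subdegree[of "y j"] by (auto simp: x_def)
  ultimately show ?thesis by (intro bexI[of _ x]) (auto simp: x_def t_def)
qed

text \<open>The coordinate \<open>u = x l\<close> is a local parameter. Since \<open>z^k = - (\<mu>_l + u^k)\<close>, the equations for \<open>z\<close> and for
  the coordinates other than \<open>x l\<close> only involve \<open>\<tau> = u^k\<close>; they are solved by power series in \<open>\<tau>\<close>, into which
  \<open>u^k\<close> is then substituted. That these coordinates are series in \<open>u^k\<close> makes the powers \<open>1, u, \<dots>, u^(k - 1)\<close>
  independent over them, which is the source of irreducibility.\<close>

lemma branch_ramified:
  assumes p1: "p 1 = 1" and p: "\<And>j. j \<in> {3..n+1} \<Longrightarrow> p j ^ k = poly (radicand j) (p 2)"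
    and l: "l \<in> {3..n+1}" "p l = 0"
  shows "\<exists>x\<in>Sol (n+1). nonconst x \<and> centered x p \<and> x l = fls_X \<and>
    (\<exists>x'. \<forall>i. i \<noteq> l \<longrightarrow> x i = fls_compose_power (x' i) k) \<and>
    (\<forall>j\<in>{3..n+1}-{l}. fls_subdegree (x j) = 0) \<and>
    (\<exists>s. x 2 = fls_const (p 2) + s \<and> fls_subdegree s \<ge> int k) \<and> p 2 \<noteq> 0"
proof -
  have pl: "p 2 ^ k = - \<mu> l" using p[OF l(1)] l(2) k0 by (simp add: poly_radicand power_0_left add_eq_0_iff)
  have \<mu>l: "\<mu> l \<noteq> 0" using \<mu>0 l by simp
  then have p2: "p 2 \<noteq> 0" using pl k0 by (auto simp: power_0_left)
  define A where "A = - (fls_const (\<mu> l) + fls_X)"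
  have A: "integral A" unfolding A_def fls_uminus_subdegree by (intro integral_add) auto
  have A0: "fls_nth A 0 = - \<mu> l" by (simp add: A_def)
  obtain t where t: "integral t" "fls_nth t 0 = p 2" "t ^ k = A"
    using fls_root_exists[OF kne A, of "p 2"] A0 \<mu>l pl by auto
  have pne: "p j \<noteq> 0" if "j \<in> {3..n+1}" "j \<noteq> l" for j
  proof
    assume "p j = 0"
    then have "\<mu> j = \<mu> l" using p[OF that(1)] pl k0 by (simp add: poly_radicand power_0_left)
    then show False using \<mu>_inj that l by (auto dest: inj_onD)
  qed
  obtain y where y: "\<forall>j\<in>{3..n+1}. p j \<noteq> 0 \<longrightarrow>
      integral (y j) \<and> fls_nth (y j) 0 = p j \<and> y j ^ k = fpoly (radicand j) t"
    using roots_over[OF t(1), of p] p t(2) by auto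
  define x' where "x' = (\<lambda>i::nat. if i = 1 then 1 else if i = 2 then t else y i)"
  define x where "x = (\<lambda>i. if i = l then fls_X else fls_compose_power (x' i) k)"
  have x2: "x 2 = fls_compose_power t k" using l by (auto simp: x_def x'_def)
  have x'i: "integral (x' i)" "fls_nth (x' i) 0 = p i" if "i \<in> {1..n+1}" "i \<noteq> l" for i
  proof -
    have "i = 1 \<or> i = 2 \<or> i \<in> {3..n+1}" using that by auto
    then show "integral (x' i)" "fls_nth (x' i) 0 = p i"
      using y pne[of i] that t p1 by (auto simp: x'_def)
  qed
  have "x \<in> Sol (n+1)" unfolding Sol_def
  proof (intro CollectI conjI ballI)
    show "x 1 = 1" using l k0 by (auto simp: x_def x'_def)
    fix j assume j: "j \<in> {3..n+1}"
    show "x j ^ k = fpoly (radicand j) (x 2)"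
    proof (cases "j = l")
      case True
      have "fpoly (radicand l) (x 2) = fls_compose_power (fpoly (radicand l) t) k"
        by (simp add: x2 fpoly_compose_power k0)
      also have "fpoly (radicand l) t = fls_X" by (simp add: fpoly_radicand t(3) A_def)
      finally show ?thesis using True k0 by (simp add: x_def fls_X_power_conv_shift_1)
    next
      case False
      have "x j ^ k = fls_compose_power (y j ^ k) k"
        using False j k0 by (simp add: x_def x'_def)
      also have "y j ^ k = fpoly (radicand j) t" using y j pne[OF j False] by auto
      finally show ?thesis by (simp add: x2 fpoly_compose_power k0)
    qed
  qed
  moreover have nc: "nonconst x"
  proof
    assume "x 2 \<in> range fls_const"
    then obtain c where "fls_compose_power t k = fls_const c" by (auto simp: x2)
    then have "fls_compose_power t k ^ k = fls_const (c ^ k)" by (simp add: fls_const_power)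
    then have "fls_compose_power A k = fls_const (c ^ k)" using t(3) k0 by (metis fls_compose_power_power)
    then have "fls_nth (fls_compose_power A k) (int k) = 0" using k0 by simp
    then show False using k0 by (simp add: fls_nth_compose_power A_def)
  qed
  moreover have "centered x p" unfolding centered_def
  proof (intro exI[of _ 1] ballI)
    fix i assume i: "i \<in> {1..n+1}"
    show "integral (1 * x i) \<and> fls_nth (1 * x i) 0 = p i"
      using x'i[OF i] integral_compose_power[of "x' i" k] k0 l by (cases "i = l") (auto simp: x_def)
  qed
  moreover have "fls_subdegree (x j) = 0" if j: "j \<in> {3..n+1} - {l}" for j
  proof -
    have "j \<in> {1..n+1}" "j \<noteq> l" using j by auto
    then have "integral (x j)" "fls_nth (x j) 0 \<noteq> 0"
      using x'i[of j] integral_compose_power[of "x' j" k] k0 pne[of j] j by (auto simp: x_def)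
    then show ?thesis by (rule unit_subdegree)
  qed
  moreover have "\<exists>s. x 2 = fls_const (p 2) + s \<and> fls_subdegree s \<ge> int k"
  proof (intro exI conjI)
    show "x 2 = fls_const (p 2) + (x 2 - fls_const (p 2))" by simp
    have "x 2 - fls_const (p 2) \<noteq> 0" using nc by auto
    then show "fls_subdegree (x 2 - fls_const (p 2)) \<ge> int k"
    proof (rule fls_subdegree_geI)
      fix i assume i: "i < int k"
      show "fls_nth (x 2 - fls_const (p 2)) i = 0"
      proof (cases "int k dvd i \<and> i \<noteq> 0")
        case True
        then have "i < 0" using i by (meson linorder_neqE_linordered_idom not_less zdvd_imp_le)
        then show ?thesis using integral_compose_power[OF t(1) k0] by (simp add: x2)
      next
        case False
        then show ?thesis using t k0 by (auto simp: x2 fls_nth_compose_power)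
      qed
    qed
  qed
  ultimately show ?thesis using p2 by (intro bexI[of _ x]) (auto simp: x_def)
qed

text \<open>The local parameter is a multiple of \<open>1/z\<close>, and multiplication by it turns \<open>x j\<close> into a \<open>k\<close>-th root of
  a unit.\<close>

lemma branch_infinity:
  assumes p1: "p 1 = 0" and p2: "p 2 \<noteq> 0"
    and p: "\<And>j. j \<in> {3..n+1} \<Longrightarrow> p j ^ k = - (p 2 ^ k)"
  shows "\<exists>x\<in>Sol (n+1). nonconst x \<and> centered x p \<and> x 2 = fls_const (p 2) * fls_X_inv \<and>
    (\<forall>j\<in>{3..n+1}. fls_subdegree (x j) = -1)"
proof -
  have "\<exists>y. integral y \<and> fls_nth y 0 = p j \<and> y ^ k = - (fls_const (\<mu> j) * fls_X ^ k + fls_const (p 2) ^ k)"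
    if j: "j \<in> {3..n+1}" for j
  proof -
    let ?A = "- (fls_const (\<mu> j) * fls_X ^ k + fls_const (p 2) ^ k)"
    have A: "integral ?A" unfolding fls_uminus_subdegree
      by (intro integral_add integral_mult) (auto simp: fls_const_power[symmetric])
    have "fls_nth ?A 0 = - (p 2 ^ k)" using k0 by (simp add: fls_const_power[symmetric])
    then show ?thesis using fls_root_exists[OF kne A, of "p j"] p[OF j] p2 by auto
  qed
  then obtain y where y: "\<And>j. j \<in> {3..n+1} \<Longrightarrow> integral (y j) \<and> fls_nth (y j) 0 = p j \<and>
      y j ^ k = - (fls_const (\<mu> j) * fls_X ^ k + fls_const (p 2) ^ k)" by metis
  have pne: "p j \<noteq> 0" if "j \<in> {3..n+1}" for j using p[OF that] p2 k0 by (auto simp: power_0_left)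
  define x where "x = (\<lambda>i::nat. if i = 1 then 1 else if i = 2 then fls_const (p 2) * fls_X_inv
      else y i * fls_X_inv)"
  have X_inv: "fls_X * fls_X_inv = (1 :: 'a fls)"
    by (metis fls_X_nonzero fls_inverse_X right_inverse)
  then have XX: "fls_X ^ k * fls_X_inv ^ k = (1 :: 'a fls)"
    by (metis power_mult_distrib power_one)
  have X1: "fls_X * (f * fls_X_inv) = f" for f :: "'a fls"
    using X_inv by (metis mult.left_commute mult.right_neutral)
  have "x \<in> Sol (n+1)" unfolding Sol_def
  proof (intro CollectI conjI ballI)
    fix j assume j: "j \<in> {3..n+1}"
    have yj: "y j ^ k = - (fls_const (\<mu> j) * fls_X ^ k + fls_const (p 2) ^ k)" using y[OF j] by simp
    have "x j ^ k = y j ^ k * fls_X_inv ^ k" using j by (simp add: x_def power_mult_distrib)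
    also have "\<dots> = - (fls_const (\<mu> j) * (fls_X ^ k * fls_X_inv ^ k) + (fls_const (p 2) * fls_X_inv) ^ k)"
      unfolding yj by (simp add: power_mult_distrib algebra_simps)
    also have "\<dots> = fpoly (radicand j) (x 2)" unfolding XX by (simp add: fpoly_radicand x_def)
    finally show "x j ^ k = fpoly (radicand j) (x 2)" .
  qed (simp add: x_def)
  moreover have "nonconst x"
  proof
    assume "x 2 \<in> range fls_const"
    then obtain c where "fls_const (p 2) * fls_X_inv = fls_const c" by (auto simp: x_def)
    then have "fls_nth (fls_const (p 2) * fls_X_inv) (-1) = 0" by simp
    then show False using p2 by simp
  qed
  moreover have "centered x p" unfolding centered_def
  proof (intro exI[of _ fls_X] ballI)
    fix i assume i: "i \<in> {1..n+1}"
    then have "i = 1 \<or> i = 2 \<or> i \<in> {3..n+1}" by auto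
    then show "integral (fls_X * x i) \<and> fls_nth (fls_X * x i) 0 = p i"
      using y[of i] p1 by (auto simp: x_def X1)
  qed
  moreover have "fls_subdegree (x j) = -1" if j: "j \<in> {3..n+1}" for j
  proof -
    have "fls_subdegree (y j) = 0" "y j \<noteq> 0" using y[OF j] pne[OF j] by (auto intro: unit_subdegree)
    then show ?thesis using j by (auto simp: x_def)
  qed
  ultimately show ?thesis by (intro bexI[of _ x]) (auto simp: x_def)
qed

lemma root_point_exists:
  "\<exists>p. p 1 = 1 \<and> p 2 = a \<and> (\<forall>j\<in>{3..n+1}. p j ^ k = poly (radicand j) a)"
proof -
  have "\<forall>j. \<exists>b. b ^ k = poly (radicand j) a" using nth_root_exists[OF k0] by blast
  then obtain b where "\<forall>j. b j ^ k = poly (radicand j) a" by metis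
  then show ?thesis by (intro exI[of _ "\<lambda>i::nat. if i = 1 then 1 else if i = 2 then a else b i"]) auto
qed

lemma special_branch:
  assumes "3 \<le> l" "l \<le> n + 1"
  shows "\<exists>x\<in>Sol (n+1). nonconst x \<and> x l = fls_X \<and>
    (\<exists>x'. \<forall>i. i \<noteq> l \<longrightarrow> x i = fls_compose_power (x' i) k)"
proof -
  obtain a where a: "a ^ k = - \<mu> l" using nth_root_exists[OF k0] by blast
  obtain p where p: "p 1 = 1" "p 2 = a" "\<forall>j\<in>{3..n+1}. p j ^ k = poly (radicand j) a"
    using root_point_exists by blast
  have "p l ^ k = 0" using p(3) assms a by (simp add: poly_radicand)
  then have "p l = 0" by simp
  then show ?thesis using branch_ramified[of p l] p assms by auto
qed

text \<open>Irreducibility of the curve, in the form that is needed: a polynomial in the coordinates is zero on all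
  Laurent series points as soon as it is zero on the points with constant coordinates, or on a single
  nonconstant point. The proof is by induction on the number of coordinates, writing \<open>f\<close> as
  \<open>\<Sum>i<k. g_i x (m + 1)^i\<close>.

  In the first case the \<open>k\<close> twists of a point separate the \<open>g_i\<close>. In the second case the norm of \<open>f\<close>
  vanishes at the given point and involves one coordinate less, so by induction it also vanishes on the
  branch \<open>S\<close> on which \<open>x (m + 1)\<close> is the local parameter \<open>u\<close>. Hence some twist of \<open>f\<close> vanishes on \<open>S\<close>,
  where the \<open>g_i\<close> are series in \<open>u^k\<close>, so that they vanish one by one.\<close>

theorem coord_vanish:
  assumes "2 \<le> m" "m \<le> n + 1"
  shows "\<forall>f\<in>coord m.
    ((\<forall>x\<in>Sol m. range x \<subseteq> range fls_const \<longrightarrow> f x = 0) \<longrightarrow> (\<forall>x\<in>Sol m. f x = 0)) \<and>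
    ((\<exists>x\<in>Sol m. nonconst x \<and> f x = 0) \<longrightarrow> (\<forall>x\<in>Sol m. f x = 0))"
  using assms
proof (induction m rule: nat_induct_at_least)
  case base
  show ?case
  proof
    fix f :: "(nat \<Rightarrow> 'a fls) \<Rightarrow> 'a fls" assume "f \<in> coord 2"
    then obtain p where p: "\<And>x. f x = fpoly p (x 2)" using coord_base by metis
    have "p = 0" if "\<forall>x\<in>Sol 2. range x \<subseteq> range fls_const \<longrightarrow> f x = 0"
    proof -
      have pc: "poly p c = 0" for c
      proof -
        define x where "x = (\<lambda>i::nat. if i = 1 then 1 else fls_const c)"
        have "x \<in> Sol 2" by (auto simp: Sol_def x_def)
        moreover have "range x \<subseteq> range fls_const"
          by (auto simp: x_def)
        ultimately have "f x = 0" using that by blast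
        then show ?thesis by (simp add: p x_def fpoly_const)
      qed
      show "p = 0"
      proof (rule ccontr)
        assume p0: "p \<noteq> 0"
        \<comment> \<open>A polynomial that is zero everywhere does not take the value \<open>- 1\<close>.\<close>
        have "degree (p + [:1:]) > 0"
        proof (rule ccontr)
          assume "\<not> degree (p + [:1:]) > 0"
          then obtain c where c: "p + [:1:] = [:c:]" using degree_eq_zeroE by blast
          then have "p = [:c - 1:]" by (metis add_diff_cancel_right' diff_pCons diff_0_right minus_pCons pCons_eq_iff eq_diff_eq)
          then show False using pc[of 0] p0 by simp
        qed
        then obtain c where "poly (p + [:1:]) c = 0" using alg_closed_imp_poly_has_root by blast
        then show False using pc[of c] by simp
      qed
    qed
    moreover have "p = 0" if "\<exists>x\<in>Sol 2. nonconst x \<and> f x = 0"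
      using that fpoly_nonconst by (auto simp: p)
    moreover have "f x = 0" if "p = 0" for x using that by (simp add: p)
    ultimately show "((\<forall>x\<in>Sol 2. range x \<subseteq> range fls_const \<longrightarrow> f x = 0) \<longrightarrow> (\<forall>x\<in>Sol 2. f x = 0)) \<and>
        ((\<exists>x\<in>Sol 2. nonconst x \<and> f x = 0) \<longrightarrow> (\<forall>x\<in>Sol 2. f x = 0))"
      by blast
  qed
next
  case (Suc m)
  have m: "2 \<le> m" "m \<le> n + 1" "Suc m \<le> n + 1" using Suc by auto
  have IH1: "\<forall>x\<in>Sol m. f x = 0"
    if "f \<in> coord m" "\<And>x. x \<in> Sol m \<Longrightarrow> range x \<subseteq> range fls_const \<Longrightarrow> f x = 0" for f
    using Suc.IH[OF m(2)] that by blast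
  have IH2: "\<forall>x\<in>Sol m. f x = 0"
    if "f \<in> coord m" "x \<in> Sol m" "nonconst x" "f x = 0" for f x
    using Suc.IH[OF m(2)] that by blast
  obtain S S' where S: "S \<in> Sol (n+1)" "nonconst S" "S (Suc m) = fls_X"
    and S': "\<forall>i. i \<noteq> Suc m \<longrightarrow> S i = fls_compose_power (S' i) k"
    using special_branch[of "Suc m"] m by auto
  have Sm: "S \<in> Sol (Suc m)" "S \<in> Sol m" using S(1) m Sol_mono by auto
  show ?case
  proof (intro ballI conjI impI)
    fix f x assume f: "f \<in> coord (Suc m)" and x: "x \<in> Sol (Suc m)"
      and van: "\<forall>x\<in>Sol (Suc m). range x \<subseteq> range fls_const \<longrightarrow> f x = 0"
    obtain g where g: "\<forall>i. g i \<in> coord m"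
      "\<forall>x\<in>Sol (Suc m). f x = (\<Sum>i<k. g i x * x (Suc m) ^ i)"
      using coord_reduce[OF f m(1)] by blast
    have "g i x = 0" if i: "i < k" for i
    proof -
      let ?h = "\<lambda>x. fpoly (radicand (Suc m)) (x 2)"
      \<comment> \<open>The factor \<open>?h\<close> takes care of the points at which \<open>x (m + 1)\<close> vanishes and twisting is trivial.\<close>
      have hg: "(\<lambda>x. ?h x * g i x) \<in> coord m"
        using g(1) m by (intro coord.mult coord_fpoly coord.var) auto
      have "\<forall>x\<in>Sol m. ?h x * g i x = 0"
      proof (rule IH1[OF hg])
        fix w assume w: "w \<in> Sol m" "range w \<subseteq> range fls_const"
        show "?h w * g i w = 0"
        proof (cases "?h w = 0")
          case False
          obtain c where c: "w 2 = fls_const c" using w(2) by blast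
          obtain b where b: "b ^ k = poly (radicand (Suc m)) c" using nth_root_exists[OF k0] by blast
          define v where "v = w(Suc m := fls_const b)"
          have w': "v \<in> Sol (Suc m)"
            unfolding v_def by (rule Sol_upd[OF m(1) w(1)]) (simp add: c fpoly_const fls_const_power[symmetric] b)
          have b0: "b \<noteq> 0" using False b k0 by (auto simp: c fpoly_const power_0_left)
          have "f (twist (Suc m) \<zeta> v) = 0" if "\<zeta> ^ k = 1" for \<zeta>
          proof -
            have "twist (Suc m) \<zeta> v \<in> Sol (Suc m)" using twist_Sol[OF _ that w'] m by simp
            moreover have "range (twist (Suc m) \<zeta> v) \<subseteq> range fls_const"
              using w(2) by (auto simp: twist_def v_def)
            ultimately show ?thesis using van by blast
          qed
          then have "fls_const (of_nat k) * (g i v * v (Suc m) ^ i) = 0"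
            using twist_average[OF m(1) g(1)[rule_format] g(2)[rule_format] w' i] by simp
          moreover have "v (Suc m) = fls_const b" by (simp add: v_def)
          ultimately have "g i v = 0" using kne b0 by simp
          moreover have "g i v = g i w" by (rule coord_local) (use g m in \<open>auto simp: v_def\<close>)
          ultimately show ?thesis by simp
        qed simp
      qed
      then have "?h S * g i S = 0" using Sm by blast
      then have "g i S = 0" using fpoly_nonconst[of S, OF S(2) radicand_nonzero] by simp
      then show ?thesis using IH2[OF g(1)[rule_format] Sm(2) S(2)] Sol_mono[OF x] by auto
    qed
    then show "f x = 0" using g(2) x by simp
  next
    fix f x assume f: "f \<in> coord (Suc m)" and x: "x \<in> Sol (Suc m)"
      and "\<exists>x\<in>Sol (Suc m). nonconst x \<and> f x = 0"
    then obtain w where w: "w \<in> Sol (Suc m)" "nonconst w" "f w = 0" by blast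
    obtain g where g: "\<forall>i. g i \<in> coord m"
      "\<forall>x\<in>Sol (Suc m). f x = (\<Sum>i<k. g i x * x (Suc m) ^ i)"
      using coord_reduce[OF f m(1)] by blast
    obtain N where N: "N \<in> coord m"
      "\<forall>x\<in>Sol (Suc m). (\<Prod>\<zeta>\<in>unity_roots k. f (twist (Suc m) \<zeta> x)) = N x"
      using coord_norm[OF f m(1)] by blast
    have fin: "finite (unity_roots k :: 'a set)" by (rule finite_unity_roots[OF k0])
    have "(\<Prod>\<zeta>\<in>unity_roots k. f (twist (Suc m) \<zeta> w)) = 0"
      by (rule prod_zero[OF fin]) (rule bexI[of _ 1], use w in auto)
    then have "N w = 0" using N(2) w by simp
    then have "N S = 0" using IH2[OF N(1) Sol_mono[OF w(1)] w(2)] Sm by auto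
    then have "(\<Prod>\<zeta>\<in>unity_roots k. f (twist (Suc m) \<zeta> S)) = 0" using N(2) Sm by simp
    then obtain \<zeta> where \<zeta>: "\<zeta> ^ k = 1" "f (twist (Suc m) \<zeta> S) = 0" using fin by auto
    have \<zeta>0: "\<zeta> \<noteq> 0" using \<zeta>(1) k0 by (auto simp: power_0_left)
    define c where "c = (\<lambda>i. g i S' * fls_const \<zeta> ^ i)"
    have gS: "g i S = fls_compose_power (g i S') k" for i
    proof -
      have "g i S = g i (\<lambda>i. fls_compose_power (S' i) k)"
        by (rule coord_local) (use g S' in auto)
      then show ?thesis using coord_compose_power[OF g(1)[rule_format] k0] by simp
    qed
    have "(\<Sum>i<k. fls_compose_power (c i) k * fls_X ^ i) = 0"
      using sum_twist[OF m(1) g(1)[rule_format] g(2)[rule_format] Sm(1) \<zeta>(1)] \<zeta>(2) k0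
      by (simp add: S(3) gS c_def fls_compose_power_const_left mult_ac)
    then have c0: "c i = 0" if "i < k" for i using compose_power_direct[OF k0] that by blast
    have "g i x = 0" if i: "i < k" for i
    proof -
      have "g i S' = 0" using c0[OF i] \<zeta>0 by (simp add: c_def)
      then have "g i S = 0" by (simp add: gS)
      then show ?thesis using IH2[OF g(1)[rule_format] Sm(2) S(2)] Sol_mono[OF x] by auto
    qed
    then show "f x = 0" using g(2) x by simp
  qed
qed

text \<open>The product of \<open>f\<close> with its proper twists is a norm, which involves one coordinate less.\<close>

lemma coord_multiple:
  assumes "2 \<le> m" "m \<le> n + 1"
  shows "\<forall>f\<in>coord m. (\<exists>x\<in>Sol m. nonconst x \<and> f x \<noteq> 0) \<longrightarrow>
    (\<exists>g\<in>coord m. \<exists>q. q \<noteq> 0 \<and> (\<forall>x\<in>Sol m. f x * g x = fpoly q (x 2)))"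
  using assms
proof (induction m rule: nat_induct_at_least)
  case base
  show ?case
  proof (intro ballI impI)
    fix f :: "(nat \<Rightarrow> 'a fls) \<Rightarrow> 'a fls"
    assume "f \<in> coord 2" and nz: "\<exists>x\<in>Sol 2. nonconst x \<and> f x \<noteq> 0"
    then obtain p where p: "\<And>x. f x = fpoly p (x 2)" using coord_base by metis
    then have "p \<noteq> 0" using nz by auto
    then show "\<exists>g\<in>coord 2. \<exists>q. q \<noteq> 0 \<and> (\<forall>x\<in>Sol 2. f x * g x = fpoly q (x 2))"
      using p coord_1 by (intro bexI[of _ "\<lambda>_. 1"] exI[of _ p]) auto
  qed
next
  case (Suc m)
  have m: "2 \<le> m" "m \<le> n + 1" "Suc m \<le> n + 1" using Suc by auto
  show ?case
  proof (intro ballI impI)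
    fix f :: "(nat \<Rightarrow> 'a fls) \<Rightarrow> 'a fls"
    assume f: "f \<in> coord (Suc m)" and "\<exists>x\<in>Sol (Suc m). nonconst x \<and> f x \<noteq> 0"
    then obtain w where w: "w \<in> Sol (Suc m)" "nonconst w" "f w \<noteq> 0" by blast
    have nz: "f x \<noteq> 0" if "x \<in> Sol (Suc m)" "nonconst x" for x
      using coord_vanish[OF _ m(3)] m(1) f w that by (meson le_SucI)
    obtain N where N: "N \<in> coord m"
      "\<forall>x\<in>Sol (Suc m). (\<Prod>\<zeta>\<in>unity_roots k. f (twist (Suc m) \<zeta> x)) = N x"
      using coord_norm[OF f m(1)] by blast
    have fin: "finite (unity_roots k :: 'a set)" by (rule finite_unity_roots[OF k0])
    have "f (twist (Suc m) \<zeta> w) \<noteq> 0" if "\<zeta> ^ k = 1" for \<zeta>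
      by (rule nz) (use twist_Sol[OF _ that w(1)] m w(2) in \<open>auto simp: twist_def\<close>)
    then have "(\<Prod>\<zeta>\<in>unity_roots k. f (twist (Suc m) \<zeta> w)) \<noteq> 0" by (simp add: prod_zero_iff[OF fin])
    then have "N w \<noteq> 0" using N(2) w(1) by simp
    then have "\<exists>x\<in>Sol m. nonconst x \<and> N x \<noteq> 0" using Sol_mono[OF w(1)] w(2) by auto
    then obtain g q where g: "g \<in> coord m" "q \<noteq> 0" "\<forall>x\<in>Sol m. N x * g x = fpoly q (x 2)"
      using Suc.IH[OF m(2)] N(1) by blast
    let ?G = "\<lambda>x. (\<Prod>\<zeta>\<in>unity_roots k - {1}. f (twist (Suc m) \<zeta> x)) * g x"
    have "?G \<in> coord (Suc m)"
      using coord_mono[OF g(1), of "Suc m"] by (intro coord.mult coord_prod coord_twist f) auto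
    moreover have "f x * ?G x = fpoly q (x 2)" if x: "x \<in> Sol (Suc m)" for x
    proof -
      have "f x * ?G x = (\<Prod>\<zeta>\<in>unity_roots k. f (twist (Suc m) \<zeta> x)) * g x"
        using prod.remove[OF fin, of 1 "\<lambda>\<zeta>. f (twist (Suc m) \<zeta> x)"] by (simp add: mult_ac)
      then show ?thesis using N(2) g(3) x Sol_mono[OF x] by auto
    qed
    ultimately show "\<exists>g\<in>coord (Suc m). \<exists>q. q \<noteq> 0 \<and> (\<forall>x\<in>Sol (Suc m). f x * g x = fpoly q (x 2))"
      using g(2) by (intro bexI[of _ ?G] exI[of _ q]) auto
  qed
qed

end

section \<open>Evaluating forms at Laurent series\<close>

definition mdeg :: "(nat \<Rightarrow>\<^sub>0 nat) \<Rightarrow> nat" where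
  "mdeg m = (\<Sum>i\<in>Poly_Mapping.keys m. Poly_Mapping.lookup m i)"

definition mon :: "(nat \<Rightarrow> 'b::comm_ring_1) \<Rightarrow> (nat \<Rightarrow>\<^sub>0 nat) \<Rightarrow> 'b" where
  "mon x m = (\<Prod>i\<in>Poly_Mapping.keys m. x i ^ Poly_Mapping.lookup m i)"

lemma mdeg_superset:
  "finite S \<Longrightarrow> Poly_Mapping.keys m \<subseteq> S \<Longrightarrow> mdeg m = (\<Sum>i\<in>S. Poly_Mapping.lookup m i)"
  unfolding mdeg_def by (rule sum.mono_neutral_left) (auto simp: not_in_keys_iff_lookup_eq_zero)

lemma mon_superset:
  "finite S \<Longrightarrow> Poly_Mapping.keys m \<subseteq> S \<Longrightarrow> mon x m = (\<Prod>i\<in>S. x i ^ Poly_Mapping.lookup m i)"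
  unfolding mon_def by (rule prod.mono_neutral_left) (auto simp: not_in_keys_iff_lookup_eq_zero)

lemma mdeg_add: "mdeg (m + l) = mdeg m + mdeg l"
proof -
  let ?S = "Poly_Mapping.keys m \<union> Poly_Mapping.keys l"
  have "mdeg (m + l) = (\<Sum>i\<in>?S. Poly_Mapping.lookup (m + l) i)"
    by (rule mdeg_superset) (use keys_add[of m l] in auto)
  moreover have "mdeg m = (\<Sum>i\<in>?S. Poly_Mapping.lookup m i)" "mdeg l = (\<Sum>i\<in>?S. Poly_Mapping.lookup l i)"
    by (rule mdeg_superset; simp)+
  ultimately show ?thesis by (simp add: lookup_add sum.distrib)
qed

lemma mon_add: "mon x (m + l) = mon x m * mon x l"
proof -
  let ?S = "Poly_Mapping.keys m \<union> Poly_Mapping.keys l"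
  have "mon x (m + l) = (\<Prod>i\<in>?S. x i ^ Poly_Mapping.lookup (m + l) i)"
    by (rule mon_superset) (use keys_add[of m l] in auto)
  moreover have "mon x m = (\<Prod>i\<in>?S. x i ^ Poly_Mapping.lookup m i)"
    "mon x l = (\<Prod>i\<in>?S. x i ^ Poly_Mapping.lookup l i)"
    by (rule mon_superset; simp)+
  ultimately show ?thesis by (simp add: lookup_add power_add prod.distrib)
qed

lemma mon_scale: "mon (\<lambda>i. s * x i) m = s ^ mdeg m * mon x m"
  by (simp add: mon_def mdeg_def power_mult_distrib prod.distrib power_sum)

definition ev :: "(nat \<Rightarrow> 'a::field fls) \<Rightarrow> 'a mpoly \<Rightarrow> 'a fls" where
  "ev x p = (\<Sum>m\<in>Poly_Mapping.keys p. fls_const (Poly_Mapping.lookup p m) * mon x m)"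

lemma ev_superset:
  "finite S \<Longrightarrow> Poly_Mapping.keys p \<subseteq> S \<Longrightarrow> ev x p = (\<Sum>m\<in>S. fls_const (Poly_Mapping.lookup p m) * mon x m)"
  unfolding ev_def by (rule sum.mono_neutral_left) (auto simp: not_in_keys_iff_lookup_eq_zero)

lemma ev_0 [simp]: "ev x 0 = 0"
  by (simp add: ev_def)

lemma ev_add: "ev x (p + q) = ev x p + ev x q"
proof -
  let ?S = "Poly_Mapping.keys p \<union> Poly_Mapping.keys q"
  have "ev x (p + q) = (\<Sum>m\<in>?S. fls_const (Poly_Mapping.lookup (p + q) m) * mon x m)"
    by (rule ev_superset) (use keys_add[of p q] in auto)
  moreover have "ev x p = (\<Sum>m\<in>?S. fls_const (Poly_Mapping.lookup p m) * mon x m)"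
    "ev x q = (\<Sum>m\<in>?S. fls_const (Poly_Mapping.lookup q m) * mon x m)"
    by (rule ev_superset; simp)+
  ultimately show ?thesis
    by (simp add: lookup_add fls_plus_const[symmetric] distrib_right sum.distrib)
qed

lemma ev_diff: "ev x (p - q) = ev x p - ev x q"
  using ev_add[of x "p - q" q] by simp

lemma ev_sum: "ev x (\<Sum>i\<in>I. f i) = (\<Sum>i\<in>I. ev x (f i))"
  by (induction I rule: infinite_finite_induct) (auto simp: ev_add)

lemma ev_single: "ev x (Poly_Mapping.single m c) = fls_const c * mon x m"
  by (simp add: ev_def)

lemma mpoly_expand: "(p :: 'a::field mpoly) = (\<Sum>m\<in>Poly_Mapping.keys p. Poly_Mapping.single m (Poly_Mapping.lookup p m))"
proof (rule poly_mapping_eqI)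
  fix l
  have "Poly_Mapping.lookup (\<Sum>m\<in>Poly_Mapping.keys p. Poly_Mapping.single m (Poly_Mapping.lookup p m)) l
      = (\<Sum>m\<in>Poly_Mapping.keys p. if m = l then Poly_Mapping.lookup p m else 0)"
    by (simp add: lookup_sum lookup_single when_def)
  then show "Poly_Mapping.lookup p l = Poly_Mapping.lookup
      (\<Sum>m\<in>Poly_Mapping.keys p. Poly_Mapping.single m (Poly_Mapping.lookup p m)) l"
    by (simp add: sum.delta not_in_keys_iff_lookup_eq_zero)
qed

lemma ev_mult: "ev x (p * q) = ev x p * ev x q"
proof -
  have "p * q = (\<Sum>m\<in>Poly_Mapping.keys p. Poly_Mapping.single m (Poly_Mapping.lookup p m)) *
      (\<Sum>l\<in>Poly_Mapping.keys q. Poly_Mapping.single l (Poly_Mapping.lookup q l))"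
    using mpoly_expand[of p] mpoly_expand[of q] by simp
  also have "\<dots> = (\<Sum>m\<in>Poly_Mapping.keys p. \<Sum>l\<in>Poly_Mapping.keys q.
      Poly_Mapping.single (m + l) (Poly_Mapping.lookup p m * Poly_Mapping.lookup q l))"
    by (simp add: sum_product mult_single)
  finally have "ev x (p * q) = (\<Sum>m\<in>Poly_Mapping.keys p. \<Sum>l\<in>Poly_Mapping.keys q.
      (fls_const (Poly_Mapping.lookup p m) * mon x m) * (fls_const (Poly_Mapping.lookup q l) * mon x l))"
    by (simp add: ev_sum ev_single mon_add mult_ac flip: fls_const_mult_const)
  then show ?thesis by (simp add: ev_def sum_product)
qed

lemma ev_Const [simp]: "ev x (Const c) = fls_const c"
  by (simp add: Const_def ev_single mon_def)

lemma ev_1 [simp]: "ev x 1 = 1"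
  using ev_Const[of x 1] by (simp add: Const_def)

lemma ev_Var [simp]: "ev x (Var i) = x i"
  by (simp add: Var_def ev_single mon_def)

lemma ev_power: "ev x (p ^ d) = ev x p ^ d"
  by (induction d) (auto simp: ev_mult)

lemma ev_const_point: "ev (\<lambda>i. fls_const (p i)) g = fls_const (mpoly_eval p g)"
proof -
  have "mon (\<lambda>i. fls_const (p i)) m = fls_const (mon p m)" for m
  proof -
    have "fls_const (\<Prod>i\<in>I. f i) = (\<Prod>i\<in>I. fls_const (f i))" for I and f :: "nat \<Rightarrow> 'a"
      by (induction I rule: infinite_finite_induct) (auto simp flip: fls_const_mult_const)
    then show ?thesis by (simp add: mon_def fls_const_power)
  qed
  then show ?thesis by (simp add: ev_def mpoly_eval_def mon_def[symmetric] fls_const_sum)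
qed

lemma forms_iff: "g \<in> forms n d \<longleftrightarrow> (\<forall>m\<in>Poly_Mapping.keys g. Poly_Mapping.keys m \<subseteq> {1..n+1} \<and> mdeg m = d)"
  by (simp add: forms_def mdeg_def)

lemma forms_keys: "g \<in> forms n d \<Longrightarrow> m \<in> Poly_Mapping.keys g \<Longrightarrow> Poly_Mapping.keys m \<subseteq> {1..n+1}"
  unfolding forms_iff by blast

lemma forms_0 [simp]: "0 \<in> forms n d" by (simp add: forms_iff)

lemma forms_add: "g \<in> forms n d \<Longrightarrow> h \<in> forms n d \<Longrightarrow> g + h \<in> forms n d"
  unfolding forms_iff using keys_add[of g h] by blast

lemma forms_uminus: "g \<in> forms n d \<Longrightarrow> - g \<in> forms n d"
  by (auto simp: forms_iff in_keys_iff)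

lemma forms_diff: "g \<in> forms n d \<Longrightarrow> h \<in> forms n d \<Longrightarrow> g - h \<in> forms n d"
  using forms_add[OF _ forms_uminus] by (metis add_uminus_conv_diff)

lemma forms_mult: "g \<in> forms n d \<Longrightarrow> h \<in> forms n e \<Longrightarrow> g * h \<in> forms n (d + e)"
  unfolding forms_iff
proof
  fix m assume *: "\<forall>m\<in>Poly_Mapping.keys g. Poly_Mapping.keys m \<subseteq> {1..n+1} \<and> mdeg m = d"
    "\<forall>m\<in>Poly_Mapping.keys h. Poly_Mapping.keys m \<subseteq> {1..n+1} \<and> mdeg m = e"
    and "m \<in> Poly_Mapping.keys (g * h)"
  then obtain a b where ab: "m = a + b" "a \<in> Poly_Mapping.keys g" "b \<in> Poly_Mapping.keys h"
    using keys_mult[of g h] by blast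
  then have "Poly_Mapping.keys a \<subseteq> {1..n+1}" "mdeg a = d" "Poly_Mapping.keys b \<subseteq> {1..n+1}" "mdeg b = e"
    using * by blast+
  then show "Poly_Mapping.keys m \<subseteq> {1..n+1} \<and> mdeg m = d + e"
    using keys_add[of a b] unfolding ab(1) mdeg_add by blast
qed

lemma forms_Const [simp]: "Const c \<in> forms n 0"
  by (auto simp: forms_iff Const_def mdeg_def)

lemma forms_1 [simp]: "1 \<in> forms n 0"
  by (auto simp: forms_iff mdeg_def)

lemma forms_Var: "1 \<le> i \<Longrightarrow> i \<le> n + 1 \<Longrightarrow> Var i \<in> forms n 1"
  by (auto simp: forms_iff Var_def mdeg_def)

lemma forms_power: "g \<in> forms n d \<Longrightarrow> g ^ e \<in> forms n (d * e)"
  by (induction e) (auto dest: forms_mult)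

lemma ev_scale: "g \<in> forms n d \<Longrightarrow> ev (\<lambda>i. s * x i) g = s ^ d * ev x g"
  by (auto simp: ev_def forms_iff mon_scale sum_distrib_left mult_ac intro!: sum.cong)

lemma eval_scale: "g \<in> forms n d \<Longrightarrow> mpoly_eval (\<lambda>i. s * x i) g = s ^ d * mpoly_eval x g"
  for s :: "'a::field"
proof -
  assume g: "g \<in> forms n d"
  have "fls_const (mpoly_eval (\<lambda>i. s * x i) g) = fls_const (s ^ d * mpoly_eval x g)"
    unfolding ev_const_point[symmetric] fls_const_mult_const[symmetric] fls_const_power
    by (rule ev_scale[OF g])
  then show ?thesis by (metis fls_const_nth)
qed

lemma ev_local: "g \<in> forms n d \<Longrightarrow> (\<And>i. i \<in> {1..n+1} \<Longrightarrow> x i = y i) \<Longrightarrow> ev x g = ev y g"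
  by (auto simp: ev_def forms_iff mon_def subset_iff intro!: sum.cong prod.cong arg_cong2[where f = "(*)"])

lemma ev_const_term:
  assumes g: "g \<in> forms n d" and y: "\<And>i. i \<in> {1..n+1} \<Longrightarrow> integral (y i) \<and> fls_nth (y i) 0 = p i"
  shows "integral (ev y g)" "fls_nth (ev y g) 0 = mpoly_eval p g"
proof -
  have mon: "integral (mon y m) \<and> fls_nth (mon y m) 0 = mon p m" if "m \<in> Poly_Mapping.keys g" for m
  proof -
    have m: "Poly_Mapping.keys m \<subseteq> {1..n+1}" using g that by (rule forms_keys)
    have i: "integral (y i ^ e)" "fls_nth (y i ^ e) 0 = p i ^ e" if "i \<in> Poly_Mapping.keys m" for i e
      using const_term_power[of "y i" e] y[of i] m that by auto
    then show ?thesis unfolding mon_def by (auto intro!: integral_prod simp: const_term_prod)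
  qed
  then show "integral (ev y g)" unfolding ev_def by (intro integral_sum integral_mult) auto
  show "fls_nth (ev y g) 0 = mpoly_eval p g"
    unfolding ev_def mpoly_eval_def fls_nth_sum mon_def[symmetric]
    by (intro sum.cong refl) (use mon in \<open>simp add: const_term_mult\<close>)
qed

lemma ev_coord:
  assumes g: "g \<in> forms n d"
  shows "(\<lambda>x. ev (x(1 := 1)) g) \<in> coord (n + 1)"
  unfolding ev_def mon_def
proof (intro coord_sum coord.mult coord.const coord_prod coord_power)
  fix m i assume "m \<in> Poly_Mapping.keys g" "i \<in> Poly_Mapping.keys m"
  then have "i \<in> {1..n+1}" using forms_keys[OF g] by blast
  then have "i = 1 \<or> 2 \<le> i \<and> i \<le> n + 1" by auto
  then show "(\<lambda>x. (x(1 := 1)) i) \<in> coord (n + 1)" by (auto intro: coord_1 coord.var)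
qed

section \<open>The curve\<close>

text \<open>The first equation of the curve has the shape of the others with the parameter \<open>1\<close>, so that
  \<open>1, lam 1, \<dots>, lam (n - 2)\<close> play the role of the \<open>\<mu>_j\<close>.\<close>

locale gen_fermat =
  fixes k n :: nat and lam :: "nat \<Rightarrow> 'a::alg_closed_field"
  assumes k_ge: "k \<ge> 2" and n_ge: "n \<ge> 2" and k_ne: "of_nat k \<noteq> (0::'a)"
    and lam_ne: "\<forall>i\<in>{1..n-2}. lam i \<noteq> 0 \<and> lam i \<noteq> 1" and lam_inj: "inj_on lam {1..n-2}"
begin

definition branch_value :: "nat \<Rightarrow> 'a" where
  "branch_value j = (if j = 3 then 1 else lam (j - 3))"

sublocale fermat_series k n branch_value
proof
  show "k \<ge> 2" "n \<ge> 2" "of_nat k \<noteq> (0::'a)" by (rule k_ge n_ge k_ne)+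
  show "branch_value j \<noteq> 0" if "3 \<le> j" "j \<le> n + 1" for j
  proof (cases "j = 3")
    case False
    then have "j - 3 \<in> {1..n-2}" using that by auto
    then show ?thesis using lam_ne False by (simp add: branch_value_def)
  qed (simp add: branch_value_def)
  show "inj_on branch_value {3..n + 1}"
  proof (rule inj_onI)
    fix i j assume *: "i \<in> {3..n+1}" "j \<in> {3..n+1}" "branch_value i = branch_value j"
    have r: "l - 3 \<in> {1..n-2}" if "l \<in> {3..n+1}" "l \<noteq> 3" for l using that by auto
    show "i = j"
    proof (cases "i = 3 \<or> j = 3")
      case True
      then show ?thesis using * r lam_ne by (auto simp: branch_value_def split: if_splits)
    next
      case False
      then have "lam (i - 3) = lam (j - 3)" using * by (auto simp: branch_value_def)
      then have "i - 3 = j - 3" using lam_inj r * False by (auto dest: inj_onD)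
      then show ?thesis using * by auto
    qed
  qed
qed

abbreviation "C \<equiv> gen_fermat_curve k n lam"

lemma proportional_equiv: "equiv (homog_vectors n) (proportional n :: ((nat \<Rightarrow> 'a) \<times> (nat \<Rightarrow> 'a)) set)"
proof (rule equivI)
  let ?H = "homog_vectors n :: (nat \<Rightarrow> 'a) set" and ?R = "proportional n :: ((nat \<Rightarrow> 'a) \<times> (nat \<Rightarrow> 'a)) set"
  show "?R \<subseteq> ?H \<times> ?H" by (auto simp: proportional_def)
  show "refl_on ?H ?R"
    by (rule refl_onI) (auto simp: proportional_def intro!: exI[of _ 1])
  show "sym ?R"
  proof (rule symI)
    fix x y :: "nat \<Rightarrow> 'a" assume "(x, y) \<in> proportional n"
    then obtain c where c: "x \<in> homog_vectors n" "y \<in> homog_vectors n" "c \<noteq> 0" "y = (\<lambda>i. c * x i)"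
      by (auto simp: proportional_def)
    then have "x = (\<lambda>i. inverse c * y i)" by (auto simp: field_simps)
    then show "(y, x) \<in> proportional n" using c by (auto simp: proportional_def intro!: exI[of _ "inverse c"])
  qed
  show "trans ?R"
  proof (rule transI)
    fix x y z :: "nat \<Rightarrow> 'a" assume "(x, y) \<in> proportional n" "(y, z) \<in> proportional n"
    then obtain c d where c: "x \<in> homog_vectors n" "z \<in> homog_vectors n" "c \<noteq> 0" "y = (\<lambda>i. c * x i)"
      "d \<noteq> 0" "z = (\<lambda>i. d * y i)"
      by (auto simp: proportional_def)
    then show "(x, z) \<in> proportional n"
      by (auto simp: proportional_def intro!: exI[of _ "d * c"])
  qed
qed

lemma point_rep:
  fixes P :: "(nat \<Rightarrow> 'a) set"
  assumes "P \<in> proj_space n" "p \<in> P"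
  shows "p \<in> homog_vectors n" "P = proportional n `` {p}"
proof -
  obtain q where q: "q \<in> homog_vectors n" "P = proportional n `` {q}"
    using assms(1) unfolding proj_space_def by (rule quotientE)
  then have "(q, p) \<in> proportional n" using assms(2) by auto
  then show "p \<in> homog_vectors n" by (simp add: proportional_def)
  show "P = proportional n `` {p}"
    unfolding q(2) by (rule equiv_class_eq[OF proportional_equiv]) fact
qed

lemma point_nonempty:
  fixes P :: "(nat \<Rightarrow> 'a) set"
  assumes "P \<in> proj_space n" shows "\<exists>p. p \<in> P"
proof -
  obtain q where q: "q \<in> homog_vectors n" "P = proportional n `` {q}"
    using assms unfolding proj_space_def by (rule quotientE)
  then have "q \<in> P" using equiv_class_self[OF proportional_equiv q(1)] by simp
  then show ?thesis by blast
qed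

lemma vanishes_at_rep:
  fixes P :: "(nat \<Rightarrow> 'a) set"
  assumes "P \<in> proj_space n" "p \<in> P" "g \<in> forms n d"
  shows "vanishes_at g P \<longleftrightarrow> mpoly_eval p g = 0"
proof -
  have "mpoly_eval q g = 0 \<longleftrightarrow> mpoly_eval p g = 0" if "q \<in> P" for q
  proof -
    have "(p, q) \<in> proportional n" using point_rep(2)[OF assms(1,2)] that by auto
    then obtain c where "c \<noteq> 0" "q = (\<lambda>i. c * p i)" by (auto simp: proportional_def)
    then show ?thesis using eval_scale[OF assms(3), of c p] by simp
  qed
  then show ?thesis unfolding vanishes_at_def using assms(2) by blast
qed

lemma C_iff:
  assumes "P \<in> proj_space n" "p \<in> P"
  shows "P \<in> C \<longleftrightarrow> (\<forall>j\<in>{3..n+1}. p j ^ k = - (branch_value j * p 1 ^ k + p 2 ^ k))"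
proof -
  let ?f = "Var 1 ^ k + Var 2 ^ k + Var 3 ^ k :: 'a mpoly"
  let ?g = "\<lambda>i. Const (lam i) * Var 1 ^ k + Var 2 ^ k + Var (i + 3) ^ k :: 'a mpoly"
  have V: "Var i ^ k \<in> (forms n k :: 'a mpoly set)" if "1 \<le> i" "i \<le> n + 1" for i
    using forms_power[OF forms_Var[OF that], of k] by simp
  have ff: "?f \<in> forms n k" using n_ge by (intro forms_add V) auto
  have gf: "?g i \<in> forms n k" if "i \<in> {1..n-2}" for i
    using n_ge that forms_mult[OF forms_Const V[of 1]] by (intro forms_add V) auto
  have e: "fls_const (mpoly_eval p q) = ev (\<lambda>i. fls_const (p i)) q" for q by (simp add: ev_const_point)
  have fe: "mpoly_eval p ?f = p 1 ^ k + p 2 ^ k + p 3 ^ k"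
  proof -
    have "fls_const (mpoly_eval p ?f) = fls_const (p 1 ^ k + p 2 ^ k + p 3 ^ k)"
      unfolding e by (simp add: ev_add ev_power fls_const_power flip: fls_plus_const)
    then show ?thesis by (metis fls_const_nth)
  qed
  have ge: "mpoly_eval p (?g i) = lam i * p 1 ^ k + p 2 ^ k + p (i + 3) ^ k" for i
  proof -
    have "fls_const (mpoly_eval p (?g i)) = fls_const (lam i * p 1 ^ k + p 2 ^ k + p (i + 3) ^ k)"
      unfolding e by (simp add: ev_add ev_mult ev_power fls_const_power flip: fls_plus_const fls_const_mult_const)
    then show ?thesis by (metis fls_const_nth)
  qed
  have "P \<in> C \<longleftrightarrow> vanishes_at ?f P \<and> (\<forall>i\<in>{1..n-2}. vanishes_at (?g i) P)"
    unfolding gen_fermat_curve_def zero_locus_def using assms(1) by blast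
  also have "\<dots> \<longleftrightarrow> mpoly_eval p ?f = 0 \<and> (\<forall>i\<in>{1..n-2}. mpoly_eval p (?g i) = 0)"
    by (intro conj_cong ball_cong refl vanishes_at_rep[OF assms ff] vanishes_at_rep[OF assms gf])
  also have "\<dots> \<longleftrightarrow> (\<forall>j\<in>{3..n+1}. p j ^ k = - (branch_value j * p 1 ^ k + p 2 ^ k))"
  proof
    assume L: "mpoly_eval p ?f = 0 \<and> (\<forall>i\<in>{1..n-2}. mpoly_eval p (?g i) = 0)"
    show "\<forall>j\<in>{3..n+1}. p j ^ k = - (branch_value j * p 1 ^ k + p 2 ^ k)"
    proof
      fix j assume j: "j \<in> {3..n+1}"
      show "p j ^ k = - (branch_value j * p 1 ^ k + p 2 ^ k)"
      proof (cases "j = 3")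
        case True
        have "p 1 ^ k + p 2 ^ k + p 3 ^ k = 0" using L unfolding fe by blast
        then have "p 3 ^ k + (p 1 ^ k + p 2 ^ k) = 0" by (simp add: add_ac)
        then have "p 3 ^ k = - (p 1 ^ k + p 2 ^ k)" by (rule eq_neg_iff_add_eq_0[THEN iffD2])
        then show ?thesis using True by (simp add: branch_value_def)
      next
        case False
        then have "j - 3 \<in> {1..n-2}" "j - 3 + 3 = j" using j by auto
        then have "lam (j - 3) * p 1 ^ k + p 2 ^ k + p j ^ k = 0" 
          using L unfolding ge by metis
        then have "p j ^ k + (lam (j - 3) * p 1 ^ k + p 2 ^ k) = 0" by (simp add: add_ac)
        then have "p j ^ k = - (lam (j - 3) * p 1 ^ k + p 2 ^ k)" by (rule eq_neg_iff_add_eq_0[THEN iffD2])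
        then show ?thesis using False by (simp add: branch_value_def)
      qed
    qed
  next
    assume R: "\<forall>j\<in>{3..n+1}. p j ^ k = - (branch_value j * p 1 ^ k + p 2 ^ k)"
    have "p 1 ^ k + p 2 ^ k + p 3 ^ k = 0"
      using R[rule_format, of 3] n_ge by (simp add: branch_value_def)
    moreover have "lam i * p 1 ^ k + p 2 ^ k + p (i + 3) ^ k = 0" if "i \<in> {1..n-2}" for i
    proof -
      have "i + 3 \<in> {3..n+1}" "i + 3 \<noteq> 3" using that by auto
      then show ?thesis using R[rule_format, of "i + 3"] by (simp add: branch_value_def)
    qed
    ultimately show "mpoly_eval p ?f = 0 \<and> (\<forall>i\<in>{1..n-2}. mpoly_eval p (?g i) = 0)"
      unfolding fe ge by blast
  qed
  finally show ?thesis .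
qed

end

text \<open>The field axioms are equations, and they can be verified after applying \<open>T\<close>.\<close>

lemma field_of_inj_hom:
  fixes F :: "('a, 'b) ring_scheme" (structure) and expand :: "'a \<Rightarrow> 'k::field"
  assumes inj: "inj_on expand (carrier F)"
    and add: "\<And>a b. a \<in> carrier F \<Longrightarrow> b \<in> carrier F \<Longrightarrow> a \<oplus> b \<in> carrier F \<and> expand (a \<oplus> b) = expand a + expand b"
    and mult: "\<And>a b. a \<in> carrier F \<Longrightarrow> b \<in> carrier F \<Longrightarrow> a \<otimes> b \<in> carrier F \<and> expand (a \<otimes> b) = expand a * expand b"
    and zero: "\<zero> \<in> carrier F \<and> expand \<zero> = 0" and one: "\<one> \<in> carrier F \<and> expand \<one> = 1"
    and neg: "\<And>a. a \<in> carrier F \<Longrightarrow> \<exists>b\<in>carrier F. expand b = - expand a"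
    and inv: "\<And>a. a \<in> carrier F \<Longrightarrow> expand a \<noteq> 0 \<Longrightarrow> \<exists>b\<in>carrier F. expand b = inverse (expand a)"
  shows "field F"
proof -
  have eqI: "a = b" if "a \<in> carrier F" "b \<in> carrier F" "expand a = expand b" for a b
    using inj that by (auto dest: inj_onD)
  have "abelian_group F"
  proof (rule abelian_groupI)
    fix a assume a: "a \<in> carrier F"
    obtain b where b: "b \<in> carrier F" "expand b = - expand a" using neg a by blast
    have "b \<oplus> a = \<zero>" by (rule eqI) (use a b add zero in auto)
    then show "\<exists>b\<in>carrier F. b \<oplus> a = \<zero>" using b by blast
  qed (use add zero in \<open>auto intro!: eqI\<close>)
  moreover have "comm_monoid F"
    by (rule comm_monoidI) (use mult one in \<open>auto intro!: eqI\<close>)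
  ultimately interpret cring F
    by (rule cringI) (use add mult in \<open>auto intro!: eqI simp: distrib_right\<close>)
  show ?thesis
  proof (rule cring_fieldI2)
    show "\<zero> \<noteq> \<one>" using zero one by auto
    fix a assume a: "a \<in> carrier F" "a \<noteq> \<zero>"
    then have "expand a \<noteq> 0" using eqI zero by metis
    then obtain b where b: "b \<in> carrier F" "expand b = inverse (expand a)" using inv a by blast
    have "a \<otimes> b = \<one>" by (rule eqI) (use a b mult one \<open>expand a \<noteq> 0\<close> in auto)
    then show "\<exists>b\<in>carrier F. a \<otimes> b = \<one>" using b by blast
  qed
qed

lemma UN_UN_const:
  assumes "(a, b) \<in> A" "(a', b') \<in> B"
    and "\<And>u v u' v'. (u, v) \<in> A \<Longrightarrow> (u', v') \<in> B \<Longrightarrow> f u v u' v' = c"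
  shows "(\<Union>(u, v)\<in>A. \<Union>(u', v')\<in>B. f u v u' v') = c"
proof (intro equalityI subsetI)
  fix z assume "z \<in> c"
  then have "z \<in> f a b a' b'" using assms by blast
  then show "z \<in> (\<Union>(u, v)\<in>A. \<Union>(u', v')\<in>B. f u v u' v')" using assms(1,2) by blast
qed (use assms(3) in blast)

context gen_fermat
begin

lemma scale_mem:
  assumes P: "P \<in> proj_space n" and p: "p \<in> P" and c: "c \<noteq> (0 :: 'a)"
  shows "(\<lambda>i. c * p i) \<in> P"
proof -
  have "p \<in> homog_vectors n" and PP: "P = proportional n `` {p}" using point_rep[OF P p] by auto
  moreover have "(\<lambda>i. c * p i) \<in> homog_vectors n" using calculation(1) c by (auto simp: homog_vectors_def)
  ultimately have "(p, \<lambda>i. c * p i) \<in> proportional n" using c by (auto simp: proportional_def)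
  then show ?thesis unfolding PP by simp
qed

lemma C_proj: "P \<in> C \<Longrightarrow> P \<in> proj_space n"
  by (simp add: gen_fermat_curve_def zero_locus_def)

lemma C_eq: "P \<in> C \<Longrightarrow> p \<in> P \<Longrightarrow> j \<in> {3..n+1} \<Longrightarrow> p j ^ k = - (branch_value j * p 1 ^ k + p 2 ^ k)"
  using C_iff[OF C_proj] by blast

lemma class_in_C:
  assumes "p \<in> homog_vectors n" "\<And>j. j \<in> {3..n+1} \<Longrightarrow> p j ^ k = - (branch_value j * p 1 ^ k + p 2 ^ k)"
  shows "proportional n `` {p} \<in> C" "p \<in> proportional n `` {p}"
proof -
  show p: "p \<in> proportional n `` {p}" using equiv_class_self[OF proportional_equiv assms(1)] .
  have "proportional n `` {p} \<in> proj_space n" unfolding proj_space_def using assms(1) by (rule quotientI)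
  then show "proportional n `` {p} \<in> C" using C_iff[OF _ p] assms(2) by blast
qed

text \<open>Each of these points embeds the function field into the field of Laurent series: by irreducibility a function
  that does not vanish on the curve does not vanish along them either.\<close>

definition generic_points :: "(nat \<Rightarrow> 'a fls) set" where
  "generic_points = {x \<in> Sol (n+1). nonconst x}"

lemma affine_point_eq:
  assumes "P \<in> C" "p \<in> P" "p 1 = 1" "j \<in> {3..n+1}"
  shows "p j ^ k = poly (radicand j) (p 2)"
  using C_eq[OF assms(1,2,4)] assms(3) by (simp add: poly_radicand)

text \<open>If \<open>x_1 = x_2 = 0\<close>, the equations force all the other coordinates to vanish as well.\<close>

lemma point_cases:
  assumes P: "P \<in> C"
  obtains (affine) p where "p \<in> P" "p 1 = 1"
  | (infinite) p where "p \<in> P" "p 1 = 0" "p 2 \<noteq> 0"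
proof -
  obtain p where p: "p \<in> P" using point_nonempty[OF C_proj[OF P]] by blast
  show ?thesis
  proof (cases "p 1 = 0")
    case True
    have "p 2 \<noteq> 0"
    proof
      assume p2: "p 2 = 0"
      have "p i = 0" for i
      proof (cases "i \<in> {3..n+1}")
        case in3: True
        have "p i ^ k = 0" using C_eq[OF P p in3] True p2 k0 by (simp add: power_0_left)
        then show ?thesis by simp
      next
        case False
        then have "i \<notin> {1..n+1} \<or> i = 1 \<or> i = 2" by auto
        then show ?thesis using True p2 point_rep(1)[OF C_proj[OF P] p] by (auto simp: homog_vectors_def)
      qed
      then show False using point_rep(1)[OF C_proj[OF P] p] by (auto simp: homog_vectors_def)
    qed
    then show ?thesis using infinite p True by blast
  next
    case False
    then have "(\<lambda>i. inverse (p 1) * p i) \<in> P" by (intro scale_mem[OF C_proj[OF P] p]) simp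
    then show ?thesis using affine[of "\<lambda>i. inverse (p 1) * p i"] False by simp
  qed
qed

lemma branch_at_point:
  assumes P: "P \<in> C"
  shows "\<exists>p\<in>P. \<exists>x\<in>generic_points. centered x p"
  using P
proof (cases rule: point_cases)
  case (affine p)
  note eq = affine_point_eq[OF P affine]
  show ?thesis
  proof (cases "\<exists>l\<in>{3..n+1}. p l = 0")
    case True
    then show ?thesis using branch_ramified[OF affine(2) eq] affine(1) unfolding generic_points_def by blast
  next
    case False
    then show ?thesis using branch_unramified[of p] affine eq unfolding generic_points_def by blast
  qed
next
  case (infinite p)
  have "p j ^ k = - (p 2 ^ k)" if "j \<in> {3..n+1}" for j
    using C_eq[OF P infinite(1) that] infinite(2) k0 by (simp add: power_0_left)
  then show ?thesis using branch_infinity[OF infinite(2,3)] infinite(1) unfolding generic_points_def by blast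
qed

lemma ev_centered:
  assumes g: "g \<in> forms n d" and x: "centered x p"
  shows "\<exists>s. integral (s ^ d * ev x g) \<and> fls_nth (s ^ d * ev x g) 0 = mpoly_eval p g"
proof -
  obtain s where "\<forall>i\<in>{1..n+1}. integral (s * x i) \<and> fls_nth (s * x i) 0 = p i"
    using x unfolding centered_def by blast
  then show ?thesis using ev_const_term[OF g, of "\<lambda>i. s * x i" p] by (auto simp: ev_scale[OF g])
qed

text \<open>A form that vanishes along one nonconstant point vanishes along all Laurent series points by irreducibility,
  and therefore at the centres of the branches, which exhaust the curve. Conversely, vanishing on the curve
  includes the affine points with constant coordinates.\<close>

lemma vanish_iff:
  assumes g: "g \<in> forms n d" and x: "x \<in> generic_points"
  shows "ev x g = 0 \<longleftrightarrow> (\<forall>P\<in>C. vanishes_at g P)"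
proof -
  define f where "f = (\<lambda>x. ev (x(1 := 1)) g)"
  have f: "f \<in> coord (n+1)" unfolding f_def by (rule ev_coord[OF g])
  have fS: "f y = ev y g" if "y \<in> Sol (n+1)" for y
  proof -
    have "y(1 := 1) = y" using that by (auto simp: Sol_def)
    then show ?thesis by (simp add: f_def)
  qed
  have n1: "2 \<le> n + 1" using n_ge by simp
  have V: "((\<forall>x\<in>Sol (n+1). range x \<subseteq> range fls_const \<longrightarrow> f x = 0) \<longrightarrow> (\<forall>x\<in>Sol (n+1). f x = 0)) \<and>
    ((\<exists>x\<in>Sol (n+1). nonconst x \<and> f x = 0) \<longrightarrow> (\<forall>x\<in>Sol (n+1). f x = 0))"
    by (rule bspec[OF coord_vanish[OF n1 order_refl] f])
  show ?thesis
  proof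
    assume "ev x g = 0"
    then have "\<exists>x\<in>Sol (n+1). nonconst x \<and> f x = 0" using x fS by (auto simp: generic_points_def)
    then have all: "\<forall>x\<in>Sol (n+1). f x = 0" using V by blast
    show "\<forall>P\<in>C. vanishes_at g P"
    proof
      fix P assume P: "P \<in> C"
      obtain p y where py: "p \<in> P" "y \<in> generic_points" "centered y p" using branch_at_point[OF P] by blast
      obtain s where "fls_nth (s ^ d * ev y g) 0 = mpoly_eval p g" using ev_centered[OF g py(3)] by blast
      moreover have "ev y g = 0" using all py(2) fS by (auto simp: generic_points_def)
      ultimately have "mpoly_eval p g = 0" by simp
      then show "vanishes_at g P" using vanishes_at_rep[OF C_proj[OF P] py(1) g] by simp
    qed
  next
    assume van: "\<forall>P\<in>C. vanishes_at g P"
    have "f y = 0" if y: "y \<in> Sol (n+1)" "range y \<subseteq> range fls_const" for y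
    proof -
      have "\<forall>i. \<exists>c. y i = fls_const c" using y(2) by blast
      then obtain q where q: "\<And>i. y i = fls_const (q i)" by metis
      define p where "p = (\<lambda>i. if i \<in> {1..n+1} then q i else 0)"
      have q1: "q 1 = 1" using y(1) q[of 1] by (auto simp: Sol_def)
      have hv: "p \<in> homog_vectors n" using q1 by (auto simp: homog_vectors_def p_def intro!: exI[of _ 1])
      have eqs: "p j ^ k = - (branch_value j * p 1 ^ k + p 2 ^ k)" if j: "j \<in> {3..n+1}" for j
      proof -
        have "fls_const (q j ^ k) = fls_const (poly (radicand j) (q 2))"
          using y(1) j by (auto simp: Sol_def q fpoly_const fls_const_power)
        then have "q j ^ k = poly (radicand j) (q 2)" by (metis fls_const_nth)
        then show ?thesis using j q1 n_ge by (simp add: p_def poly_radicand)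
      qed
      have P: "proportional n `` {p} \<in> C" "p \<in> proportional n `` {p}" using class_in_C[OF hv eqs] by blast+
      have "mpoly_eval p g = 0" using van P vanishes_at_rep[OF C_proj[OF P(1)] P(2) g] by blast
      then have "ev (\<lambda>i. fls_const (p i)) g = 0" by (simp add: ev_const_point)
      moreover have "ev y g = ev (\<lambda>i. fls_const (p i)) g"
        by (rule ev_local[OF g]) (simp add: q p_def)
      ultimately show ?thesis using fS[OF y(1)] by simp
    qed
    then have "\<forall>x\<in>Sol (n+1). f x = 0" using V by blast
    then show "ev x g = 0" using x fS by (auto simp: generic_points_def)
  qed
qed

lemma generic_nonempty: "\<exists>x. x \<in> generic_points"
  using special_branch[of 3] n_ge by (auto simp: generic_points_def)

section \<open>The function field\<close>

abbreviation "F \<equiv> function_field n C"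
abbreviation "Frac \<equiv> fractions n C"
abbreviation "fr \<equiv> frac n C"

lemma Frac_iff:
  assumes x: "x \<in> generic_points"
  shows "(g, h) \<in> Frac \<longleftrightarrow> (\<exists>d. g \<in> forms n d \<and> h \<in> forms n d) \<and> ev x h \<noteq> 0"
  unfolding fractions_def using vanish_iff[OF _ x] by blast

lemma Frac_nz: "x \<in> generic_points \<Longrightarrow> (g, h) \<in> Frac \<Longrightarrow> ev x h \<noteq> 0"
  using Frac_iff by blast

text \<open>Cross multiplication turns equality of the two expansions into the vanishing of a form along \<open>x\<close>.\<close>

lemma rel_iff:
  assumes x: "x \<in> generic_points"
  shows "((g, h), (g', h')) \<in> fraction_rel n C \<longleftrightarrow>
    (g, h) \<in> Frac \<and> (g', h') \<in> Frac \<and> ev x g / ev x h = ev x g' / ev x h'"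
proof (cases "(g, h) \<in> Frac \<and> (g', h') \<in> Frac")
  case True
  then obtain d e where d: "g \<in> forms n d" "h \<in> forms n d" "g' \<in> forms n e" "h' \<in> forms n e"
    and nz: "ev x h \<noteq> 0" "ev x h' \<noteq> 0" using Frac_iff[OF x] by blast
  have "g' * h \<in> forms n (d + e)" using forms_mult[OF d(3) d(2)] by (simp add: add.commute)
  then have "g * h' - g' * h \<in> forms n (d + e)" by (rule forms_diff[OF forms_mult[OF d(1) d(4)]])
  then have "(\<forall>P\<in>C. vanishes_at (g * h' - g' * h) P) \<longleftrightarrow> ev x (g * h' - g' * h) = 0"
    by (rule vanish_iff[OF _ x, symmetric])
  also have "\<dots> \<longleftrightarrow> ev x g * ev x h' = ev x g' * ev x h" by (simp add: ev_diff ev_mult)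
  also have "\<dots> \<longleftrightarrow> ev x g / ev x h = ev x g' / ev x h'" using nz by (simp add: frac_eq_eq)
  finally show ?thesis using True by (simp add: fraction_rel_def)
qed (auto simp: fraction_rel_def)

lemma frac_iff:
  "x \<in> generic_points \<Longrightarrow> (g', h') \<in> fr g h \<longleftrightarrow> (g, h) \<in> Frac \<and> (g', h') \<in> Frac \<and> ev x g / ev x h = ev x g' / ev x h'"
  unfolding frac_def using rel_iff by simp

lemma frac_self: "(g, h) \<in> Frac \<Longrightarrow> (g, h) \<in> fr g h"
  using frac_iff generic_nonempty by blast

lemma frac_eqI:
  assumes x: "x \<in> generic_points" and "(g, h) \<in> Frac" "(g', h') \<in> Frac" "ev x g / ev x h = ev x g' / ev x h'"
  shows "fr g h = fr g' h'"
proof (rule Set.set_eqI)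
  fix r :: "'a mpoly \<times> 'a mpoly"
  obtain g1 h1 where r: "r = (g1, h1)" by (cases r)
  show "r \<in> fr g h \<longleftrightarrow> r \<in> fr g' h'" unfolding r frac_iff[OF x] using assms(2-4) by simp
qed

lemma carrier_F: "a \<in> carrier F \<longleftrightarrow> (\<exists>g h. (g, h) \<in> Frac \<and> a = fr g h)"
  by (auto simp: function_field_def quotient_def frac_def)

lemma frac_closed [simp]: "(g, h) \<in> Frac \<Longrightarrow> fr g h \<in> carrier F"
  using carrier_F by blast

definition expand :: "(nat \<Rightarrow> 'a fls) \<Rightarrow> 'a ratfun \<Rightarrow> 'a fls" where
  "expand x a = (let (g, h) = (SOME r. r \<in> a) in ev x g / ev x h)"

lemma expand_mem:
  assumes x: "x \<in> generic_points" and a: "a \<in> carrier F" and "(g, h) \<in> a"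
  shows "expand x a = ev x g / ev x h"
proof -
  obtain g0 h0 where a: "a = fr g0 h0" using a carrier_F by blast
  obtain g1 h1 where 1: "(SOME r. r \<in> a) = (g1, h1)" by (metis surj_pair)
  have "(SOME r. r \<in> a) \<in> a" using assms(3) by (rule someI)
  then have "(g1, h1) \<in> a" unfolding 1 .
  then show ?thesis using assms(3) frac_iff[OF x] unfolding a expand_def 1[unfolded a] by auto
qed

lemma expand_frac: "x \<in> generic_points \<Longrightarrow> (g, h) \<in> Frac \<Longrightarrow> expand x (fr g h) = ev x g / ev x h"
  by (intro expand_mem frac_self frac_closed)

lemma expand_inj:
  assumes x: "x \<in> generic_points" shows "inj_on (expand x) (carrier F)"
proof (rule inj_onI)
  fix a b assume ab: "a \<in> carrier F" "b \<in> carrier F" "expand x a = expand x b"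
  obtain g h where gh: "(g, h) \<in> Frac" "a = fr g h" using ab(1) carrier_F by blast
  obtain g' h' where gh': "(g', h') \<in> Frac" "b = fr g' h'" using ab(2) carrier_F by blast
  show "a = b" using frac_eqI[OF x gh(1) gh'(1)] expand_frac[OF x gh(1)] expand_frac[OF x gh'(1)] ab(3) gh(2) gh'(2)
    by simp
qed

lemma Frac_mult: "(g, h) \<in> Frac \<Longrightarrow> (g', h') \<in> Frac \<Longrightarrow> (g * g', h * h') \<in> Frac"
proof -
  obtain x where x: "x \<in> generic_points" using generic_nonempty by blast
  assume "(g, h) \<in> Frac" "(g', h') \<in> Frac"
  then show ?thesis unfolding Frac_iff[OF x] ev_mult using forms_mult by (metis mult_eq_0_iff)
qed

lemma Frac_add: "(g, h) \<in> Frac \<Longrightarrow> (g', h') \<in> Frac \<Longrightarrow> (g * h' + g' * h, h * h') \<in> Frac"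
proof -
  obtain x where x: "x \<in> generic_points" using generic_nonempty by blast
  assume *: "(g, h) \<in> Frac" "(g', h') \<in> Frac"
  then obtain d e where d: "g \<in> forms n d" "h \<in> forms n d" "g' \<in> forms n e" "h' \<in> forms n e"
    and nz: "ev x h \<noteq> 0" "ev x h' \<noteq> 0" using Frac_iff[OF x] by blast
  have "g' * h \<in> forms n (d + e)" using forms_mult[OF d(3) d(2)] by (simp add: add.commute)
  then have "g * h' + g' * h \<in> forms n (d + e)" by (rule forms_add[OF forms_mult[OF d(1) d(4)]])
  then show ?thesis unfolding Frac_iff[OF x] ev_mult using forms_mult[OF d(2) d(4)] nz by auto
qed

lemma Frac_Const: "(Const c, 1) \<in> Frac"
proof -
  obtain x where x: "x \<in> generic_points" using generic_nonempty by blast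
  show ?thesis unfolding Frac_iff[OF x] by (intro conjI exI[of _ 0]) simp_all
qed

lemma mult_frac:
  assumes "(g, h) \<in> Frac" "(g', h') \<in> Frac"
  shows "fr g h \<otimes>\<^bsub>F\<^esub> fr g' h' = fr (g * g') (h * h')"
proof -
  obtain x where x: "x \<in> generic_points" using generic_nonempty by blast
  have quot: "ev x (u * u') / ev x (v * v') = (ev x u / ev x v) * (ev x u' / ev x v')" for u v u' v'
    by (simp add: ev_mult)
  have *: "fr (g1 * g1') (h1 * h1') = fr (g * g') (h * h')" if "(g1, h1) \<in> fr g h" "(g1', h1') \<in> fr g' h'" for g1 h1 g1' h1'
  proof (rule frac_eqI[OF x])
    have 1: "(g1, h1) \<in> Frac" "ev x g / ev x h = ev x g1 / ev x h1"
      "(g1', h1') \<in> Frac" "ev x g' / ev x h' = ev x g1' / ev x h1'"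
      using that frac_iff[OF x] by blast+
    show "(g1 * g1', h1 * h1') \<in> Frac" "(g * g', h * h') \<in> Frac"
      using 1 assms Frac_mult by blast+
    show "ev x (g1 * g1') / ev x (h1 * h1') = ev x (g * g') / ev x (h * h')"
      unfolding quot by (simp only: 1)
  qed
  have "(\<Union>(g1, h1)\<in>fr g h. \<Union>(g1', h1')\<in>fr g' h'. fr (g1 * g1') (h1 * h1')) = fr (g * g') (h * h')"
    by (rule UN_UN_const[OF frac_self[OF assms(1)] frac_self[OF assms(2)] *])
  then show ?thesis by (simp add: function_field_def)
qed

lemma add_frac:
  assumes "(g, h) \<in> Frac" "(g', h') \<in> Frac"
  shows "fr g h \<oplus>\<^bsub>F\<^esub> fr g' h' = fr (g * h' + g' * h) (h * h')"
proof -
  obtain x where x: "x \<in> generic_points" using generic_nonempty by blast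
  have quot: "ev x (u * v' + u' * v) / ev x (v * v') = ev x u / ev x v + ev x u' / ev x v'"
    if "ev x v \<noteq> 0" "ev x v' \<noteq> 0" for u v u' v'
    using that by (simp add: ev_add ev_mult add_frac_eq)
  have *: "fr (g1 * h1' + g1' * h1) (h1 * h1') = fr (g * h' + g' * h) (h * h')"
    if "(g1, h1) \<in> fr g h" "(g1', h1') \<in> fr g' h'" for g1 h1 g1' h1'
  proof (rule frac_eqI[OF x])
    have 1: "(g1, h1) \<in> Frac" "ev x g / ev x h = ev x g1 / ev x h1"
      "(g1', h1') \<in> Frac" "ev x g' / ev x h' = ev x g1' / ev x h1'"
      using that frac_iff[OF x] by blast+
    show "(g1 * h1' + g1' * h1, h1 * h1') \<in> Frac" "(g * h' + g' * h, h * h') \<in> Frac"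
      using 1 assms Frac_add by blast+
    show "ev x (g1 * h1' + g1' * h1) / ev x (h1 * h1') = ev x (g * h' + g' * h) / ev x (h * h')"
      using 1 assms Frac_nz[OF x] by (simp add: quot)
  qed
  have "(\<Union>(g1, h1)\<in>fr g h. \<Union>(g1', h1')\<in>fr g' h'. fr (g1 * h1' + g1' * h1) (h1 * h1'))
      = fr (g * h' + g' * h) (h * h')"
    by (rule UN_UN_const[OF frac_self[OF assms(1)] frac_self[OF assms(2)] *])
  then show ?thesis by (simp add: function_field_def)
qed

lemma one_F: "\<one>\<^bsub>F\<^esub> = const_fun n C 1" and zero_F: "\<zero>\<^bsub>F\<^esub> = const_fun n C 0"
  by (simp_all add: function_field_def const_fun_def Const_def)

lemma const_fun_closed [simp]: "const_fun n C c \<in> carrier F"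
  by (simp add: const_fun_def Frac_Const)

lemma expand_const: "x \<in> generic_points \<Longrightarrow> expand x (const_fun n C c) = fls_const c"
  by (simp add: const_fun_def expand_frac Frac_Const)

lemma expand_mult: "x \<in> generic_points \<Longrightarrow> a \<in> carrier F \<Longrightarrow> b \<in> carrier F \<Longrightarrow>
    a \<otimes>\<^bsub>F\<^esub> b \<in> carrier F \<and> expand x (a \<otimes>\<^bsub>F\<^esub> b) = expand x a * expand x b"
proof -
  assume x: "x \<in> generic_points" and "a \<in> carrier F" "b \<in> carrier F"
  then obtain g h g' h' where 1: "(g, h) \<in> Frac" "a = fr g h" "(g', h') \<in> Frac" "b = fr g' h'"
    unfolding carrier_F by blast
  then show ?thesis
    using mult_frac[OF 1(1,3)] Frac_mult[OF 1(1,3)] x by (simp add: expand_frac ev_mult)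
qed

lemma expand_add: "x \<in> generic_points \<Longrightarrow> a \<in> carrier F \<Longrightarrow> b \<in> carrier F \<Longrightarrow>
    a \<oplus>\<^bsub>F\<^esub> b \<in> carrier F \<and> expand x (a \<oplus>\<^bsub>F\<^esub> b) = expand x a + expand x b"
proof -
  assume x: "x \<in> generic_points" and "a \<in> carrier F" "b \<in> carrier F"
  then obtain g h g' h' where 1: "(g, h) \<in> Frac" "a = fr g h" "(g', h') \<in> Frac" "b = fr g' h'"
    unfolding carrier_F by blast
  then show ?thesis
    using add_frac[OF 1(1,3)] Frac_add[OF 1(1,3)] Frac_nz[OF x] x
    by (simp add: expand_frac ev_add ev_mult add_frac_eq)
qed

lemma field_F: "field F"
proof -
  obtain x where x: "x \<in> generic_points" using generic_nonempty by blast
  show ?thesis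
  proof (rule field_of_inj_hom[where expand = "expand x"])
    show "inj_on (expand x) (carrier F)" by (rule expand_inj[OF x])
    show "\<zero>\<^bsub>F\<^esub> \<in> carrier F \<and> expand x \<zero>\<^bsub>F\<^esub> = 0" "\<one>\<^bsub>F\<^esub> \<in> carrier F \<and> expand x \<one>\<^bsub>F\<^esub> = 1"
      by (simp_all add: zero_F one_F expand_const[OF x])
    fix a b assume "a \<in> carrier F" "b \<in> carrier F"
    then show "a \<oplus>\<^bsub>F\<^esub> b \<in> carrier F \<and> expand x (a \<oplus>\<^bsub>F\<^esub> b) = expand x a + expand x b"
      "a \<otimes>\<^bsub>F\<^esub> b \<in> carrier F \<and> expand x (a \<otimes>\<^bsub>F\<^esub> b) = expand x a * expand x b"
      using expand_add[OF x] expand_mult[OF x] by blast+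
  next
    fix a assume a: "a \<in> carrier F"
    have "expand x (const_fun n C (-1) \<otimes>\<^bsub>F\<^esub> a) = - expand x a"
      using expand_mult[OF x const_fun_closed a] by (simp add: expand_const[OF x])
    then show "\<exists>b\<in>carrier F. expand x b = - expand x a" using expand_mult[OF x const_fun_closed a] by blast
    obtain g h where gh: "(g, h) \<in> Frac" "a = fr g h" using a carrier_F by blast
    assume "expand x a \<noteq> 0"
    then have "ev x g \<noteq> 0" using gh expand_frac[OF x gh(1)] by auto
    then have hg: "(h, g) \<in> Frac" using gh(1) Frac_iff[OF x] by blast
    have "expand x (fr h g) = inverse (expand x a)" using expand_frac[OF x gh(1)] expand_frac[OF x hg] gh(2) by simp
    then show "\<exists>b\<in>carrier F. expand x b = inverse (expand x a)" using frac_closed[OF hg] by blast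
  qed
qed

sublocale F: field F by (rule field_F)

lemma expand_zero: "x \<in> generic_points \<Longrightarrow> expand x \<zero>\<^bsub>F\<^esub> = 0" and expand_one: "x \<in> generic_points \<Longrightarrow> expand x \<one>\<^bsub>F\<^esub> = 1"
  by (simp_all add: zero_F one_F expand_const)

lemma expand_eq_0_iff: "x \<in> generic_points \<Longrightarrow> a \<in> carrier F \<Longrightarrow> expand x a = 0 \<longleftrightarrow> a = \<zero>\<^bsub>F\<^esub>"
  using expand_inj[of x] expand_zero[of x] F.zero_closed by (metis inj_onD)

lemma expand_inv: "x \<in> generic_points \<Longrightarrow> a \<in> carrier F \<Longrightarrow> a \<noteq> \<zero>\<^bsub>F\<^esub> \<Longrightarrow>
    inv\<^bsub>F\<^esub> a \<in> carrier F \<and> expand x (inv\<^bsub>F\<^esub> a) = inverse (expand x a)"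
proof -
  assume x: "x \<in> generic_points" and a: "a \<in> carrier F" "a \<noteq> \<zero>\<^bsub>F\<^esub>"
  then have U: "a \<in> Units F" by (simp add: F.field_Units)
  then have "expand x a * expand x (inv\<^bsub>F\<^esub> a) = 1"
    using expand_mult[OF x a(1), of "inv\<^bsub>F\<^esub> a"] expand_one[OF x] F.Units_r_inv F.Units_inv_closed by metis
  then have "expand x (inv\<^bsub>F\<^esub> a) = inverse (expand x a)" by (metis inverse_unique)
  then show ?thesis using U F.Units_inv_closed by blast
qed

lemma expand_pow: "x \<in> generic_points \<Longrightarrow> a \<in> carrier F \<Longrightarrow> expand x (a [^]\<^bsub>F\<^esub> (m::nat)) = expand x a ^ m"
  by (induction m) (auto simp: expand_one expand_mult)

lemma expand_finprod:
  assumes x: "x \<in> generic_points" and "finite I" "\<And>i. i \<in> I \<Longrightarrow> f i \<in> carrier F"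
  shows "expand x (finprod F f I) = (\<Prod>i\<in>I. expand x (f i))"
  using assms(2,3)
proof (induction I rule: finite_induct)
  case empty
  then show ?case by (simp add: expand_one x)
next
  case (insert i I)
  then have "f \<in> I \<rightarrow> carrier F" "f i \<in> carrier F" by auto
  then show ?case using insert x by (simp add: F.finprod_insert expand_mult F.finprod_closed)
qed

lemma expand_minus: "x \<in> generic_points \<Longrightarrow> a \<in> carrier F \<Longrightarrow> expand x (\<ominus>\<^bsub>F\<^esub> a) = - expand x a"
proof -
  assume x: "x \<in> generic_points" and a: "a \<in> carrier F"
  have "expand x (\<ominus>\<^bsub>F\<^esub> a) + expand x a = 0"
    using expand_add[OF x F.a_inv_closed[OF a] a] expand_zero[OF x] F.l_neg[OF a] by simp
  then show ?thesis by (simp add: eq_neg_iff_add_eq_0)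
qed

end

lemma integral_deriv: "integral f \<Longrightarrow> integral (fls_deriv (f :: 'a::field fls))"
proof (rule fls_subdegree_ge0I)
  fix i :: int assume f: "integral f" and i: "i < 0"
  show "fls_nth (fls_deriv f) i = 0"
  proof (cases "i = -1")
    case False
    then have "i + 1 < fls_subdegree f" using f i by simp
    then show ?thesis by simp
  qed simp
qed

context gen_fermat
begin

lemma generic_1: "x \<in> generic_points \<Longrightarrow> x 1 = 1"
  by (simp add: generic_points_def Sol_def)

lemma generic_eq: "x \<in> generic_points \<Longrightarrow> j \<in> {3..n+1} \<Longrightarrow> x j ^ k = - (fls_const (branch_value j) + x 2 ^ k)"
  by (auto simp: generic_points_def Sol_def fpoly_radicand)

lemma generic_nonzero:
  assumes x: "x \<in> generic_points" and i: "i \<in> {1..n+1}"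
  shows "x i \<noteq> 0"
proof -
  have nc: "nonconst x" using x by (simp add: generic_points_def)
  consider "i = 1" | "i = 2" | "i \<in> {3..n+1}" using i by force
  then show ?thesis
  proof cases
    case 1 then show ?thesis using generic_1[OF x] by simp
  next
    case 2
    have "x 2 \<noteq> fls_const 0" using nc by blast
    then show ?thesis using 2 by simp
  next
    case 3
    have "x i ^ k = fpoly (radicand i) (x 2)" using x 3 by (auto simp: generic_points_def Sol_def)
    then show ?thesis using fpoly_nonconst[of x, OF nc radicand_nonzero] k0 by (auto simp: power_0_left)
  qed
qed

lemma Frac_Var: "i \<in> {1..n+1} \<Longrightarrow> l \<in> {1..n+1} \<Longrightarrow> (Var i, Var l) \<in> Frac"
proof -
  obtain x where x: "x \<in> generic_points" using generic_nonempty by blast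
  assume "i \<in> {1..n+1}" "l \<in> {1..n+1}"
  then show ?thesis unfolding Frac_iff[OF x] using generic_nonzero[OF x] forms_Var[of i n] forms_Var[of l n]
    by (intro conjI exI[of _ 1]) auto
qed

abbreviation "y \<equiv> y_coord n C"

lemma y_closed [simp]: "j \<in> {1..n+1} \<Longrightarrow> y j \<in> carrier F"
  unfolding y_coord_def by (intro frac_closed Frac_Var) auto

lemma expand_y: "x \<in> generic_points \<Longrightarrow> j \<in> {1..n+1} \<Longrightarrow> expand x (y j) = x j"
  unfolding y_coord_def using expand_frac[of x "Var j" "Var 1"] Frac_Var[of j 1] generic_1[of x] by simp

lemma F_eqI: "x \<in> generic_points \<Longrightarrow> a \<in> carrier F \<Longrightarrow> b \<in> carrier F \<Longrightarrow> expand x a = expand x b \<Longrightarrow> a = b"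
  using expand_inj[of x] by (auto dest: inj_onD)

lemma coord_elem:
  assumes Q: "Q \<subseteq> carrier F" "\<And>c. const_fun n C c \<in> Q" "\<And>j. j \<in> {2..n+1} \<Longrightarrow> y j \<in> Q"
    "\<And>a b. a \<in> Q \<Longrightarrow> b \<in> Q \<Longrightarrow> a \<oplus>\<^bsub>F\<^esub> b \<in> Q" "\<And>a b. a \<in> Q \<Longrightarrow> b \<in> Q \<Longrightarrow> a \<otimes>\<^bsub>F\<^esub> b \<in> Q"
    and f: "f \<in> coord (n+1)"
  shows "\<exists>a\<in>Q. \<forall>x\<in>generic_points. expand x a = f x"
  using f
proof (induction rule: coord.induct)
  case (const c)
  then show ?case using Q(2)[of c] expand_const by blast
next
  case (var j)
  then show ?case using Q(3)[of j] expand_y by (intro bexI[of _ "y j"]) auto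
next
  case (add f g)
  then obtain a b where ab: "a \<in> Q" "\<forall>x\<in>generic_points. expand x a = f x" "b \<in> Q" "\<forall>x\<in>generic_points. expand x b = g x" by blast
  have "a \<in> carrier F" "b \<in> carrier F" using ab Q(1) by auto
  then have "\<forall>x\<in>generic_points. expand x (a \<oplus>\<^bsub>F\<^esub> b) = f x + g x" using expand_add ab by simp
  then show ?case using Q(4)[OF ab(1,3)] by blast
next
  case (mult f g)
  then obtain a b where ab: "a \<in> Q" "\<forall>x\<in>generic_points. expand x a = f x" "b \<in> Q" "\<forall>x\<in>generic_points. expand x b = g x" by blast
  have "a \<in> carrier F" "b \<in> carrier F" using ab Q(1) by auto
  then have "\<forall>x\<in>generic_points. expand x (a \<otimes>\<^bsub>F\<^esub> b) = f x * g x" using expand_mult ab by simp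
  then show ?case using Q(5)[OF ab(1,3)] by blast
qed

lemma form_elem:
  assumes Q: "Q \<subseteq> carrier F" "\<And>c. const_fun n C c \<in> Q" "\<And>j. j \<in> {2..n+1} \<Longrightarrow> y j \<in> Q"
    "\<And>a b. a \<in> Q \<Longrightarrow> b \<in> Q \<Longrightarrow> a \<oplus>\<^bsub>F\<^esub> b \<in> Q" "\<And>a b. a \<in> Q \<Longrightarrow> b \<in> Q \<Longrightarrow> a \<otimes>\<^bsub>F\<^esub> b \<in> Q"
    and g: "g \<in> forms n d"
  shows "\<exists>a\<in>Q. \<forall>x\<in>generic_points. expand x a = ev x g"
proof -
  obtain a where a: "a \<in> Q" "\<forall>x\<in>generic_points. expand x a = ev (x(1 := 1)) g"
    using coord_elem[OF Q ev_coord[OF g]] by blast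
  have "x(1 := 1) = x" if "x \<in> generic_points" for x using generic_1[OF that] by auto
  then show ?thesis using a by auto
qed

lemma expand_add_pow: "x \<in> generic_points \<Longrightarrow> a \<in> carrier F \<Longrightarrow> expand x (add_pow F (m::nat) a) = of_nat m * expand x a"
  by (induction m) (auto simp: expand_zero expand_add distrib_right)

section \<open>Differentials on the curve\<close>

lemma kaehler_module_F: "kaehler_module F (range (const_fun n C))"
proof (rule kaehler_module.intro[OF field_F kaehler_module_axioms.intro])
  show "range (const_fun n C) \<subseteq> carrier F" by auto
  show "\<one>\<^bsub>F\<^esub> \<in> range (const_fun n C)" by (simp add: one_F)
qed

sublocale K: kaehler_module F "range (const_fun n C)"
  by (rule kaehler_module_F)

abbreviation "Om \<equiv> mero_forms n C"
abbreviation "dif \<equiv> differential n C"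

lemma mero_eq: "Om = K.\<Omega>" and diff_eq: "dif = K.d"
  by (simp_all add: mero_forms_def differential_def)

lemma module_Om: "Module.module F Om"
  unfolding mero_eq by (rule K.\<Omega>.module_axioms)

sublocale Om: Module.module F Om by (rule module_Om)

lemma dif_closed [simp]: "a \<in> carrier F \<Longrightarrow> dif a \<in> carrier Om"
  by (simp add: mero_eq diff_eq)

text \<open>The elements whose differential is a multiple of \<open>dz\<close> form a field that contains the constants and \<open>z\<close>. It
  contains \<open>y_j\<close> because \<open>y_j^k\<close> is a polynomial in \<open>z\<close> and \<open>k\<close> is invertible, and it is
  everything since forms are polynomials in the coordinates.\<close>

lemma all_multiples: "K.diff_multiples (y 2) = carrier F"
proof
  obtain x where x: "x \<in> generic_points" using generic_nonempty by blast
  let ?S = "K.diff_multiples (y 2)"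
  have z: "y 2 \<in> carrier F" using n_ge by simp
  show S: "?S \<subseteq> carrier F" by (auto simp: K.diff_multiples_def)
  have pow: "a [^]\<^bsub>F\<^esub> (m::nat) \<in> ?S" if "a \<in> ?S" for a m
  proof (induction m)
    case 0
    then show ?case using K.diff_multiples_const[OF z, of "\<one>\<^bsub>F\<^esub>"] by (simp add: one_F)
  next
    case (Suc m)
    then show ?case using K.diff_multiples_mult[OF z Suc that] by simp
  qed
  obtain m where m: "k = Suc m" using k0 by (cases k) auto
  have yS: "y j \<in> ?S" if j: "j \<in> {2..n+1}" for j
  proof (cases "j = 2")
    case True
    then show ?thesis using K.diff_multiples_self[OF z] by simp
  next
    case False
    then have j3: "j \<in> {3..n+1}" using j by auto
    have yj: "y j \<in> carrier F" using j by auto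
    define e where "e = const_fun n C (- branch_value j) \<oplus>\<^bsub>F\<^esub> const_fun n C (-1) \<otimes>\<^bsub>F\<^esub> (y 2 [^]\<^bsub>F\<^esub> k)"
    have eS: "e \<in> ?S" unfolding e_def
      by (intro K.diff_multiples_add[OF z] K.diff_multiples_mult[OF z] K.diff_multiples_const[OF z] pow K.diff_multiples_self[OF z]) auto
    have "expand x e = - (fls_const (branch_value j) + x 2 ^ k)"
    proof -
      have "expand x (y 2) = x 2" using expand_y[OF x, of 2] n_ge by simp
      then show ?thesis using z by (simp add: e_def expand_add[OF x] expand_mult[OF x] expand_const[OF x] expand_pow[OF x])
    qed
    also have "\<dots> = expand x (y j [^]\<^bsub>F\<^esub> k)" using generic_eq[OF x j3] expand_pow[OF x yj] expand_y[OF x] j by simp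
    finally have "y j [^]\<^bsub>F\<^esub> k = e" using F_eqI[OF x, of e] eS S yj by auto
    then have 1: "y j [^]\<^bsub>F\<^esub> Suc m \<in> ?S" using eS m by simp
    have ym: "y j [^]\<^bsub>F\<^esub> m \<in> carrier F" using yj by simp
    have "expand x (add_pow F (Suc m) (y j [^]\<^bsub>F\<^esub> m)) = of_nat (Suc m) * x j ^ m"
      using expand_y[OF x, of j] j unfolding expand_add_pow[OF x ym] expand_pow[OF x yj] by simp
    also have "of_nat (Suc m) = fls_const (of_nat k :: 'a)" by (simp only: m fls_of_nat)
    finally have "expand x (add_pow F (Suc m) (y j [^]\<^bsub>F\<^esub> m)) = fls_const (of_nat k) * x j ^ m" .
    moreover have "x j \<noteq> 0" using generic_nonzero[OF x, of j] j by auto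
    ultimately have "expand x (add_pow F (Suc m) (y j [^]\<^bsub>F\<^esub> m)) \<noteq> 0" using kne by simp
    then have "add_pow F (Suc m) (y j [^]\<^bsub>F\<^esub> m) \<noteq> \<zero>\<^bsub>F\<^esub>" using expand_zero[OF x] by metis
    then show ?thesis by (rule K.diff_multiples_root[OF z yj 1])
  qed
  have cS: "const_fun n C c \<in> ?S" for c using K.diff_multiples_const[OF z] by simp
  have elem: "\<exists>a\<in>?S. \<forall>x\<in>generic_points. expand x a = ev x g" if "g \<in> forms n d" for g d
    by (rule form_elem[OF S _ _ _ _ that]) (blast intro: cS yS K.diff_multiples_add[OF z] K.diff_multiples_mult[OF z])+
  show "carrier F \<subseteq> ?S"
  proof
    fix a assume a: "a \<in> carrier F"
    then obtain g h where gh: "(g, h) \<in> Frac" "a = fr g h" using carrier_F by blast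
    then obtain d where d: "g \<in> forms n d" "h \<in> forms n d" and nz: "ev x h \<noteq> 0" using Frac_iff[OF x] by blast
    obtain b where b: "b \<in> ?S" "expand x b = ev x g" using elem[OF d(1)] x by blast
    obtain c where c: "c \<in> ?S" "expand x c = ev x h" using elem[OF d(2)] x by blast
    have c0: "c \<noteq> \<zero>\<^bsub>F\<^esub>" using c nz expand_zero[OF x] by auto
    have bc: "b \<in> carrier F" "c \<in> carrier F" using b c S by auto
    have ic: "inv\<^bsub>F\<^esub> c \<in> ?S" by (rule K.diff_multiples_inv[OF z c(1) c0])
    have "expand x (b \<otimes>\<^bsub>F\<^esub> inv\<^bsub>F\<^esub> c) = expand x a"
      using expand_mult[OF x bc(1), of "inv\<^bsub>F\<^esub> c"] expand_inv[OF x bc(2) c0] b c expand_frac[OF x gh(1)] gh(2)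
      by (simp add: divide_inverse)
    then have "b \<otimes>\<^bsub>F\<^esub> inv\<^bsub>F\<^esub> c = a"
      using F_eqI[OF x _ a] expand_mult[OF x bc(1), of "inv\<^bsub>F\<^esub> c"] expand_inv[OF x bc(2) c0] by blast
    then show "a \<in> ?S" using K.diff_multiples_mult[OF z b(1) ic] by simp
  qed
qed

lemma Om_multiple: "\<omega> \<in> carrier Om \<Longrightarrow> \<exists>f\<in>carrier F. \<omega> = f \<odot>\<^bsub>Om\<^esub> dif (y 2)"
  unfolding mero_eq diff_eq using K.\<Omega>_eq_multiples[OF _ all_multiples] n_ge by simp

text \<open>The coefficient of \<open>du\<close> in the expansion of a form along \<open>x\<close>, where \<open>u\<close> is the variable of the series.\<close>

definition pullback :: "(nat \<Rightarrow> 'a fls) \<Rightarrow> 'a diff_form \<Rightarrow> 'a fls" where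
  "pullback x = kaehler_realization.realize F (range (const_fun n C)) (expand x) (\<lambda>a. fls_deriv (expand x a))"

lemma realization:
  assumes x: "x \<in> generic_points"
  shows "kaehler_realization F (range (const_fun n C)) (expand x) (\<lambda>a. fls_deriv (expand x a))"
  by (rule kaehler_realization.intro[OF kaehler_module_F kaehler_realization_axioms.intro])
    (use expand_add[OF x] expand_mult[OF x] expand_one[OF x] expand_const[OF x] in auto)

lemma pullback_add: "x \<in> generic_points \<Longrightarrow> \<omega> \<in> carrier Om \<Longrightarrow> \<eta> \<in> carrier Om \<Longrightarrow> pullback x (\<omega> \<oplus>\<^bsub>Om\<^esub> \<eta>) = pullback x \<omega> + pullback x \<eta>"
  unfolding pullback_def mero_eq by (rule kaehler_realization.realize_add[OF realization])

lemma pullback_smult: "x \<in> generic_points \<Longrightarrow> a \<in> carrier F \<Longrightarrow> \<omega> \<in> carrier Om \<Longrightarrow> pullback x (a \<odot>\<^bsub>Om\<^esub> \<omega>) = expand x a * pullback x \<omega>"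
  unfolding pullback_def mero_eq by (rule kaehler_realization.realize_smult[OF realization])

lemma pullback_d: "x \<in> generic_points \<Longrightarrow> a \<in> carrier F \<Longrightarrow> pullback x (dif a) = fls_deriv (expand x a)"
  unfolding pullback_def diff_eq by (rule kaehler_realization.realize_d[OF realization])

lemma pullback_zero: "x \<in> generic_points \<Longrightarrow> pullback x \<zero>\<^bsub>Om\<^esub> = 0"
  unfolding pullback_def mero_eq by (rule kaehler_realization.realize_zero[OF realization])

lemma pullback_inj:
  assumes x: "x \<in> generic_points" and "fls_deriv (x 2) \<noteq> 0"
  shows "inj_on (pullback x) (carrier Om)"
  unfolding pullback_def mero_eq
  by (rule kaehler_realization.realize_inj[OF realization[OF x] _ all_multiples])
    (use expand_inj[OF x] expand_y[OF x, of 2] assms(2) n_ge in auto)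

text \<open>Along a point with \<open>z' = 0\<close>, which exists in positive characteristic (substitute \<open>u^p\<close> for \<open>u\<close>), pulling back
  forms is not injective. A branch over \<open>z = 0\<close>, where the covering by \<open>z\<close> is unramified, has
  \<open>z' = 1\<close>.\<close>

lemma separating_exists: "\<exists>x\<in>generic_points. fls_deriv (x 2) = 1"
proof -
  obtain p where p: "p 1 = 1" "p 2 = 0" "\<forall>j\<in>{3..n+1}. p j ^ k = poly (radicand j) 0"
    using root_point_exists[of 0] by blast
  have "p j \<noteq> 0" if "j \<in> {3..n+1}" for j
  proof
    assume "p j = 0"
    moreover have "p j ^ k = poly (radicand j) 0" using p(3) that by blast
    ultimately have "branch_value j = 0" using k0 by (simp add: poly_radicand power_0_left)
    then show False using \<mu>0[of j] that by simp
  qed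
  then obtain x where "x \<in> Sol (n+1)" "nonconst x" "x 2 = fls_const (p 2) + fls_X"
    using branch_unramified[of p] p by auto
  then show ?thesis by (intro bexI[of _ x]) (auto simp: generic_points_def)
qed

section \<open>Local rings and regular forms\<close>

abbreviation "LR \<equiv> local_ring n C"
abbreviation "FL P \<equiv> F\<lparr>carrier := LR P\<rparr>"

lemma LR_iff: "a \<in> LR P \<longleftrightarrow> (\<exists>g h. (g, h) \<in> Frac \<and> a = fr g h \<and> \<not> vanishes_at h P)"
proof
  obtain x where x: "x \<in> generic_points" using generic_nonempty by blast
  assume "a \<in> LR P"
  then obtain g h where a: "a \<in> carrier F" "(g, h) \<in> a" "\<not> vanishes_at h P" by (auto simp: local_ring_def)
  then obtain g0 h0 where g0: "(g0, h0) \<in> Frac" "a = fr g0 h0" using carrier_F by blast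
  then have 1: "(g, h) \<in> Frac" "ev x g0 / ev x h0 = ev x g / ev x h" using a(2) frac_iff[OF x] by blast+
  then have "a = fr g h" using frac_eqI[OF x g0(1) 1(1)] g0(2) by simp
  then show "\<exists>g h. (g, h) \<in> Frac \<and> a = fr g h \<and> \<not> vanishes_at h P" using 1 a(3) by blast
next
  assume "\<exists>g h. (g, h) \<in> Frac \<and> a = fr g h \<and> \<not> vanishes_at h P"
  then show "a \<in> LR P" using frac_self by (auto simp: local_ring_def)
qed

lemma LR_closed: "a \<in> LR P \<Longrightarrow> a \<in> carrier F"
  by (simp add: local_ring_def)

lemma eval_mult: "mpoly_eval p (g * h) = mpoly_eval p g * (mpoly_eval p h :: 'a)"
proof -
  have "fls_const (mpoly_eval p (g * h)) = fls_const (mpoly_eval p g * mpoly_eval p h)"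
    unfolding fls_const_mult_const[symmetric] ev_const_point[symmetric] by (rule ev_mult)
  then show ?thesis by (metis fls_const_nth)
qed

lemma vanishes_mult:
  assumes P: "P \<in> C" and "(g, h) \<in> Frac" "(g', h') \<in> Frac"
    and nv: "\<not> vanishes_at h P" "\<not> vanishes_at h' P"
  shows "\<not> vanishes_at (h * h') P"
proof -
  obtain x where x: "x \<in> generic_points" using generic_nonempty by blast
  obtain d e where d: "h \<in> forms n d" "h' \<in> forms n e" using assms(2,3) Frac_iff[OF x] by blast
  obtain p where p: "p \<in> P" using point_nonempty[OF C_proj[OF P]] by blast
  note v = vanishes_at_rep[OF C_proj[OF P] p]
  show ?thesis using nv unfolding v[OF d(1)] v[OF d(2)] v[OF forms_mult[OF d]] eval_mult by simp
qed

lemma LR_mult: "P \<in> C \<Longrightarrow> a \<in> LR P \<Longrightarrow> b \<in> LR P \<Longrightarrow> a \<otimes>\<^bsub>F\<^esub> b \<in> LR P"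
  unfolding LR_iff using mult_frac Frac_mult vanishes_mult by metis

lemma LR_add: "P \<in> C \<Longrightarrow> a \<in> LR P \<Longrightarrow> b \<in> LR P \<Longrightarrow> a \<oplus>\<^bsub>F\<^esub> b \<in> LR P"
  unfolding LR_iff using add_frac Frac_add vanishes_mult by metis

lemma LR_const: "P \<in> C \<Longrightarrow> const_fun n C c \<in> LR P"
proof -
  assume P: "P \<in> C"
  obtain p where p: "p \<in> P" using point_nonempty[OF C_proj[OF P]] by blast
  have "fls_const (mpoly_eval p 1) = (1 :: 'a fls)" by (simp add: ev_const_point[symmetric])
  then have "mpoly_eval p 1 = (1 :: 'a)" by simp
  then have "\<not> vanishes_at (1 :: 'a mpoly) P" using vanishes_at_rep[OF C_proj[OF P] p forms_1] by simp
  then show ?thesis unfolding LR_iff const_fun_def using Frac_Const by blast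
qed

lemma LR_zero: "P \<in> C \<Longrightarrow> \<zero>\<^bsub>F\<^esub> \<in> LR P" and LR_one: "P \<in> C \<Longrightarrow> \<one>\<^bsub>F\<^esub> \<in> LR P"
  by (simp_all add: zero_F one_F LR_const)

lemma LR_minus: "P \<in> C \<Longrightarrow> a \<in> LR P \<Longrightarrow> \<ominus>\<^bsub>F\<^esub> a \<in> LR P"
proof -
  assume P: "P \<in> C" and a: "a \<in> LR P"
  obtain x where x: "x \<in> generic_points" using generic_nonempty by blast
  have aF: "a \<in> carrier F" using a by (rule LR_closed)
  have "const_fun n C (-1) \<otimes>\<^bsub>F\<^esub> a = \<ominus>\<^bsub>F\<^esub> a"
    by (rule F_eqI[OF x]) (use aF in \<open>simp_all add: expand_mult[OF x] expand_minus[OF x] expand_const[OF x]\<close>)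
  then show ?thesis using LR_mult[OF P LR_const[OF P] a] by metis
qed

lemma LR_Var:
  assumes P: "P \<in> C" and p: "p \<in> P" "p l \<noteq> 0" and i: "i \<in> {1..n+1}" "l \<in> {1..n+1}"
  shows "fr (Var i) (Var l) \<in> LR P"
proof -
  have "fls_const (mpoly_eval p (Var l)) = fls_const (p l)" by (simp add: ev_const_point[symmetric])
  then have "mpoly_eval p (Var l) = p l" by (metis fls_const_nth)
  then have "\<not> vanishes_at (Var l) P"
    using vanishes_at_rep[OF C_proj[OF P] p(1) forms_Var[of l n]] i p(2) by auto
  then show ?thesis unfolding LR_iff using Frac_Var[OF i] by blast
qed

lemma LR_pow: "P \<in> C \<Longrightarrow> a \<in> LR P \<Longrightarrow> a [^]\<^bsub>F\<^esub> (m::nat) \<in> LR P"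
  by (induction m) (auto simp: LR_one LR_mult)

lemma LR_finprod:
  assumes P: "P \<in> C" and "finite I" "\<And>i. i \<in> I \<Longrightarrow> f i \<in> LR P"
  shows "finprod F f I \<in> LR P"
  using assms(2,3)
proof (induction I rule: finite_induct)
  case empty
  then show ?case by (simp add: LR_one P)
next
  case (insert i I)
  then have "f \<in> I \<rightarrow> carrier F" "f i \<in> carrier F" using LR_closed by auto
  then show ?case using insert by (simp add: F.finprod_insert LR_mult P)
qed

lemma cring_LR: "P \<in> C \<Longrightarrow> cring (FL P)"
proof -
  assume P: "P \<in> C"
  have "abelian_group (FL P)"
  proof (rule abelian_groupI)
    fix a assume a: "a \<in> carrier (FL P)"
    then show "\<exists>b\<in>carrier (FL P). b \<oplus>\<^bsub>FL P\<^esub> a = \<zero>\<^bsub>FL P\<^esub>"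
      using LR_minus[OF P] LR_closed[of a P] by (intro bexI[of _ "\<ominus>\<^bsub>F\<^esub> a"]) (auto simp: F.l_neg)
  qed (use P in \<open>simp_all add: LR_add LR_zero LR_closed F.a_ac\<close>)
  moreover have "comm_monoid (FL P)"
    by (rule comm_monoidI) (use P in \<open>simp_all add: LR_mult LR_one LR_closed F.m_ac\<close>)
  ultimately show ?thesis
    by (rule cringI) (auto simp: LR_closed F.l_distr)
qed

lemma module_LR: "P \<in> C \<Longrightarrow> Module.module (FL P) Om"
proof -
  assume P: "P \<in> C"
  have "abelian_group Om" by (rule Om.M.abelian_group_axioms)
  then show ?thesis
    unfolding Module.module_def Module.module_axioms_def using cring_LR[OF P]
    by (auto simp: LR_closed Om.smult_l_distr Om.smult_r_distr Om.smult_assoc1)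
qed

lemma dif_LR: "dif ` LR P \<subseteq> carrier Om"
  using LR_closed by auto

lemma regular_submodule:
  "P \<in> C \<Longrightarrow> LinearCombinations.submodule (FL P) {\<omega>. regular_at n C \<omega> P} Om"
  unfolding regular_at_def using module.span_is_submodule[OF module_LR dif_LR, of P] by simp

lemma regular_add: "P \<in> C \<Longrightarrow> regular_at n C \<omega> P \<Longrightarrow> regular_at n C \<eta> P \<Longrightarrow> regular_at n C (\<omega> \<oplus>\<^bsub>Om\<^esub> \<eta>) P"
  using submodule.m_closed[OF regular_submodule] by blast

lemma regular_zero: "P \<in> C \<Longrightarrow> regular_at n C \<zero>\<^bsub>Om\<^esub> P"
  using submodule.zero_closed[OF regular_submodule] by blast

lemma regular_smult: "P \<in> C \<Longrightarrow> a \<in> LR P \<Longrightarrow> regular_at n C \<omega> P \<Longrightarrow> regular_at n C (a \<odot>\<^bsub>Om\<^esub> \<omega>) P"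
  using submodule.smult_closed[OF regular_submodule, of P a \<omega>] by simp

lemma regular_fdg: "P \<in> C \<Longrightarrow> f \<in> LR P \<Longrightarrow> g \<in> LR P \<Longrightarrow> regular_at n C (f \<odot>\<^bsub>Om\<^esub> dif g) P"
  by (rule regular_smult, assumption+)
    (use module.in_own_span[OF module_LR dif_LR] in \<open>auto simp: regular_at_def\<close>)

text \<open>Multiplying numerator and denominator by a power of \<open>s\<close> makes both integral, and the constant term of the
  denominator becomes its value at \<open>P\<close>.\<close>

lemma expand_integral:
  assumes P: "P \<in> C" and p: "p \<in> P" and x: "x \<in> generic_points" "centered x p" and a: "a \<in> LR P"
  shows "integral (expand x a)"
proof -
  obtain g h where gh: "(g, h) \<in> Frac" "a = fr g h" "\<not> vanishes_at h P" using a LR_iff by blast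
  then obtain d where d: "g \<in> forms n d" "h \<in> forms n d" using Frac_iff[OF x(1)] by blast
  obtain s where s: "\<And>i. i \<in> {1..n+1} \<Longrightarrow> integral (s * x i) \<and> fls_nth (s * x i) 0 = p i"
    using x(2) unfolding centered_def by blast
  have G: "integral (s ^ d * ev x g)"
    using ev_const_term(1)[OF d(1), of "\<lambda>i. s * x i" p] s by (simp add: ev_scale[OF d(1)])
  have H: "integral (s ^ d * ev x h)" "fls_nth (s ^ d * ev x h) 0 = mpoly_eval p h"
    using ev_const_term[OF d(2), of "\<lambda>i. s * x i" p] s by (simp_all add: ev_scale[OF d(2)])
  have "mpoly_eval p h \<noteq> 0" using gh(3) vanishes_at_rep[OF C_proj[OF P] p d(2)] by simp
  then have h0: "fls_nth (s ^ d * ev x h) 0 \<noteq> 0" using H(2) by simp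
  then have nz: "s ^ d * ev x h \<noteq> 0" by (metis fls_zero_nth)
  have sd: "fls_subdegree (s ^ d * ev x h) = 0" by (rule unit_subdegree[OF H(1) h0])
  define w where "w = s ^ d"
  have "w \<noteq> 0" using nz unfolding w_def by (metis mult_zero_left)
  then have "expand x a = (w * ev x g) / (w * ev x h)"
    using expand_frac[OF x(1) gh(1)] gh(2) by simp
  then have Ta: "expand x a = (s ^ d * ev x g) * inverse (s ^ d * ev x h)" by (simp only: divide_inverse w_def)
  have "integral (inverse (s ^ d * ev x h))" using sd by (simp only: fls_inverse_subdegree)
  then show ?thesis unfolding Ta by (rule integral_mult[OF G])
qed

text \<open>The forms with integral pullback are a module over the local ring, and they contain \<open>dg\<close> for \<open>g\<close> in the local
  ring because differentiation preserves integrality.\<close>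

lemma regular_integral:
  assumes P: "P \<in> C" and p: "p \<in> P" and x: "x \<in> generic_points" "centered x p" and \<omega>: "regular_at n C \<omega> P"
  shows "integral (pullback x \<omega>)"
proof -
  let ?K = "{\<omega> \<in> carrier Om. integral (pullback x \<omega>)}"
  have "LinearCombinations.submodule (FL P) ?K Om"
  proof (rule submodule.intro)
    show "Module.module (FL P) Om" by (rule module_LR[OF P])
    show "\<zero>\<^bsub>Om\<^esub> \<in> ?K" using pullback_zero[OF x(1)] by simp
    fix v w assume "v \<in> ?K" "w \<in> ?K"
    then show "v \<oplus>\<^bsub>Om\<^esub> w \<in> ?K" using pullback_add[OF x(1)] integral_add by auto
  next
    fix c v assume "c \<in> carrier (FL P)" "v \<in> ?K"
    then show "c \<odot>\<^bsub>Om\<^esub> v \<in> ?K"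
      using pullback_smult[OF x(1), of c v] integral_mult[OF expand_integral[OF P p x, of c]] LR_closed[of c P] by auto
  qed auto
  moreover have "dif ` LR P \<subseteq> ?K"
    using pullback_d[OF x(1)] LR_closed expand_integral[OF P p x] by (auto intro!: integral_deriv)
  ultimately show ?thesis
    using module.span_is_subset[OF module_LR[OF P], of "dif ` LR P" ?K] \<omega> unfolding regular_at_def by blast
qed

end

lemma fls_deriv_inverse:
  assumes "f \<noteq> (0 :: 'a::field fls)"
  shows "fls_deriv (inverse f) = - (fls_deriv f * inverse f ^ 2)"
proof -
  have "f * fls_deriv (inverse f) + fls_deriv f * inverse f = fls_deriv (f * inverse f)" by simp
  also have "\<dots> = 0" using assms by simp
  finally have "f * fls_deriv (inverse f) = - (fls_deriv f * inverse f)" by (simp add: eq_neg_iff_add_eq_0)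
  then have "inverse f * (f * fls_deriv (inverse f)) = - (fls_deriv f * inverse f ^ 2)"
    by (simp add: power2_eq_square mult_ac)
  moreover have "inverse f * (f * fls_deriv (inverse f)) = fls_deriv (inverse f)"
    using assms by (simp add: mult.assoc[symmetric])
  ultimately show ?thesis by simp
qed

lemma prod_inverse: "(\<Prod>j\<in>J. inverse (f j)) = inverse (\<Prod>j\<in>J. f j :: 'b::field)"
  by (induction J rule: infinite_finite_induct) auto

context gen_fermat
begin

lemma deriv_relation:
  assumes x: "x \<in> generic_points" and l: "l \<in> {3..n+1}"
  shows "x l ^ (k - 1) * fls_deriv (x l) = - (x 2 ^ (k - 1) * fls_deriv (x 2))"
proof -
  have pw: "fls_deriv (f ^ k) = of_nat k * (f ^ (k - 1) * fls_deriv f)" for f :: "'a fls"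
    by (simp add: fls_deriv_power mult_ac fls_of_nat)
  have "of_nat k * (x l ^ (k - 1) * fls_deriv (x l)) = fls_deriv (x l ^ k)" by (rule pw[symmetric])
  also have "\<dots> = - fls_deriv (x 2 ^ k)" unfolding generic_eq[OF x l] by simp
  also have "\<dots> = of_nat k * - (x 2 ^ (k - 1) * fls_deriv (x 2))" unfolding pw by simp
  finally have "of_nat k * (x l ^ (k - 1) * fls_deriv (x l)) = of_nat k * - (x 2 ^ (k - 1) * fls_deriv (x 2))" .
  moreover have "of_nat k \<noteq> (0 :: 'a fls)" using kne by (simp add: fls_of_nat)
  ultimately show ?thesis by (simp only: mult_cancel_left) simp
qed

lemma generic_prod_nonzero:
  assumes x: "x \<in> generic_points" and J: "J \<subseteq> {1..n+1}"
  shows "(\<Prod>j\<in>J. x j ^ \<alpha> j) \<noteq> 0"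
proof
  assume "(\<Prod>j\<in>J. x j ^ \<alpha> j) = 0"
  moreover have "finite J" using J by (rule finite_subset) simp
  ultimately obtain j where "j \<in> J" "x j ^ \<alpha> j = 0" by auto
  then show False using generic_nonzero[OF x, of j] J by auto
qed

section \<open>The forms theta\<close>

definition theta_coeff :: "(nat \<Rightarrow> 'a fls) \<Rightarrow> int \<times> (nat \<Rightarrow> nat) \<Rightarrow> 'a fls" where
  "theta_coeff x = (\<lambda>(r, \<alpha>). x 2 ^ nat r * inverse (\<Prod>j\<in>{3..n+1}. x j ^ \<alpha> j))"

abbreviation "th \<equiv> theta n C"
abbreviation "Idx \<equiv> theta_index k n"

lemma theta_elem:
  assumes r: "0 \<le> r"
  shows "\<exists>a\<in>carrier F. th (r, \<alpha>) = a \<odot>\<^bsub>Om\<^esub> dif (y 2) \<and> (\<forall>x\<in>generic_points. expand x a = theta_coeff x (r, \<alpha>))"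
proof -
  let ?D = "finprod F (\<lambda>j. y j [^]\<^bsub>F\<^esub> \<alpha> j) {3..n+1}"
  have yj: "y j [^]\<^bsub>F\<^esub> \<alpha> j \<in> carrier F" if "j \<in> {3..n+1}" for j
    using that by (intro F.nat_pow_closed y_closed) auto
  have D: "?D \<in> carrier F" by (rule F.finprod_closed) (use yj in auto)
  have TD: "expand x ?D = (\<Prod>j\<in>{3..n+1}. x j ^ \<alpha> j)" if x: "x \<in> generic_points" for x
  proof -
    have "expand x ?D = (\<Prod>j\<in>{3..n+1}. expand x (y j [^]\<^bsub>F\<^esub> \<alpha> j))" by (rule expand_finprod[OF x]) (use yj in auto)
    also have "\<dots> = (\<Prod>j\<in>{3..n+1}. x j ^ \<alpha> j)"
    proof (rule prod.cong[OF refl])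
      fix j assume "j \<in> {3..n+1}"
      then have j: "j \<in> {1..n+1}" by auto
      show "expand x (y j [^]\<^bsub>F\<^esub> \<alpha> j) = x j ^ \<alpha> j" using expand_pow[OF x y_closed[OF j]] expand_y[OF x j] by simp
    qed
    finally show ?thesis .
  qed
  have D0: "?D \<noteq> \<zero>\<^bsub>F\<^esub>"
  proof -
    obtain x where x: "x \<in> generic_points" using generic_nonempty by blast
    have "(\<Prod>j\<in>{3..n+1}. x j ^ \<alpha> j) \<noteq> 0" by (rule generic_prod_nonzero[OF x]) auto
    then show ?thesis using TD[OF x] expand_zero[OF x] by metis
  qed
  have z: "y 2 \<in> carrier F" "2 \<in> {1..n+1}" using n_ge by auto
  define a where "a = y 2 [^]\<^bsub>F\<^esub> nat r \<otimes>\<^bsub>F\<^esub> inv\<^bsub>F\<^esub> ?D"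
  have iD: "inv\<^bsub>F\<^esub> ?D \<in> carrier F" using generic_nonempty expand_inv[OF _ D D0] by blast
  have "a \<in> carrier F" using z iD by (simp add: a_def)
  moreover have "th (r, \<alpha>) = a \<odot>\<^bsub>Om\<^esub> dif (y 2)"
    using int_pow_int[of F "y 2" "nat r"] r by (simp add: theta_def a_def Let_def)
  moreover have "expand x a = theta_coeff x (r, \<alpha>)" if x: "x \<in> generic_points" for x
    using expand_mult[OF x F.nat_pow_closed[OF z(1)] iD] expand_inv[OF x D D0] TD[OF x] expand_pow[OF x z(1)] expand_y[OF x z(2)]
    by (simp add: a_def theta_coeff_def)
  ultimately show ?thesis by blast
qed

lemma theta_closed: "0 \<le> r \<Longrightarrow> th (r, \<alpha>) \<in> carrier Om"
  using theta_elem[of r \<alpha>] n_ge by auto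

lemma pullback_theta: "x \<in> generic_points \<Longrightarrow> 0 \<le> r \<Longrightarrow> pullback x (th (r, \<alpha>)) = theta_coeff x (r, \<alpha>) * fls_deriv (x 2)"
proof -
  assume x: "x \<in> generic_points" and r: "0 \<le> r"
  obtain a where a: "a \<in> carrier F" "th (r, \<alpha>) = a \<odot>\<^bsub>Om\<^esub> dif (y 2)" "expand x a = theta_coeff x (r, \<alpha>)"
    using theta_elem[OF r, of \<alpha>] x by blast
  have z: "y 2 \<in> carrier F" "2 \<in> {1..n+1}" using n_ge by auto
  show ?thesis using pullback_smult[OF x a(1) dif_closed[OF z(1)]] pullback_d[OF x z(1)] expand_y[OF x z(2)] a by simp
qed

text \<open>Along a separating point a form is determined by its pullback.\<close>

lemma theta_eqI:
  assumes r: "0 \<le> r" and f: "f \<in> carrier F" and g: "g \<in> carrier F"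
    and eq: "\<And>x. x \<in> generic_points \<Longrightarrow> expand x f * fls_deriv (expand x g) = theta_coeff x (r, \<alpha>) * fls_deriv (x 2)"
  shows "th (r, \<alpha>) = f \<odot>\<^bsub>Om\<^esub> dif g"
proof -
  obtain x where x: "x \<in> generic_points" "fls_deriv (x 2) = 1" using separating_exists by blast
  have "pullback x (f \<odot>\<^bsub>Om\<^esub> dif g) = pullback x (th (r, \<alpha>))"
    using pullback_smult[OF x(1) f dif_closed[OF g]] pullback_d[OF x(1) g] pullback_theta[OF x(1) r] eq[OF x(1)] by simp
  moreover have "inj_on (pullback x) (carrier Om)" by (rule pullback_inj[OF x(1)]) (simp add: x(2))
  ultimately show ?thesis using theta_closed[OF r] f g by (metis Om.smult_closed dif_closed inj_onD)
qed

lemma expand_Var_frac: "x \<in> generic_points \<Longrightarrow> i \<in> {1..n+1} \<Longrightarrow> l \<in> {1..n+1} \<Longrightarrow> expand x (fr (Var i) (Var l)) = x i / x l"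
  using expand_frac Frac_Var by simp

lemma ramified_others:
  assumes P: "P \<in> C" and p: "p \<in> P" "p 1 = 1" and l: "l \<in> {3..n+1}" "p l = 0"
  shows "p 2 \<noteq> 0" "j \<in> {3..n+1} \<Longrightarrow> j \<noteq> l \<Longrightarrow> p j \<noteq> 0"
proof -
  have e: "p 2 ^ k = - branch_value l"
    using C_eq[OF P p(1) l(1)] p(2) l(2) k0 by (simp add: power_0_left add_eq_0_iff)
  moreover have "branch_value l \<noteq> 0" using \<mu>0[of l] l by simp
  ultimately show "p 2 \<noteq> 0" using k0 by (auto simp: power_0_left)
  assume j: "j \<in> {3..n+1}" "j \<noteq> l"
  show "p j \<noteq> 0"
  proof
    assume "p j = 0"
    then have "branch_value j = branch_value l"
      using C_eq[OF P p(1) j(1)] p(2) e k0 by (simp add: power_0_left)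
    then show False using \<mu>_inj j l by (auto dest: inj_onD)
  qed
qed

lemma power_split: "f \<noteq> (0::'b::field) \<Longrightarrow> a \<le> m \<Longrightarrow> f ^ (m - a) = f ^ m * inverse (f ^ a)"
  by (simp add: power_diff divide_inverse)

text \<open>At an affine point with all \<open>y_j\<close> nonzero the coefficient of \<open>dz\<close> is regular. If \<open>y_l\<close> vanishes, then
  \<open>z \<noteq> 0\<close>, and \<open>z^(k - 1) dz = - y_l^(k - 1) dy_l\<close> expresses the form by \<open>dy_l\<close> with the nonnegative power
  \<open>y_l^(k - 1 - \<alpha>_l)\<close>. At infinity put \<open>w = 1/z\<close>; then \<open>dz = - z^2 dw\<close>, and the form is
  \<open>- w^(\<Sum>j. \<alpha>_j - r - 2) \<Prod>j. (z / y_j)^\<alpha>_j dw\<close>, whose exponent of \<open>w\<close> is nonnegative by the bound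
  on \<open>r\<close>.\<close>

lemma theta_regular:
  assumes idx: "(r, \<alpha>) \<in> Idx" and P: "P \<in> C"
  shows "regular_at n C (th (r, \<alpha>)) P"
proof -
  have r: "0 \<le> r" and rs: "r \<le> (\<Sum>j=3..n+1. int (\<alpha> j)) - 2" and \<alpha>: "\<And>j. j \<in> {3..n+1} \<Longrightarrow> \<alpha> j \<le> k - 1"
    using idx by (auto simp: theta_index_def PiE_def Pi_def)
  have I: "\<And>j. j \<in> {3..n+1} \<Longrightarrow> j \<in> {1..n+1}" and I12: "1 \<in> {1..n+1}" "2 \<in> {1..n+1}" using n_ge by auto
  show ?thesis using P
  proof (cases rule: point_cases)
    case (affine p)
    have p1: "p 1 \<noteq> 0" using affine(2) by simp
    have yL: "y j \<in> LR P" if "j \<in> {1..n+1}" for j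
      unfolding y_coord_def by (rule LR_Var[OF P affine(1) p1 that I12(1)])
    show ?thesis
    proof (cases "\<exists>l\<in>{3..n+1}. p l = 0")
      case False
      let ?D = "finprod F (\<lambda>j. fr (Var 1) (Var j) [^]\<^bsub>F\<^esub> \<alpha> j) {3..n+1}"
      have u: "fr (Var 1) (Var j) [^]\<^bsub>F\<^esub> \<alpha> j \<in> LR P" if "j \<in> {3..n+1}" for j
        by (intro LR_pow[OF P] LR_Var[OF P affine(1)]) (use False that I I12 in auto)
      have D: "?D \<in> LR P" by (rule LR_finprod[OF P]) (use u in auto)
      let ?f = "y 2 [^]\<^bsub>F\<^esub> nat r \<otimes>\<^bsub>F\<^esub> ?D"
      have f: "?f \<in> LR P" by (intro LR_mult[OF P] LR_pow[OF P] yL D I12)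
      have "th (r, \<alpha>) = ?f \<odot>\<^bsub>Om\<^esub> dif (y 2)"
      proof (rule theta_eqI[OF r LR_closed[OF f] y_closed[OF I12(2)]])
        fix x assume x: "x \<in> generic_points"
        have "expand x ?D = (\<Prod>j\<in>{3..n+1}. expand x (fr (Var 1) (Var j) [^]\<^bsub>F\<^esub> \<alpha> j))"
          by (rule expand_finprod[OF x]) (use u LR_closed in auto)
        also have "\<dots> = (\<Prod>j\<in>{3..n+1}. inverse (x j ^ \<alpha> j))"
          using I Frac_Var[OF I12(1)] generic_1[OF x] expand_Var_frac[OF x I12(1)]
          by (intro prod.cong refl) (simp add: expand_pow[OF x] inverse_eq_divide power_divide)
        also have "\<dots> = inverse (\<Prod>j\<in>{3..n+1}. x j ^ \<alpha> j)" by (rule prod_inverse)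
        finally have "expand x ?f = theta_coeff x (r, \<alpha>)"
          using expand_mult[OF x F.nat_pow_closed[OF y_closed[OF I12(2)]] LR_closed[OF D]]
            expand_pow[OF x y_closed[OF I12(2)]] expand_y[OF x I12(2)] by (simp add: theta_coeff_def)
        then show "expand x ?f * fls_deriv (expand x (y 2)) = theta_coeff x (r, \<alpha>) * fls_deriv (x 2)"
          using expand_y[OF x I12(2)] by simp
      qed
      then show ?thesis using regular_fdg[OF P f yL[OF I12(2)]] by simp
    next
      case True
      then obtain l where l: "l \<in> {3..n+1}" "p l = 0" by blast
      note ne = ramified_others[OF P affine l]
      let ?J = "{3..n+1} - {l}"
      let ?D = "finprod F (\<lambda>j. fr (Var 1) (Var j) [^]\<^bsub>F\<^esub> \<alpha> j) ?J"
      have u: "fr (Var 1) (Var j) [^]\<^bsub>F\<^esub> \<alpha> j \<in> LR P" if "j \<in> ?J" for j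
        by (intro LR_pow[OF P] LR_Var[OF P affine(1)]) (use ne(2) that I I12 in auto)
      have D: "?D \<in> LR P" by (rule LR_finprod[OF P]) (use u in auto)
      have u2: "fr (Var 1) (Var 2) \<in> LR P" by (rule LR_Var[OF P affine(1) ne(1) I12])
      have lI: "l \<in> {1..n+1}" using I[OF l(1)] .
      define f1 where "f1 = y 2 [^]\<^bsub>F\<^esub> nat r"
      define f2 where "f2 = fr (Var 1) (Var 2) [^]\<^bsub>F\<^esub> (k - 1)"
      define f3 where "f3 = y l [^]\<^bsub>F\<^esub> (k - 1 - \<alpha> l)"
      have fL: "f1 \<in> LR P" "f2 \<in> LR P" "f3 \<in> LR P" unfolding f1_def f2_def f3_def
        by (intro LR_pow[OF P] yL u2 I12 lI)+
      define f where "f = const_fun n C (-1) \<otimes>\<^bsub>F\<^esub> (f1 \<otimes>\<^bsub>F\<^esub> (f2 \<otimes>\<^bsub>F\<^esub> (f3 \<otimes>\<^bsub>F\<^esub> ?D)))"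
      have f: "f \<in> LR P" unfolding f_def by (intro LR_mult[OF P] LR_const[OF P] fL D)
      have "th (r, \<alpha>) = f \<odot>\<^bsub>Om\<^esub> dif (y l)"
      proof (rule theta_eqI[OF r LR_closed[OF f] y_closed[OF lI]])
        fix x assume x: "x \<in> generic_points"
        have x2: "x 2 \<noteq> 0" and xl: "x l \<noteq> 0" using generic_nonzero[OF x] I12 lI by auto
        have "expand x ?D = (\<Prod>j\<in>?J. expand x (fr (Var 1) (Var j) [^]\<^bsub>F\<^esub> \<alpha> j))"
          by (rule expand_finprod[OF x]) (use u LR_closed in auto)
        also have "\<dots> = (\<Prod>j\<in>?J. inverse (x j ^ \<alpha> j))"
          using I Frac_Var[OF I12(1)] generic_1[OF x] expand_Var_frac[OF x I12(1)]
          by (intro prod.cong refl) (simp add: expand_pow[OF x] inverse_eq_divide power_divide)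
        finally have TD: "expand x ?D = inverse (\<Prod>j\<in>?J. x j ^ \<alpha> j)" by (simp add: prod_inverse)
        have T1: "expand x f1 = x 2 ^ nat r" using expand_pow[OF x y_closed[OF I12(2)]] expand_y[OF x I12(2)] by (simp add: f1_def)
        have T2: "expand x f2 = inverse (x 2 ^ (k - 1))"
          using expand_pow[OF x frac_closed[OF Frac_Var[OF I12]]] expand_Var_frac[OF x I12] generic_1[OF x]
          by (simp add: f2_def inverse_eq_divide power_divide)
        have T3: "expand x f3 = x l ^ (k - 1) * inverse (x l ^ \<alpha> l)"
          using expand_pow[OF x y_closed[OF lI]] expand_y[OF x lI] power_split[OF xl \<alpha>[OF l(1)]] by (simp add: f3_def)
        have Tf: "expand x f = - (expand x f1 * (expand x f2 * (expand x f3 * expand x ?D)))"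
          unfolding f_def using fL D LR_closed by (simp add: expand_mult[OF x] expand_const[OF x])
        have split: "(\<Prod>j\<in>{3..n+1}. x j ^ \<alpha> j) = x l ^ \<alpha> l * (\<Prod>j\<in>?J. x j ^ \<alpha> j)"
          using l(1) by (intro prod.remove) auto
        have "expand x f * fls_deriv (expand x (y l)) = - (x 2 ^ nat r * inverse (x 2 ^ (k - 1)) * inverse (x l ^ \<alpha> l)
            * inverse (\<Prod>j\<in>?J. x j ^ \<alpha> j) * (x l ^ (k - 1) * fls_deriv (x l)))"
          unfolding Tf T1 T2 T3 TD expand_y[OF x lI] by (simp only: mult_ac mult_minus_left mult_minus_right)
        also have "\<dots> = x 2 ^ nat r * (inverse (x 2 ^ (k - 1)) * x 2 ^ (k - 1)) * inverse (x l ^ \<alpha> l)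
            * inverse (\<Prod>j\<in>?J. x j ^ \<alpha> j) * fls_deriv (x 2)"
          unfolding deriv_relation[OF x l(1)] by (simp only: mult_ac mult_minus_left mult_minus_right minus_minus)
        also have "\<dots> = theta_coeff x (r, \<alpha>) * fls_deriv (x 2)"
          unfolding theta_coeff_def prod.case split using x2 by (simp add: inverse_mult_distrib mult_ac)
        finally show "expand x f * fls_deriv (expand x (y l)) = theta_coeff x (r, \<alpha>) * fls_deriv (x 2)" .
      qed
      then show ?thesis using regular_fdg[OF P f yL[OF lI]] by simp
    qed
  next
    case (infinite p)
    have pj: "p j \<noteq> 0" if "j \<in> {3..n+1}" for j
      using C_eq[OF P infinite(1) that] infinite(2,3) k0 by (auto simp: power_0_left)
    let ?D = "finprod F (\<lambda>j. fr (Var 2) (Var j) [^]\<^bsub>F\<^esub> \<alpha> j) {3..n+1}"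
    have u: "fr (Var 2) (Var j) [^]\<^bsub>F\<^esub> \<alpha> j \<in> LR P" if "j \<in> {3..n+1}" for j
      by (intro LR_pow[OF P] LR_Var[OF P infinite(1)]) (use pj that I I12 in auto)
    have D: "?D \<in> LR P" by (rule LR_finprod[OF P]) (use u in auto)
    define w where "w = fr (Var 1) (Var 2)"
    have w: "w \<in> LR P" unfolding w_def by (rule LR_Var[OF P infinite(1,3) I12])
    define s where "s = (\<Sum>j\<in>{3..n+1}. \<alpha> j)"
    have rs': "nat r + 2 \<le> s"
    proof -
      have "int s = (\<Sum>j=3..n+1. int (\<alpha> j))" by (simp only: s_def of_nat_sum)
      moreover have "int (nat r) = r" using r by simp
      ultimately have "int (nat r) + 2 \<le> int s" using rs by linarith
      then show ?thesis by linarith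
    qed
    define f where "f = const_fun n C (-1) \<otimes>\<^bsub>F\<^esub> (w [^]\<^bsub>F\<^esub> (s - (nat r + 2)) \<otimes>\<^bsub>F\<^esub> ?D)"
    have f: "f \<in> LR P" unfolding f_def by (intro LR_mult[OF P] LR_const[OF P] LR_pow[OF P] w D)
    have "th (r, \<alpha>) = f \<odot>\<^bsub>Om\<^esub> dif w"
    proof (rule theta_eqI[OF r LR_closed[OF f] LR_closed[OF w]])
      fix x assume x: "x \<in> generic_points"
      have x2: "x 2 \<noteq> 0" using generic_nonzero[OF x] I12 by auto
      have Tw: "expand x w = inverse (x 2)" using expand_Var_frac[OF x I12] generic_1[OF x] by (simp add: w_def inverse_eq_divide)
      have "expand x ?D = (\<Prod>j\<in>{3..n+1}. expand x (fr (Var 2) (Var j) [^]\<^bsub>F\<^esub> \<alpha> j))"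
        by (rule expand_finprod[OF x]) (use u LR_closed in auto)
      also have "\<dots> = (\<Prod>j\<in>{3..n+1}. x 2 ^ \<alpha> j * inverse (x j ^ \<alpha> j))"
        using I Frac_Var[OF I12(2)] expand_Var_frac[OF x I12(2)]
        by (intro prod.cong refl) (simp add: expand_pow[OF x] inverse_eq_divide power_divide)
      finally have TD: "expand x ?D = x 2 ^ s * inverse (\<Prod>j\<in>{3..n+1}. x j ^ \<alpha> j)"
        by (simp only: prod.distrib prod_inverse power_sum s_def)
      have Tf: "expand x f = - (inverse (x 2) ^ (s - (nat r + 2)) * expand x ?D)"
        unfolding f_def using D w LR_closed by (simp add: expand_mult[OF x] expand_const[OF x] expand_pow[OF x] Tw)
      have e: "inverse (x 2) ^ (s - (nat r + 2)) * x 2 ^ s = x 2 ^ nat r * x 2 ^ 2"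
      proof -
        have "x 2 ^ s = x 2 ^ (s - (nat r + 2) + (nat r + 2))" using rs' by (simp only: le_add_diff_inverse2)
        also have "\<dots> = x 2 ^ (s - (nat r + 2)) * x 2 ^ (nat r + 2)" by (rule power_add)
        finally have xs: "x 2 ^ s = x 2 ^ (s - (nat r + 2)) * x 2 ^ (nat r + 2)" .
        have "inverse (x 2) ^ (s - (nat r + 2)) * x 2 ^ s
            = (inverse (x 2) * x 2) ^ (s - (nat r + 2)) * x 2 ^ (nat r + 2)"
          unfolding xs power_mult_distrib by (simp only: mult.assoc)
        also have "\<dots> = x 2 ^ nat r * x 2 ^ 2"
          by (simp only: left_inverse[OF x2] power_one mult_1_left power_add)
        finally show ?thesis .
      qed
      have "expand x f * fls_deriv (expand x w) = (inverse (x 2) ^ (s - (nat r + 2)) * x 2 ^ s)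
          * inverse (\<Prod>j\<in>{3..n+1}. x j ^ \<alpha> j) * (fls_deriv (x 2) * inverse (x 2) ^ 2)"
        unfolding Tf TD Tw fls_deriv_inverse[OF x2] by (simp only: mult_ac mult_minus_left mult_minus_right minus_minus)
      also have "\<dots> = x 2 ^ nat r * (x 2 ^ 2 * inverse (x 2) ^ 2) * inverse (\<Prod>j\<in>{3..n+1}. x j ^ \<alpha> j) * fls_deriv (x 2)"
        unfolding e by (simp only: mult_ac)
      also have "\<dots> = theta_coeff x (r, \<alpha>) * fls_deriv (x 2)"
        using x2 by (simp add: theta_coeff_def power_inverse)
      finally show "expand x f * fls_deriv (expand x w) = theta_coeff x (r, \<alpha>) * fls_deriv (x 2)" .
    qed
    then show ?thesis using regular_fdg[OF P f w] by simp
  qed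
qed

section \<open>Linear independence\<close>

lemma twist_generic: "x \<in> generic_points \<Longrightarrow> 3 \<le> l \<Longrightarrow> \<zeta> ^ k = 1 \<Longrightarrow> twist l \<zeta> x \<in> generic_points"
  using twist_Sol[of l \<zeta> x "n+1"] by (auto simp: generic_points_def twist_def)

lemma prod_twist:
  assumes l: "l \<in> J" and "finite J"
  shows "(\<Prod>j\<in>J. twist l \<zeta> x j ^ \<alpha> j) = fls_const (\<zeta> ^ \<alpha> l) * (\<Prod>j\<in>J. x j ^ \<alpha> j)"
proof -
  have "(\<Prod>j\<in>J. twist l \<zeta> x j ^ \<alpha> j) = twist l \<zeta> x l ^ \<alpha> l * (\<Prod>j\<in>J-{l}. twist l \<zeta> x j ^ \<alpha> j)"
    using assms by (intro prod.remove)
  also have "(\<Prod>j\<in>J-{l}. twist l \<zeta> x j ^ \<alpha> j) = (\<Prod>j\<in>J-{l}. x j ^ \<alpha> j)"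
    by (intro prod.cong refl) (auto simp: twist_def)
  also have "twist l \<zeta> x l ^ \<alpha> l = fls_const (\<zeta> ^ \<alpha> l) * x l ^ \<alpha> l"
    by (simp add: twist_def power_mult_distrib fls_const_power)
  finally show ?thesis using prod.remove[OF assms(2,1), of "\<lambda>j. x j ^ \<alpha> j"] by (simp add: mult.assoc)
qed

lemma unity_inverse_power:
  assumes "\<zeta> ^ k = (1::'a)" "a \<le> k" shows "inverse (\<zeta> ^ a) = \<zeta> ^ (k - a)"
proof -
  have "\<zeta> ^ a * \<zeta> ^ (k - a) = 1" using assms by (simp add: power_add[symmetric])
  then show ?thesis by (metis inverse_unique)
qed

lemma theta_coeff_twist:
  assumes l: "l \<in> {3..n+1}" and \<zeta>: "\<zeta> ^ k = 1" and a: "\<alpha> l \<le> k"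
  shows "theta_coeff (twist l \<zeta> x) (r, \<alpha>) = fls_const (\<zeta> ^ (k - \<alpha> l)) * theta_coeff x (r, \<alpha>)"
proof -
  have "twist l \<zeta> x 2 = x 2" using l by (auto simp: twist_def)
  moreover have "inverse (fls_const (\<zeta> ^ \<alpha> l)) = fls_const (\<zeta> ^ (k - \<alpha> l))"
    using unity_inverse_power[OF \<zeta> a] by (simp add: fls_inverse_const)
  ultimately show ?thesis
    unfolding theta_coeff_def prod.case prod_twist[OF l finite_atLeastAtMost] by (simp add: inverse_mult_distrib mult_ac)
qed

text \<open>A linear relation between coefficients is the vanishing of an element of the function field. It
  therefore holds at all generic points if it holds at one.\<close>

lemma theta_coeff_sum_elem:
  assumes "finite I" "I \<subseteq> Idx"
  shows "\<exists>a\<in>carrier F. \<forall>x\<in>generic_points. expand x a = (\<Sum>i\<in>I. fls_const (c i) * theta_coeff x i)"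
  using assms
proof (induction I rule: finite_induct)
  case empty
  show ?case by (rule bexI[of _ "\<zero>\<^bsub>F\<^esub>"]) (auto simp: expand_zero)
next
  case (insert i I)
  obtain a where a: "a \<in> carrier F" "\<forall>x\<in>generic_points. expand x a = (\<Sum>i\<in>I. fls_const (c i) * theta_coeff x i)"
    using insert by auto
  obtain r \<alpha> where i: "i = (r, \<alpha>)" by (cases i)
  have "0 \<le> r" using insert.prems i by (auto simp: theta_index_def)
  then obtain b where b: "b \<in> carrier F" "\<forall>x\<in>generic_points. expand x b = theta_coeff x i" using theta_elem[of r \<alpha>] i by blast
  let ?e = "const_fun n C (c i) \<otimes>\<^bsub>F\<^esub> b \<oplus>\<^bsub>F\<^esub> a"
  show ?case
  proof (rule bexI[of _ ?e])
    show "?e \<in> carrier F" using a b by simp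
    show "\<forall>x\<in>generic_points. expand x ?e = (\<Sum>i\<in>insert i I. fls_const (c i) * theta_coeff x i)"
      using insert.hyps a b by (simp add: expand_add expand_mult expand_const)
  qed
qed

text \<open>The relation holds at all generic points, in particular at the twists of a given one. Averaging over the
  twists of one coordinate after the other leaves only the terms with the same exponents \<open>\<beta>\<close> as \<open>i0\<close>.
  Up to a common factor these form a polynomial in \<open>z\<close>, which is not constant along the point.\<close>

lemma theta_coeff_independent:
  assumes fin: "finite I" and I: "I \<subseteq> Idx" and x0: "x0 \<in> generic_points"
    and zero: "(\<Sum>i\<in>I. fls_const (c i) * theta_coeff x0 i) = 0" and i0: "i0 \<in> I"
  shows "c i0 = 0"
proof -
  obtain r0 \<beta> where i0_eq: "i0 = (r0, \<beta>)" by (cases i0)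
  have \<alpha>_bound: "snd i j < k" if "i \<in> Idx" "j \<in> {3..n+1}" for i j
    using that k0 by (force simp: theta_index_def PiE_def Pi_def)
  have \<beta>: "\<beta> j < k" if "j \<in> {3..n+1}" for j using \<alpha>_bound[of i0 j] that I i0 i0_eq by auto
  have all0: "(\<Sum>i\<in>I. fls_const (c i) * theta_coeff x i) = 0" if x: "x \<in> generic_points" for x
  proof -
    obtain a where a: "a \<in> carrier F" "\<forall>x\<in>generic_points. expand x a = (\<Sum>i\<in>I. fls_const (c i) * theta_coeff x i)"
      using theta_coeff_sum_elem[OF fin I, of c] by blast
    then have "expand x0 a = 0" using zero x0 by simp
    then have "a = \<zero>\<^bsub>F\<^esub>" using expand_eq_0_iff[OF x0 a(1)] by simp
    then have "expand x a = 0" using expand_zero[OF x] by simp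
    then show ?thesis using a(2) x by simp
  qed
  \<comment> \<open>The terms that survive averaging over the twists of the coordinates in \<open>J\<close>.\<close>
  define IJ where "IJ = (\<lambda>J. {i\<in>I. \<forall>j\<in>J. snd i j = \<beta> j})"
  have sep: "\<forall>x\<in>generic_points. (\<Sum>i\<in>IJ J. fls_const (c i) * theta_coeff x i) = 0" if "finite J" "J \<subseteq> {3..n+1}" for J
    using that
  proof (induction J rule: finite_induct)
    case empty
    then show ?case using all0 by (simp add: IJ_def)
  next
    case (insert l J)
    have l: "l \<in> {3..n+1}" and J: "J \<subseteq> {3..n+1}" using insert.prems by auto
    have finJ: "finite (IJ J)" using fin by (simp add: IJ_def)
    have IJ_split: "IJ (insert l J) = {i\<in>IJ J. snd i l = \<beta> l}" by (auto simp: IJ_def)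
    show ?case
    proof
      fix x assume x: "x \<in> generic_points"
      have "0 = (\<Sum>\<zeta>\<in>unity_roots k. fls_const (\<zeta> ^ \<beta> l) * (\<Sum>i\<in>IJ J. fls_const (c i) * theta_coeff (twist l \<zeta> x) i))"
        using insert.IH[OF J] twist_generic[OF x] l by (intro sum.neutral[symmetric]) auto
      also have "\<dots> = (\<Sum>\<zeta>\<in>unity_roots k. \<Sum>i\<in>IJ J. fls_const (c i) * theta_coeff x i * fls_const (\<zeta> ^ (\<beta> l + (k - snd i l))))"
      proof (rule sum.cong[OF refl])
        fix \<zeta> :: 'a assume "\<zeta> \<in> unity_roots k"
        then have \<zeta>: "\<zeta> ^ k = 1" by simp
        have "theta_coeff (twist l \<zeta> x) i = fls_const (\<zeta> ^ (k - snd i l)) * theta_coeff x i" if "i \<in> IJ J" for i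
        proof -
          have "snd i l \<le> k" using \<alpha>_bound[of i l] that I l by (auto simp: IJ_def)
          then show ?thesis using theta_coeff_twist[OF l \<zeta>, of "snd i" x "fst i"] by simp
        qed
        then show "fls_const (\<zeta> ^ \<beta> l) * (\<Sum>i\<in>IJ J. fls_const (c i) * theta_coeff (twist l \<zeta> x) i)
            = (\<Sum>i\<in>IJ J. fls_const (c i) * theta_coeff x i * fls_const (\<zeta> ^ (\<beta> l + (k - snd i l))))"
          unfolding sum_distrib_left
          by (intro sum.cong refl) (simp add: power_add mult_ac flip: fls_const_mult_const)
      qed
      also have "\<dots> = (\<Sum>i\<in>IJ J. \<Sum>\<zeta>\<in>unity_roots k. fls_const (c i) * theta_coeff x i * fls_const (\<zeta> ^ (\<beta> l + (k - snd i l))))"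
        by (rule sum.swap)
      also have "\<dots> = (\<Sum>i\<in>IJ J. fls_const (c i) * theta_coeff x i * fls_const (\<Sum>\<zeta>\<in>unity_roots k. \<zeta> ^ (\<beta> l + (k - snd i l))))"
        by (simp add: sum_distrib_left fls_const_sum)
      also have "\<dots> = (\<Sum>i\<in>IJ J. if snd i l = \<beta> l then fls_const (of_nat k) * (fls_const (c i) * theta_coeff x i) else 0)"
      proof (rule sum.cong[OF refl])
        fix i assume i: "i \<in> IJ J"
        have b: "snd i l < k" "\<beta> l < k" using \<alpha>_bound[of i l] i I l \<beta>[OF l] by (auto simp: IJ_def)
        have "k dvd \<beta> l + (k - snd i l) \<longleftrightarrow> snd i l = \<beta> l"
        proof
          assume "k dvd \<beta> l + (k - snd i l)"
          then obtain q where q: "\<beta> l + (k - snd i l) = k * q" by blast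
          have "0 < k * q" "k * q < k * 2" using q b by linarith+
          then have "q = 1" by simp
          then show "snd i l = \<beta> l" using q b by simp
        qed (use b in simp)
        then show "fls_const (c i) * theta_coeff x i * fls_const (\<Sum>\<zeta>\<in>unity_roots k. \<zeta> ^ (\<beta> l + (k - snd i l)))
            = (if snd i l = \<beta> l then fls_const (of_nat k) * (fls_const (c i) * theta_coeff x i) else 0)"
          by (simp add: sum_unity_roots[OF k0 kne] mult_ac)
      qed
      also have "\<dots> = fls_const (of_nat k) * (\<Sum>i\<in>IJ (insert l J). fls_const (c i) * theta_coeff x i)"
        unfolding IJ_split sum.inter_filter[OF finJ, symmetric] sum_distrib_left by simp
      finally show "(\<Sum>i\<in>IJ (insert l J). fls_const (c i) * theta_coeff x i) = 0" using kne by simp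
    qed
  qed
  let ?I = "IJ {3..n+1}"
  have finI: "finite ?I" using fin by (simp add: IJ_def)
  have snd_eq: "snd i = \<beta>" if "i \<in> ?I" for i
  proof
    fix j
    have "snd i \<in> extensional {3..n+1}" "\<beta> \<in> extensional {3..n+1}"
      using that I i0 i0_eq by (auto simp: IJ_def theta_index_def PiE_def)
    then show "snd i j = \<beta> j" using that by (cases "j \<in> {3..n+1}") (auto simp: IJ_def extensional_def)
  qed
  define q where "q = (\<Sum>i\<in>?I. monom (c i) (nat (fst i)))"
  have "fpoly q (x0 2) = (\<Sum>i\<in>?I. fls_const (c i) * x0 2 ^ nat (fst i))"
  proof -
    have fm: "fpoly (monom a e) t = fls_const a * t ^ e" for a e and t :: "'a fls"
      using fpoly_power[of "[:0,1:]" e t] by (simp add: monom_altdef fpoly_smult)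
    have fs: "fpoly (\<Sum>i\<in>A. g i) t = (\<Sum>i\<in>A. fpoly (g i) t)" for A g and t :: "'a fls"
      by (induction A rule: infinite_finite_induct) (auto simp: fpoly_add)
    show ?thesis unfolding q_def fs fm ..
  qed
  then have "fpoly q (x0 2) * inverse (\<Prod>j\<in>{3..n+1}. x0 j ^ \<beta> j)
      = (\<Sum>i\<in>?I. fls_const (c i) * x0 2 ^ nat (fst i) * inverse (\<Prod>j\<in>{3..n+1}. x0 j ^ \<beta> j))"
    by (simp only: sum_distrib_right)
  also have "\<dots> = (\<Sum>i\<in>?I. fls_const (c i) * theta_coeff x0 i)"
    by (intro sum.cong refl) (simp add: snd_eq theta_coeff_def case_prod_beta mult_ac del: prod.cl_ivl_Suc)
  also have "\<dots> = 0" using sep[of "{3..n+1}"] x0 by simp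
  finally have "fpoly q (x0 2) = 0" using generic_prod_nonzero[OF x0, of "{3..n+1}" \<beta>]
    by (metis atLeastatMost_subset_iff inverse_zero_imp_zero mult_eq_0_iff one_le_numeral order_refl)
  then have "q = 0" using fpoly_nonconst[of x0 q] x0 by (auto simp: generic_points_def)
  then have "0 = coeff q (nat r0)" by simp
  also have "\<dots> = (\<Sum>i\<in>?I. if i = i0 then c i0 else 0)"
    unfolding q_def coeff_sum
  proof (rule sum.cong[OF refl])
    fix i assume i: "i \<in> ?I"
    have "0 \<le> fst i" "0 \<le> r0" using i I i0 i0_eq by (auto simp: IJ_def theta_index_def)
    then have "nat (fst i) = nat r0 \<longleftrightarrow> i = i0" using snd_eq[OF i] i0_eq by (cases i) auto
    then show "coeff (monom (c i) (nat (fst i))) (nat r0) = (if i = i0 then c i0 else 0)" by simp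
  qed
  also have "\<dots> = c i0" using i0 i0_eq finI by (simp add: sum.delta IJ_def)
  finally show ?thesis by simp
qed

end

lemma subdegree_prod:
  fixes f :: "'b \<Rightarrow> 'c::field fls"
  assumes "\<And>i. i \<in> I \<Longrightarrow> f i \<noteq> 0"
  shows "fls_subdegree (\<Prod>i\<in>I. f i) = (\<Sum>i\<in>I. fls_subdegree (f i))"
  using assms by (induction I rule: infinite_finite_induct) (auto simp: prod_zero_iff)

context gen_fermat
begin

section \<open>Regular forms are combinations of the theta\<close>

text \<open>The generic points along which regular forms are known to have integral pullbacks.\<close>

definition branches :: "(nat \<Rightarrow> 'a fls) set" where
  "branches = {x \<in> generic_points. \<exists>P\<in>C. \<exists>p\<in>P. centered x p}"

lemma branches_generic: "x \<in> branches \<Longrightarrow> x \<in> generic_points"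
  by (simp add: branches_def)

lemma branchesI:
  assumes "x \<in> Sol (n+1)" "nonconst x" "centered x p" and pn: "\<exists>i\<in>{1..n+1}. p i \<noteq> 0"
    and eq: "\<And>j. j \<in> {3..n+1} \<Longrightarrow> p j ^ k = - (branch_value j * p 1 ^ k + p 2 ^ k)"
  shows "x \<in> branches"
proof -
  define q where "q = (\<lambda>i. if i \<in> {1..n+1} then p i else 0)"
  have q: "q i = p i" if "i \<in> {1..n+1}" for i using that by (simp add: q_def)
  obtain i where i: "i \<in> {1..n+1}" "p i \<noteq> 0" using pn by blast
  then have "q i \<noteq> 0" using q by simp
  moreover have "\<forall>i. i \<notin> {1..n+1} \<longrightarrow> q i = 0" by (simp add: q_def)
  ultimately have hv: "q \<in> homog_vectors n" unfolding homog_vectors_def by blast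
  have qe: "q j ^ k = - (branch_value j * q 1 ^ k + q 2 ^ k)" if "j \<in> {3..n+1}" for j
    using eq[OF that] q[of j] q[of 1] q[of 2] that n_ge by simp
  note c = class_in_C[OF hv qe]
  have "centered x q" using assms(3) q unfolding centered_def by simp
  then show ?thesis using assms(1,2) c unfolding branches_def generic_points_def by blast
qed

lemma branches_affine:
  assumes "x \<in> Sol (n+1)" "nonconst x" "centered x p" "p 1 = 1"
    and "\<And>j. j \<in> {3..n+1} \<Longrightarrow> p j ^ k = poly (radicand j) (p 2)"
  shows "x \<in> branches"
  using assms by (intro branchesI[of x p]) (auto simp: poly_radicand intro!: bexI[of _ 1])

text \<open>A root of unity is a constant, so the twisted point is centered at the twisted centre.\<close>

lemma branches_twist:
  assumes x: "x \<in> branches" and l: "3 \<le> l" and \<zeta>: "\<zeta> ^ k = 1"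
  shows "twist l \<zeta> x \<in> branches"
proof -
  obtain P p where P: "P \<in> C" "p \<in> P" "centered x p" using x unfolding branches_def by blast
  have \<zeta>0: "\<zeta> \<noteq> 0" using \<zeta> k0 by (auto simp: power_0_left)
  have xN: "twist l \<zeta> x \<in> generic_points" using twist_generic[OF branches_generic[OF x] l \<zeta>] .
  obtain i where i: "p i \<noteq> 0" "i \<in> {1..n+1}"
    using point_rep(1)[OF C_proj[OF P(1)] P(2)] unfolding homog_vectors_def by blast
  define q where "q = p(l := \<zeta> * p l)"
  have "centered (twist l \<zeta> x) q"
  proof -
    obtain s where s: "\<And>i. i \<in> {1..n+1} \<Longrightarrow> integral (s * x i) \<and> fls_nth (s * x i) 0 = p i"
      using P(3) unfolding centered_def by blast
    have "integral (s * twist l \<zeta> x i) \<and> fls_nth (s * twist l \<zeta> x i) 0 = q i" if i: "i \<in> {1..n+1}" for i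
    proof (cases "i = l")
      case True
      have e: "s * twist l \<zeta> x i = fls_const \<zeta> * (s * x l)" using True by (simp add: twist_def mult_ac)
      show ?thesis unfolding e using s[OF i] True
        by (auto simp: q_def const_term_mult intro!: integral_mult)
    next
      case False
      then show ?thesis using s[OF i] by (simp add: twist_def q_def)
    qed
    then show ?thesis unfolding centered_def by blast
  qed
  moreover have "q i \<noteq> 0" using i \<zeta>0 by (cases "i = l") (simp_all add: q_def)
  moreover have "q j ^ k = - (branch_value j * q 1 ^ k + q 2 ^ k)" if "j \<in> {3..n+1}" for j
    using C_eq[OF P(1,2) that] l \<zeta> by (cases "j = l") (simp_all add: q_def power_mult_distrib)
  ultimately show ?thesis using xN i(2) by (intro branchesI[of _ q]) (auto simp: generic_points_def)
qed

definition Reg :: "((nat \<Rightarrow> 'a fls) \<Rightarrow> 'a fls) \<Rightarrow> bool" where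
  "Reg \<psi> \<longleftrightarrow> (\<forall>x\<in>branches. integral (\<psi> x * fls_deriv (x 2)))"

definition den :: "nat \<Rightarrow> (nat \<Rightarrow> nat) \<Rightarrow> (nat \<Rightarrow> 'a fls) \<Rightarrow> 'a fls" where
  "den m \<alpha> x = inverse (\<Prod>j\<in>{Suc m..n+1}. x j ^ \<alpha> j)"

lemma subdegree_den: "x \<in> generic_points \<Longrightarrow> m \<ge> 2 \<Longrightarrow>
  fls_subdegree (den m \<alpha> x) = - (\<Sum>j\<in>{Suc m..n+1}. int (\<alpha> j) * fls_subdegree (x j)) \<and> den m \<alpha> x \<noteq> 0"
proof -
  assume x: "x \<in> generic_points" and m: "m \<ge> 2"
  have nz: "(\<Prod>j\<in>{Suc m..n+1}. x j ^ \<alpha> j) \<noteq> 0" by (rule generic_prod_nonzero[OF x]) auto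
  have "fls_subdegree (\<Prod>j\<in>{Suc m..n+1}. x j ^ \<alpha> j) = (\<Sum>j\<in>{Suc m..n+1}. fls_subdegree (x j ^ \<alpha> j))"
    by (rule subdegree_prod) (use generic_nonzero[OF x] m in auto)
  also have "\<dots> = (\<Sum>j\<in>{Suc m..n+1}. int (\<alpha> j) * fls_subdegree (x j))"
    by (simp add: fls_subdegree_pow)
  finally show ?thesis using nz unfolding den_def by (simp del: prod.cl_ivl_Suc sum.cl_ivl_Suc)
qed

text \<open>Compare orders on a branch over \<open>z = a\<close>, assuming that \<open>p\<close> does not vanish at \<open>a\<close>. If no \<open>y_j\<close> vanishes
  there, then \<open>q\<close> has positive order and everything else has order \<open>0\<close>. If \<open>y_l\<close> vanishes, then \<open>1/q\<close>
  contributes at most \<open>- k\<close>, the denominator \<open>- \<alpha>_l\<close>, and \<open>dz\<close> only \<open>k - 1\<close>.\<close>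

lemma no_finite_pole:
  assumes reg: "Reg (\<lambda>x. fpoly p (x 2) / fpoly q (x 2) * den 2 \<alpha> x)"
    and q: "q \<noteq> 0" "poly q a = 0"
  shows "poly p a = 0"
proof (rule ccontr)
  assume pa: "poly p a \<noteq> 0"
  obtain b where b: "b 1 = 1" "b 2 = a" "\<forall>j\<in>{3..n+1}. b j ^ k = poly (radicand j) a"
    using root_point_exists by blast
  show False
  proof (cases "\<exists>l\<in>{3..n+1}. b l = 0")
    case False
    then obtain x where x: "x \<in> Sol (n+1)" "nonconst x" "centered x b" "x 2 = fls_const a + fls_X"
      "\<forall>j\<in>{3..n+1}. fls_subdegree (x j) = 0"
      using branch_unramified[of b] b by auto
    have xB: "x \<in> branches" by (rule branches_affine[OF x(1-3) b(1)]) (use b in auto)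
    have xN: "x \<in> generic_points" by (rule branches_generic[OF xB])
    have d: "fls_deriv (x 2) = 1" by (simp add: x(4))
    have sp: "fls_subdegree (fpoly p (x 2)) = 0" "fpoly p (x 2) \<noteq> 0"
      using fpoly_at_nonroot[OF pa x(4)] by simp_all
    have nzq: "fpoly q (x 2) \<noteq> 0" using fpoly_nonconst[of x, OF x(2) q(1)] .
    have sq: "fls_subdegree (fpoly q (x 2)) \<ge> 1"
      by (rule fpoly_at_root[OF q(2) x(4)]) (use nzq in auto)
    have sD: "fls_subdegree (den 2 \<alpha> x) = 0" "den 2 \<alpha> x \<noteq> 0"
      using subdegree_den[OF xN, of 2 \<alpha>] x(5) by (auto simp: numeral_2_eq_2 numeral_3_eq_3)
    have "integral (fpoly p (x 2) / fpoly q (x 2) * den 2 \<alpha> x)" using reg xB d unfolding Reg_def by auto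
    then show False using sp nzq sq sD by (simp add: fls_divide_subdegree)
  next
    case True
    then obtain l where l: "l \<in> {3..n+1}" "b l = 0" by blast
    obtain x s where x: "x \<in> Sol (n+1)" "nonconst x" "centered x b" "x l = fls_X"
      "\<forall>j\<in>{3..n+1}-{l}. fls_subdegree (x j) = 0" "x 2 = fls_const a + s" "fls_subdegree s \<ge> int k" "a \<noteq> 0"
      using branch_ramified[of b l, OF b(1) _ l] b by auto
    have xB: "x \<in> branches" by (rule branches_affine[OF x(1-3) b(1)]) (use b in auto)
    have xN: "x \<in> generic_points" by (rule branches_generic[OF xB])
    have s0: "s = 0 \<or> fls_subdegree s > 0" using x(7) k0 by auto
    have sp: "fls_subdegree (fpoly p (x 2)) = 0" "fpoly p (x 2) \<noteq> 0"
      using fpoly_at_nonroot[OF pa x(6) s0] by simp_all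
    have nzq: "fpoly q (x 2) \<noteq> 0" using fpoly_nonconst[of x, OF x(2) q(1)] .
    have sq: "fls_subdegree (fpoly q (x 2)) \<ge> int k"
      by (rule fpoly_at_root[OF q(2) x(6)]) (use nzq x(7) k0 in auto)
    have "(\<Sum>j\<in>{3..n+1}. int (\<alpha> j) * fls_subdegree (x j)) = (\<Sum>j\<in>{3..n+1}. if j = l then int (\<alpha> l) else 0)"
      using x(4,5) by (intro sum.cong refl) auto
    also have "\<dots> = int (\<alpha> l)" using l(1) by (subst sum.delta) auto
    finally have sD: "fls_subdegree (den 2 \<alpha> x) = - int (\<alpha> l)" "den 2 \<alpha> x \<noteq> 0"
      using subdegree_den[OF xN, of 2 \<alpha>] by (simp_all add: numeral_3_eq_3 numeral_2_eq_2 del: sum.cl_ivl_Suc)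
    have x2: "fls_subdegree (x 2) = 0" "x 2 \<noteq> 0"
      using fpoly_at_nonroot[of "[:0,1:]" a "x 2" s] x(6,8) s0 by auto
    have rel: "fls_X ^ (k - 1) = - (x 2 ^ (k - 1) * fls_deriv (x 2))"
      using deriv_relation[OF xN l(1)] x(4) by simp
    then have d0: "fls_deriv (x 2) \<noteq> 0" by (metis fls_X_pow_nonzero minus_zero mult_zero_right)
    have "int (k - 1) = fls_subdegree (x 2 ^ (k - 1) * fls_deriv (x 2))"
      using arg_cong[OF rel, of fls_subdegree] by simp
    then have sd: "fls_subdegree (fls_deriv (x 2)) = int (k - 1)"
      using x2 d0 by (simp add: fls_subdegree_pow)
    have "integral (fpoly p (x 2) / fpoly q (x 2) * den 2 \<alpha> x * fls_deriv (x 2))"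
      using reg xB unfolding Reg_def by auto
    then show False using sp nzq sq sD sd d0 k0 by (simp add: fls_divide_subdegree)
  qed
qed

text \<open>At infinity \<open>p(z)\<close> has order \<open>- deg p\<close>, the inverse of the product has order \<open>\<Sum>j. \<alpha>_j\<close>, and \<open>dz\<close>
  has order \<open>- 2\<close>.\<close>

lemma degree_at_infinity:
  assumes reg: "Reg (\<lambda>x. fpoly p (x 2) * den 2 \<alpha> x)" and p: "p \<noteq> 0"
  shows "int (degree p) + 2 \<le> (\<Sum>j\<in>{3..n+1}. int (\<alpha> j))"
proof -
  obtain e :: 'a where e: "e ^ k = - 1" using nth_root_exists[OF k0] by blast
  define b where "b = (\<lambda>i::nat. if i = 1 then 0 else if i = 2 then 1 else e)"
  have b: "b 1 = 0" "b 2 = 1" "\<And>j. j \<in> {3..n+1} \<Longrightarrow> b j ^ k = - (b 2 ^ k)" using e by (auto simp: b_def)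
  obtain x where x: "x \<in> Sol (n+1)" "nonconst x" "centered x b" "x 2 = fls_X_inv"
    "\<forall>j\<in>{3..n+1}. fls_subdegree (x j) = -1"
    using branch_infinity[OF b(1) _ b(3)] b(2) by auto
  have xB: "x \<in> branches"
    by (rule branchesI[OF x(1-3)]) (use b k0 n_ge in \<open>auto simp: power_0_left intro!: bexI[of _ 2]\<close>)
  have xN: "x \<in> generic_points" by (rule branches_generic[OF xB])
  have sp: "fls_subdegree (fpoly p (x 2)) = - int (degree p)" "fpoly p (x 2) \<noteq> 0"
    using fpoly_at_pole[OF p, of "x 2"] x(4) by auto
  have "(\<Sum>j\<in>{3..n+1}. int (\<alpha> j) * fls_subdegree (x j)) = - (\<Sum>j\<in>{3..n+1}. int (\<alpha> j))"
    unfolding sum_negf[symmetric] using x(5) by (intro sum.cong refl) auto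
  then have sD: "fls_subdegree (den 2 \<alpha> x) = (\<Sum>j\<in>{3..n+1}. int (\<alpha> j))" "den 2 \<alpha> x \<noteq> 0"
    using subdegree_den[OF xN, of 2 \<alpha>] by (simp_all add: numeral_3_eq_3 numeral_2_eq_2 del: sum.cl_ivl_Suc)
  have d: "fls_deriv (x 2) = - (fls_X_inv\<^sup>2)" by (simp add: x(4))
  have sd: "fls_subdegree (fls_deriv (x 2)) = -2" "fls_deriv (x 2) \<noteq> 0"
    unfolding d by (simp_all add: fls_subdegree_pow)
  have "integral (fpoly p (x 2) * den 2 \<alpha> x * fls_deriv (x 2))"
    using reg xB unfolding Reg_def by auto
  then show ?thesis using sp sD sd by (simp del: sum.cl_ivl_Suc)
qed

text \<open>Every root of \<open>q\<close> is also a root of \<open>p\<close>, so linear factors can be cancelled until \<open>q\<close> is constant.\<close>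

lemma cancel_denominator:
  assumes "q \<noteq> 0" and "Reg (\<lambda>x. fpoly p (x 2) / fpoly q (x 2) * den 2 \<alpha> x)"
  shows "\<exists>p'. \<forall>x\<in>generic_points. fpoly p (x 2) / fpoly q (x 2) = fpoly p' (x 2)"
  using assms
proof (induction "degree q" arbitrary: p q)
  case 0
  then obtain c where c: "q = [:c:]" using degree_eq_zeroE by metis
  then have c0: "c \<noteq> 0" using 0 by auto
  have ic: "inverse (fls_const c) = fls_const (inverse c)" by (rule fls_inverse_const)
  show ?case
    by (rule exI[of _ "smult (inverse c) p"]) (simp add: c fpoly_smult divide_inverse ic mult.commute)
next
  case (Suc m)
  then obtain a where a: "poly q a = 0" using alg_closed_imp_poly_has_root[of q] by auto
  then have pa: "poly p a = 0" using no_finite_pole[OF Suc.prems(2,1)] by blast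
  obtain q1 where q1: "q = [:-a,1:] * q1" using a by (metis poly_eq_0_iff_dvd dvdE)
  obtain p1 where p1: "p = [:-a,1:] * p1" using pa by (metis poly_eq_0_iff_dvd dvdE)
  have q10: "q1 \<noteq> 0" using q1 Suc.prems(1) by auto
  have "degree q = Suc (degree q1)" unfolding q1 using q10 by (subst degree_mult_eq) auto
  then have dq: "m = degree q1" using Suc.hyps(2) by simp
  have eq: "fpoly p (x 2) / fpoly q (x 2) = fpoly p1 (x 2) / fpoly q1 (x 2)" if "x \<in> generic_points" for x
  proof -
    have "fpoly [:-a,1:] (x 2) \<noteq> 0" using fpoly_nonconst[of x "[:-a,1:]"] that by (auto simp: generic_points_def)
    then show ?thesis unfolding p1 q1 fpoly_mult by simp
  qed
  have "Reg (\<lambda>x. fpoly p1 (x 2) / fpoly q1 (x 2) * den 2 \<alpha> x)"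
    using Suc.prems(2) eq branches_generic unfolding Reg_def by simp
  then show ?case using Suc.hyps(1)[OF dq q10] eq by auto
qed

text \<open>The set \<open>W\<close> stands for the span of the forms theta; these closure properties say that it is a
  \<open>K\<close>-subspace containing them.\<close>

context
  fixes W :: "'a diff_form set"
  assumes W: "W \<subseteq> carrier Om" and W0: "\<zero>\<^bsub>Om\<^esub> \<in> W"
    and Wadd: "\<And>\<omega> \<eta>. \<omega> \<in> W \<Longrightarrow> \<eta> \<in> W \<Longrightarrow> \<omega> \<oplus>\<^bsub>Om\<^esub> \<eta> \<in> W"
    and Wsmult: "\<And>c \<omega>. \<omega> \<in> W \<Longrightarrow> const_fun n C c \<odot>\<^bsub>Om\<^esub> \<omega> \<in> W"
    and Wth: "\<And>i. i \<in> Idx \<Longrightarrow> th i \<in> W"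
begin

definition from_W :: "((nat \<Rightarrow> 'a fls) \<Rightarrow> 'a fls) \<Rightarrow> bool" where
  "from_W \<psi> \<longleftrightarrow> (\<exists>\<eta>\<in>W. \<forall>x\<in>generic_points. pullback x \<eta> = \<psi> x * fls_deriv (x 2))"

lemma from_W_cong: "(\<And>x. x \<in> generic_points \<Longrightarrow> \<psi> x = \<phi> x) \<Longrightarrow> from_W \<psi> \<longleftrightarrow> from_W \<phi>"
  unfolding from_W_def by simp

lemma from_W_sum:
  assumes "\<And>i. i \<in> I \<Longrightarrow> from_W (\<psi> i)"
  shows "from_W (\<lambda>x. \<Sum>i\<in>I. \<psi> i x)"
  using assms
proof (induction I rule: infinite_finite_induct)
  case (insert i I)
  obtain \<eta> where \<eta>: "\<eta> \<in> W" "\<forall>x\<in>generic_points. pullback x \<eta> = \<psi> i x * fls_deriv (x 2)"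
    using insert.prems[of i] unfolding from_W_def by auto
  obtain \<xi> where \<xi>: "\<xi> \<in> W" "\<forall>x\<in>generic_points. pullback x \<xi> = (\<Sum>i\<in>I. \<psi> i x) * fls_deriv (x 2)"
    using insert unfolding from_W_def by auto
  have "pullback x (\<eta> \<oplus>\<^bsub>Om\<^esub> \<xi>) = (\<Sum>i\<in>insert i I. \<psi> i x) * fls_deriv (x 2)" if x: "x \<in> generic_points" for x
    using pullback_add[OF x, of \<eta> \<xi>] \<eta> \<xi> W x insert.hyps by (auto simp: distrib_right)
  then show ?case unfolding from_W_def using Wadd[OF \<eta>(1) \<xi>(1)] by blast
qed (use W0 pullback_zero in \<open>auto simp: from_W_def intro!: bexI[of _ "\<zero>\<^bsub>Om\<^esub>"]\<close>)

lemma from_W_smult: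
  assumes "from_W \<psi>" shows "from_W (\<lambda>x. fls_const c * \<psi> x)"
proof -
  obtain \<eta> where \<eta>: "\<eta> \<in> W" "\<forall>x\<in>generic_points. pullback x \<eta> = \<psi> x * fls_deriv (x 2)"
    using assms unfolding from_W_def by auto
  have "pullback x (const_fun n C c \<odot>\<^bsub>Om\<^esub> \<eta>) = fls_const c * \<psi> x * fls_deriv (x 2)" if x: "x \<in> generic_points" for x
    using pullback_smult[OF x const_fun_closed, of \<eta> c] \<eta> W x by (auto simp: expand_const mult.assoc)
  then show ?thesis unfolding from_W_def using Wsmult[OF \<eta>(1)] by blast
qed

lemma from_W_theta_coeff: "(r, \<alpha>) \<in> Idx \<Longrightarrow> from_W (\<lambda>x. theta_coeff x (r, \<alpha>))"
  unfolding from_W_def using Wth pullback_theta by (intro bexI[of _ "th (r, \<alpha>)"]) (auto simp: theta_index_def)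

lemma from_W_base:
  assumes reg: "Reg (\<lambda>x. fpoly p (x 2) * den 2 \<alpha> x)" and \<alpha>: "\<And>j. j \<in> {3..n+1} \<Longrightarrow> \<alpha> j \<le> k - 1"
  shows "from_W (\<lambda>x. fpoly p (x 2) * den 2 \<alpha> x)"
proof (cases "p = 0")
  case True
  then show ?thesis using from_W_sum[of "{}"] by simp
next
  case False
  let ?\<alpha> = "restrict \<alpha> {3..n+1}"
  have deg: "int (degree p) + 2 \<le> (\<Sum>j\<in>{3..n+1}. int (\<alpha> j))" by (rule degree_at_infinity[OF reg False])
  have idx: "(int r, ?\<alpha>) \<in> Idx" if "r \<le> degree p" for r
  proof -
    have "int r \<le> (\<Sum>j=3..n+1. int (?\<alpha> j)) - 2" using that deg by (simp del: sum.cl_ivl_Suc)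
    then show ?thesis using \<alpha> by (auto simp: theta_index_def)
  qed
  have d: "den 2 \<alpha> x = inverse (\<Prod>j\<in>{3..n+1}. x j ^ ?\<alpha> j)" for x
    unfolding den_def by (rule arg_cong[where f = inverse], rule prod.cong) auto
  have "from_W (\<lambda>x. \<Sum>r\<le>degree p. fls_const (coeff p r) * theta_coeff x (int r, ?\<alpha>))"
    by (intro from_W_sum from_W_smult from_W_theta_coeff idx) simp
  moreover have "fpoly p (x 2) * den 2 \<alpha> x = (\<Sum>r\<le>degree p. fls_const (coeff p r) * theta_coeff x (int r, ?\<alpha>))" for x
    unfolding d fpoly_altdef sum_distrib_right by (intro sum.cong refl) (simp add: theta_coeff_def mult.assoc del: prod.cl_ivl_Suc)
  ultimately show ?thesis by simp
qed

text \<open>Induction on the number of coordinates that occur in \<open>\<psi>\<close>. Averaging over the twists of \<open>x (m + 1)\<close> splits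
  the given function into parts \<open>g_i x (m + 1)^(i - (k - 1))\<close>. They satisfy the same integrality condition,
  because twisting permutes the branches, and the negative power of \<open>x (m + 1)\<close> joins the denominator. With no
  coordinate left but \<open>z\<close>, the poles are cancelled and the degree is bounded.\<close>

lemma from_W_main:
  assumes "2 \<le> m" "m \<le> n + 1"
  shows "\<forall>\<psi>\<in>coord m. \<forall>\<alpha> q. q \<noteq> 0 \<longrightarrow> (\<forall>j\<in>{Suc m..n+1}. \<alpha> j \<le> k - 1) \<longrightarrow>
    Reg (\<lambda>x. \<psi> x / fpoly q (x 2) * den m \<alpha> x) \<longrightarrow> from_W (\<lambda>x. \<psi> x / fpoly q (x 2) * den m \<alpha> x)"
  using assms
proof (induction m rule: nat_induct_at_least)
  case base
  show ?case
  proof (intro ballI allI impI)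
    fix \<psi> :: "(nat \<Rightarrow> 'a fls) \<Rightarrow> 'a fls" and \<alpha> q
    assume "\<psi> \<in> coord 2" and q: "q \<noteq> 0" and \<alpha>: "\<forall>j\<in>{Suc 2..n+1}. \<alpha> j \<le> k - 1"
      and reg: "Reg (\<lambda>x. \<psi> x / fpoly q (x 2) * den 2 \<alpha> x)"
    obtain p where p: "\<And>x. \<psi> x = fpoly p (x 2)" using coord_base[OF \<open>\<psi> \<in> coord 2\<close>] by metis
    obtain p' where p': "\<forall>x\<in>generic_points. fpoly p (x 2) / fpoly q (x 2) = fpoly p' (x 2)"
      using cancel_denominator[OF q reg[unfolded p]] by blast
    have "Reg (\<lambda>x. fpoly p' (x 2) * den 2 \<alpha> x)" using reg p' branches_generic unfolding Reg_def p by simp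
    then have "from_W (\<lambda>x. fpoly p' (x 2) * den 2 \<alpha> x)" by (rule from_W_base) (use \<alpha> in auto)
    then show "from_W (\<lambda>x. \<psi> x / fpoly q (x 2) * den 2 \<alpha> x)"
      by (subst from_W_cong[where \<phi> = "\<lambda>x. fpoly p' (x 2) * den 2 \<alpha> x"]) (use p' p in auto)
  qed
next
  case (Suc m)
  have m: "2 \<le> m" "m \<le> n + 1" "Suc m \<le> n + 1" using Suc by auto
  show ?case
  proof (intro ballI allI impI)
    fix \<psi> :: "(nat \<Rightarrow> 'a fls) \<Rightarrow> 'a fls" and \<alpha> q
    assume \<psi>: "\<psi> \<in> coord (Suc m)" and q: "q \<noteq> 0" and \<alpha>: "\<forall>j\<in>{Suc (Suc m)..n+1}. \<alpha> j \<le> k - 1"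
      and reg: "Reg (\<lambda>x. \<psi> x / fpoly q (x 2) * den (Suc m) \<alpha> x)"
    \<comment> \<open>Multiplication by \<open>x (m + 1)^(k - 1)\<close> shifts the exponents \<open>- (k - 1), \<dots>, 0\<close> to \<open>0, \<dots>, k - 1\<close>.\<close>
    define f where "f = (\<lambda>x. \<psi> x * x (Suc m) ^ (k - 1))"
    have f: "f \<in> coord (Suc m)" unfolding f_def
      by (intro coord.mult \<psi> coord_power coord.var) (use m in auto)
    obtain g where g: "\<forall>i. g i \<in> coord m"
      and fg: "\<forall>x\<in>Sol (Suc m). f x = (\<Sum>i<k. g i x * x (Suc m) ^ i)"
      using coord_reduce[OF f m(1)] by blast
    define \<beta> where "\<beta> = (\<lambda>i. \<alpha>(Suc m := k - 1 - i))"
    define Q where "Q = (\<lambda>x. inverse (fpoly q (x 2)) * den (Suc m) \<alpha> x)"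
    have Qt: "Q (twist (Suc m) \<zeta> x) = Q x" for \<zeta> x
    proof -
      have "(\<Prod>j\<in>{Suc (Suc m)..n+1}. twist (Suc m) \<zeta> x j ^ \<alpha> j) = (\<Prod>j\<in>{Suc (Suc m)..n+1}. x j ^ \<alpha> j)"
        by (intro prod.cong refl) (auto simp: twist_def)
      then show ?thesis unfolding Q_def den_def using m by (simp add: twist_def del: prod.cl_ivl_Suc)
    qed
    have xS: "x \<in> Sol (Suc m)" if "x \<in> generic_points" for x
      using that Sol_mono[of x "n+1" "Suc m"] m by (auto simp: generic_points_def)
    have x0: "x (Suc m) \<noteq> 0" if "x \<in> generic_points" for x using generic_nonzero[OF that, of "Suc m"] m by auto
    have part: "g i x / fpoly q (x 2) * den m (\<beta> i) x
        = g i x * x (Suc m) ^ i * inverse (x (Suc m) ^ (k - 1)) * Q x"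
      if x: "x \<in> generic_points" and i: "i < k" for i x
    proof -
      have "(\<Prod>j\<in>{Suc m..n+1}. x j ^ \<beta> i j) = x (Suc m) ^ (k - 1 - i) * (\<Prod>j\<in>{Suc (Suc m)..n+1}. x j ^ \<alpha> j)"
      proof -
        have "{Suc m..n+1} = insert (Suc m) {Suc (Suc m)..n+1}" using m by auto
        moreover have "(\<Prod>j\<in>{Suc (Suc m)..n+1}. x j ^ \<beta> i j) = (\<Prod>j\<in>{Suc (Suc m)..n+1}. x j ^ \<alpha> j)"
          by (intro prod.cong refl) (auto simp: \<beta>_def)
        ultimately show ?thesis by (simp add: \<beta>_def del: prod.cl_ivl_Suc)
      qed
      then have "den m (\<beta> i) x = inverse (x (Suc m) ^ (k - 1 - i)) * den (Suc m) \<alpha> x"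
        unfolding den_def by (simp only: inverse_mult_distrib)
      moreover have "inverse (x (Suc m) ^ (k - 1 - i)) = x (Suc m) ^ i * inverse (x (Suc m) ^ (k - 1))"
        using power_split[OF x0[OF x], of i "k - 1"] i x0[OF x] by (simp add: inverse_mult_distrib)
      ultimately show ?thesis by (simp add: Q_def divide_inverse mult_ac)
    qed
    have ave: "fls_const (of_nat k) * (g i x / fpoly q (x 2) * den m (\<beta> i) x)
        = (\<Sum>\<zeta>\<in>unity_roots k. fls_const (\<zeta> ^ (k - i) * \<zeta> ^ (k - 1)) *
            (\<psi> (twist (Suc m) \<zeta> x) / fpoly q (twist (Suc m) \<zeta> x 2) * den (Suc m) \<alpha> (twist (Suc m) \<zeta> x)))"
      if x: "x \<in> generic_points" and i: "i < k" for i x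
    proof -
      let ?Y = "x (Suc m)"
      have "fls_const (of_nat k) * (g i x / fpoly q (x 2) * den m (\<beta> i) x)
          = (fls_const (of_nat k) * (g i x * ?Y ^ i)) * (inverse (?Y ^ (k - 1)) * Q x)"
        unfolding part[OF x i] by (simp only: mult_ac)
      also have "fls_const (of_nat k) * (g i x * ?Y ^ i)
          = (\<Sum>\<zeta>\<in>unity_roots k. fls_const \<zeta> ^ (k - i) * f (twist (Suc m) \<zeta> x))"
        by (rule twist_average[OF m(1) g[rule_format] fg[rule_format] xS[OF x] i, symmetric])
      also have "\<dots> * (inverse (?Y ^ (k - 1)) * Q x)
          = (\<Sum>\<zeta>\<in>unity_roots k. fls_const (\<zeta> ^ (k - i) * \<zeta> ^ (k - 1)) *
            (\<psi> (twist (Suc m) \<zeta> x) / fpoly q (twist (Suc m) \<zeta> x 2) * den (Suc m) \<alpha> (twist (Suc m) \<zeta> x)))"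
        unfolding sum_distrib_right
      proof (rule sum.cong[OF refl])
        fix \<zeta> :: 'a
        let ?t = "twist (Suc m) \<zeta> x"
        have "f ?t = \<psi> ?t * (fls_const (\<zeta> ^ (k - 1)) * ?Y ^ (k - 1))"
          by (simp add: f_def twist_def power_mult_distrib fls_const_power)
        then have "fls_const \<zeta> ^ (k - i) * f ?t * (inverse (?Y ^ (k - 1)) * Q x)
            = (fls_const (\<zeta> ^ (k - i)) * fls_const (\<zeta> ^ (k - 1))) * (\<psi> ?t * Q x) * (?Y ^ (k - 1) * inverse (?Y ^ (k - 1)))"
          by (simp only: fls_const_power mult_ac)
        also have "?Y ^ (k - 1) * inverse (?Y ^ (k - 1)) = 1" using x0[OF x] by simp
        also have "\<psi> ?t * Q x = \<psi> ?t / fpoly q (?t 2) * den (Suc m) \<alpha> ?t"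
          unfolding Qt[of \<zeta> x, symmetric] by (simp add: Q_def divide_inverse mult_ac)
        finally show "fls_const \<zeta> ^ (k - i) * f ?t * (inverse (?Y ^ (k - 1)) * Q x)
            = fls_const (\<zeta> ^ (k - i) * \<zeta> ^ (k - 1)) * (\<psi> ?t / fpoly q (?t 2) * den (Suc m) \<alpha> ?t)"
          by simp
      qed
      finally show ?thesis .
    qed
    have regi: "Reg (\<lambda>x. g i x / fpoly q (x 2) * den m (\<beta> i) x)" if i: "i < k" for i
      unfolding Reg_def
    proof
      fix x assume x: "x \<in> branches"
      let ?e = "\<lambda>x. \<psi> x / fpoly q (x 2) * den (Suc m) \<alpha> x"
      have xN: "x \<in> generic_points" by (rule branches_generic[OF x])
      have "fls_const (of_nat k) * (g i x / fpoly q (x 2) * den m (\<beta> i) x * fls_deriv (x 2))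
          = (\<Sum>\<zeta>\<in>unity_roots k. fls_const (\<zeta> ^ (k - i) * \<zeta> ^ (k - 1)) *
              (?e (twist (Suc m) \<zeta> x) * fls_deriv (twist (Suc m) \<zeta> x 2)))"
      proof -
        have "twist (Suc m) \<zeta> x 2 = x 2" for \<zeta> using m by (simp add: twist_def)
        then show ?thesis
          unfolding mult.assoc[symmetric, of "fls_const (of_nat k)"] ave[OF xN i, unfolded mult.assoc[symmetric]]
          by (simp add: sum_distrib_right ave[OF xN i, unfolded mult.assoc] mult.assoc)
      qed
      moreover have "integral (\<Sum>\<zeta>\<in>unity_roots k. fls_const (\<zeta> ^ (k - i) * \<zeta> ^ (k - 1)) *
              (?e (twist (Suc m) \<zeta> x) * fls_deriv (twist (Suc m) \<zeta> x 2)))"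
      proof (rule integral_sum)
        fix \<zeta> :: 'a assume "\<zeta> \<in> unity_roots k"
        then have "twist (Suc m) \<zeta> x \<in> branches" using m by (intro branches_twist[OF x]) auto
        then have "integral (?e (twist (Suc m) \<zeta> x) * fls_deriv (twist (Suc m) \<zeta> x 2))"
          using reg unfolding Reg_def by blast
        then show "integral (fls_const (\<zeta> ^ (k - i) * \<zeta> ^ (k - 1)) *
              (?e (twist (Suc m) \<zeta> x) * fls_deriv (twist (Suc m) \<zeta> x 2)))"
          by (rule integral_mult[rotated]) simp
      qed
      ultimately have I: "integral (fls_const (of_nat k) * (g i x / fpoly q (x 2) * den m (\<beta> i) x * fls_deriv (x 2)))"
        by simp
      define h where "h = g i x / fpoly q (x 2) * den m (\<beta> i) x * fls_deriv (x 2)"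
      have "fls_subdegree (fls_const (of_nat k) * h) = fls_subdegree h"
        using kne by (cases "h = 0") auto
      then show "integral (g i x / fpoly q (x 2) * den m (\<beta> i) x * fls_deriv (x 2))"
        using I unfolding h_def[symmetric] by simp
    qed
    have "from_W (\<lambda>x. g i x / fpoly q (x 2) * den m (\<beta> i) x)" if i: "i < k" for i
    proof -
      have "\<forall>j\<in>{Suc m..n+1}. \<beta> i j \<le> k - 1" using \<alpha> by (auto simp: \<beta>_def)
      then show ?thesis using Suc.IH[OF m(2)] g q regi[OF i] by blast
    qed
    then have IS: "from_W (\<lambda>x. \<Sum>i<k. g i x / fpoly q (x 2) * den m (\<beta> i) x)" by (intro from_W_sum) simp
    have SE: "(\<Sum>i<k. g i x / fpoly q (x 2) * den m (\<beta> i) x) = \<psi> x / fpoly q (x 2) * den (Suc m) \<alpha> x"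
      if x: "x \<in> generic_points" for x
    proof -
      let ?Y = "x (Suc m)"
      have "(\<Sum>i<k. g i x / fpoly q (x 2) * den m (\<beta> i) x)
          = (\<Sum>i<k. g i x * ?Y ^ i * (inverse (?Y ^ (k - 1)) * Q x))"
        by (rule sum.cong[OF refl], subst part[OF x]) (simp_all only: mult.assoc lessThan_iff)
      also have "\<dots> = f x * (inverse (?Y ^ (k - 1)) * Q x)"
        using fg xS[OF x] by (simp add: sum_distrib_right)
      also have "\<dots> = \<psi> x * Q x * (?Y ^ (k - 1) * inverse (?Y ^ (k - 1)))" by (simp only: f_def mult_ac)
      also have "?Y ^ (k - 1) * inverse (?Y ^ (k - 1)) = 1" using x0[OF x] by simp
      finally show ?thesis by (simp add: Q_def divide_inverse mult_ac)
    qed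
    show "from_W (\<lambda>x. \<psi> x / fpoly q (x 2) * den (Suc m) \<alpha> x)"
      by (rule iffD1[OF from_W_cong IS]) (rule SE)
  qed
qed

text \<open>The coefficient of \<open>dz\<close> is a quotient of polynomials in the coordinates; a suitable multiple of its
  denominator is a polynomial in \<open>z\<close> alone.\<close>

lemma regular_in_W:
  assumes \<omega>: "\<omega> \<in> carrier Om" and reg: "\<And>P. P \<in> C \<Longrightarrow> regular_at n C \<omega> P"
  shows "\<omega> \<in> W"
proof -
  obtain x1 where x1: "x1 \<in> generic_points" "fls_deriv (x1 2) = 1" using separating_exists by blast
  obtain a where a: "a \<in> carrier F" "\<omega> = a \<odot>\<^bsub>Om\<^esub> dif (y 2)" using Om_multiple[OF \<omega>] by blast
  obtain g h where gh: "(g, h) \<in> Frac" "a = fr g h" using a(1) carrier_F by blast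
  obtain d where d: "g \<in> forms n d" "h \<in> forms n d" using gh(1) Frac_iff[OF x1(1)] by blast
  have one: "x(1 := 1) = x" if "x \<in> generic_points" for x using generic_1[OF that] by auto
  define G where "G = (\<lambda>x. ev (x(1 := 1)) g)"
  define H where "H = (\<lambda>x. ev (x(1 := 1)) h)"
  have GH: "G \<in> coord (n+1)" "H \<in> coord (n+1)" unfolding G_def H_def by (rule ev_coord[OF d(1)], rule ev_coord[OF d(2)])
  have e: "G x = ev x g" "H x = ev x h" if "x \<in> generic_points" for x using one[OF that] by (simp_all add: G_def H_def)
  have n1: "2 \<le> n + 1" using n_ge by simp
  have "H x1 \<noteq> 0" using Frac_nz[OF x1(1) gh(1)] e[OF x1(1)] by simp
  then have "\<exists>x\<in>Sol (n+1). nonconst x \<and> H x \<noteq> 0" using x1(1) unfolding generic_points_def by blast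
  then obtain H' q where H': "H' \<in> coord (n+1)" "q \<noteq> 0" "\<forall>x\<in>Sol (n+1). H x * H' x = fpoly q (x 2)"
    using bspec[OF coord_multiple[OF n1 order_refl] GH(2)] by blast
  define \<psi> where "\<psi> = (\<lambda>x. G x * H' x)"
  have \<psi>: "\<psi> \<in> coord (n+1)" unfolding \<psi>_def by (rule coord.mult[OF GH(1) H'(1)])
  have Ta: "expand x a = \<psi> x / fpoly q (x 2) * den (n+1) (\<lambda>_. 0) x" if x: "x \<in> generic_points" for x
  proof -
    have Hx: "H x \<noteq> 0" using Frac_nz[OF x gh(1)] e[OF x] by simp
    have hq: "H x * H' x = fpoly q (x 2)" using H'(3) x by (simp add: generic_points_def)
    have "fpoly q (x 2) \<noteq> 0" using fpoly_nonconst[of x q] x H'(2) by (simp add: generic_points_def)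
    then have H'x: "H' x \<noteq> 0" using hq by auto
    have "expand x a = G x / H x" using expand_frac[OF x gh(1)] gh(2) e[OF x] by simp
    also have "\<dots> = \<psi> x / fpoly q (x 2)" unfolding hq[symmetric] \<psi>_def using H'x by simp
    finally show ?thesis by (simp add: den_def)
  qed
  have z: "y 2 \<in> carrier F" "2 \<in> {1..n+1}" using n_ge by auto
  have L\<omega>: "pullback x \<omega> = expand x a * fls_deriv (x 2)" if x: "x \<in> generic_points" for x
    using pullback_smult[OF x a(1) dif_closed[OF z(1)]] pullback_d[OF x z(1)] expand_y[OF x z(2)] a(2) by simp
  have "Reg (\<lambda>x. \<psi> x / fpoly q (x 2) * den (n+1) (\<lambda>_. 0) x)"
    unfolding Reg_def
  proof
    fix x assume x: "x \<in> branches"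
    then obtain P p where P: "P \<in> C" "p \<in> P" "centered x p" unfolding branches_def by blast
    have "integral (pullback x \<omega>)" by (rule regular_integral[OF P(1,2) branches_generic[OF x] P(3) reg[OF P(1)]])
    then show "integral (\<psi> x / fpoly q (x 2) * den (n+1) (\<lambda>_. 0) x * fls_deriv (x 2))"
      unfolding L\<omega>[OF branches_generic[OF x]] Ta[OF branches_generic[OF x]] .
  qed
  then have "from_W (\<lambda>x. \<psi> x / fpoly q (x 2) * den (n+1) (\<lambda>_. 0) x)"
    using bspec[OF from_W_main[OF n1 order_refl] \<psi>] H'(2) by simp
  then obtain \<eta> where \<eta>: "\<eta> \<in> W" "\<forall>x\<in>generic_points. pullback x \<eta> = \<psi> x / fpoly q (x 2) * den (n+1) (\<lambda>_. 0) x * fls_deriv (x 2)"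
    unfolding from_W_def by blast
  have "pullback x1 \<eta> = pullback x1 \<omega>" using \<eta>(2) x1(1) L\<omega>[OF x1(1)] Ta[OF x1(1)] by simp
  moreover have "inj_on (pullback x1) (carrier Om)" by (rule pullback_inj[OF x1(1)]) (simp add: x1(2))
  ultimately have "\<eta> = \<omega>" using \<eta>(1) W \<omega> by (auto dest: inj_onD)
  then show ?thesis using \<eta>(1) by simp
qed

end

section \<open>The space of holomorphic forms\<close>

abbreviation "Hol \<equiv> holomorphic_forms n C"

lemma carrier_Hol: "carrier Hol = {\<omega> \<in> carrier Om. \<forall>P\<in>C. regular_at n C \<omega> P}"
  by (simp add: holomorphic_forms_def Let_def)

lemma Hol_simps: "zero Hol = zero Om" "add Hol = add Om" "c \<odot>\<^bsub>Hol\<^esub> \<omega> = const_fun n C c \<odot>\<^bsub>Om\<^esub> \<omega>"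
  by (simp_all add: holomorphic_forms_def Let_def)

lemma const_fun_hom:
  "const_fun n C (c + d) = const_fun n C c \<oplus>\<^bsub>F\<^esub> const_fun n C d"
  "const_fun n C (c * d) = const_fun n C c \<otimes>\<^bsub>F\<^esub> const_fun n C d"
proof -
  obtain x where x: "x \<in> generic_points" using generic_nonempty by blast
  show "const_fun n C (c + d) = const_fun n C c \<oplus>\<^bsub>F\<^esub> const_fun n C d"
    by (rule F_eqI[OF x]) (simp_all add: expand_add[OF x] expand_const[OF x] fls_plus_const)
  show "const_fun n C (c * d) = const_fun n C c \<otimes>\<^bsub>F\<^esub> const_fun n C d"
    by (rule F_eqI[OF x]) (simp_all add: expand_mult[OF x] expand_const[OF x])
qed

lemma Hol_smult: "\<omega> \<in> carrier Hol \<Longrightarrow> const_fun n C c \<odot>\<^bsub>Om\<^esub> \<omega> \<in> carrier Hol"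
  unfolding carrier_Hol using regular_smult LR_const by auto

lemma vectorspace_Hol: "vectorspace class_ring Hol"
proof -
  have "Module.module class_ring Hol"
  proof (rule module_criteria)
    show "cring (class_ring :: 'a ring)" by (rule class_cring.cring_axioms)
    show "\<zero>\<^bsub>Hol\<^esub> \<in> carrier Hol" using regular_zero by (simp add: carrier_Hol Hol_simps)
    show "\<forall>v w. v \<in> carrier Hol \<and> w \<in> carrier Hol \<longrightarrow> v \<oplus>\<^bsub>Hol\<^esub> w \<in> carrier Hol"
      using regular_add by (auto simp: carrier_Hol Hol_simps)
    show "\<forall>v\<in>carrier Hol. \<exists>w\<in>carrier Hol. v \<oplus>\<^bsub>Hol\<^esub> w = \<zero>\<^bsub>Hol\<^esub>"
    proof
      fix v assume v: "v \<in> carrier Hol"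
      have vO: "v \<in> carrier Om" using v by (simp add: carrier_Hol)
      have "v \<oplus>\<^bsub>Om\<^esub> const_fun n C (-1) \<odot>\<^bsub>Om\<^esub> v = (const_fun n C 1 \<oplus>\<^bsub>F\<^esub> const_fun n C (-1)) \<odot>\<^bsub>Om\<^esub> v"
        using vO by (simp add: Om.smult_l_distr one_F[symmetric])
      also have "\<dots> = \<zero>\<^bsub>Om\<^esub>" using vO by (simp add: const_fun_hom(1)[symmetric] zero_F[symmetric])
      finally show "\<exists>w\<in>carrier Hol. v \<oplus>\<^bsub>Hol\<^esub> w = \<zero>\<^bsub>Hol\<^esub>"
        using Hol_smult[OF v] by (auto simp: Hol_simps)
    qed
  qed (auto simp: Hol_simps Hol_smult carrier_Hol const_fun_hom Om.smult_l_distr Om.smult_r_distr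
      Om.smult_assoc1 Om.a_ac one_F[symmetric] intro: regular_smult LR_const)
  then show ?thesis by (intro vectorspace.intro class_field.field_axioms)
qed

sublocale Hol: vectorspace class_ring Hol by (rule vectorspace_Hol)

lemma theta_Hol: "i \<in> Idx \<Longrightarrow> th i \<in> carrier Hol"
  using theta_regular theta_closed by (cases i) (auto simp: carrier_Hol theta_index_def)

lemma pullback_lincomb:
  assumes x: "x \<in> generic_points" and "finite A" "A \<subseteq> carrier Hol"
  shows "pullback x (Hol.lincomb c A) = (\<Sum>v\<in>A. fls_const (c v) * pullback x v)"
  using assms(2,3)
proof (induction A rule: finite_induct)
  case empty
  then show ?case using pullback_zero[OF x] by (simp add: Hol.lincomb_def Hol_simps)
next
  case (insert v A)
  have vA: "v \<in> carrier Hol" "A \<subseteq> carrier Hol" using insert.prems by auto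
  have "Hol.lincomb c (insert v A) = (c v \<odot>\<^bsub>Hol\<^esub> v) \<oplus>\<^bsub>Hol\<^esub> Hol.lincomb c A"
    using Hol.lincomb_insert[OF insert.hyps(1) vA(2) _ insert.hyps(2) vA(1), of c] by simp
  moreover have "Hol.lincomb c A \<in> carrier Om"
    using Hol.lincomb_closed[OF vA(2), of c] by (auto simp: carrier_Hol)
  moreover have vO: "v \<in> carrier Om" using vA by (simp add: carrier_Hol)
  ultimately show ?case
    using insert pullback_add[OF x] pullback_smult[OF x const_fun_closed vO] expand_const[OF x] by (simp add: Hol_simps)
qed

lemma theta_inj: "inj_on th Idx"
proof (rule inj_onI, rule ccontr)
  fix i j assume ij: "i \<in> Idx" "j \<in> Idx" "th i = th j" "i \<noteq> j"
  obtain x where x: "x \<in> generic_points" "fls_deriv (x 2) = 1" using separating_exists by blast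
  have L: "pullback x (th i) = theta_coeff x i" if "i \<in> Idx" for i
    using pullback_theta[OF x(1)] x(2) that by (cases i) (auto simp: theta_index_def)
  let ?c = "\<lambda>l. if l = i then 1 else - 1 :: 'a"
  have "(\<Sum>l\<in>{i,j}. fls_const (?c l) * theta_coeff x l) = 0"
    using ij L[OF ij(1)] L[OF ij(2)] by (simp flip: fls_const_uminus) (metis fls_const_1 fls_const_uminus mult_minus1 add.right_inverse)
  then have "?c i = 0" using ij by (intro theta_coeff_independent[OF _ _ x(1), of "{i, j}"]) auto
  then show False by simp
qed

lemma theta_basis: "Hol.basis (th ` Idx)"
proof -
  have sub: "th ` Idx \<subseteq> carrier Hol" using theta_Hol by auto
  have "\<not> Hol.lin_dep (th ` Idx)"
  proof
    assume "Hol.lin_dep (th ` Idx)"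
    then obtain A c v where A: "finite A" "A \<subseteq> th ` Idx" "Hol.lincomb c A = \<zero>\<^bsub>Hol\<^esub>" "v \<in> A" "c v \<noteq> 0"
      unfolding Hol.lin_dep_def by auto
    obtain x where x: "x \<in> generic_points" "fls_deriv (x 2) = 1" using separating_exists by blast
    have L: "pullback x (th i) = theta_coeff x i" if "i \<in> Idx" for i
      using pullback_theta[OF x(1)] x(2) that by (cases i) (auto simp: theta_index_def)
    obtain I where I: "I \<subseteq> Idx" "A = th ` I" "finite I"
      using A(1,2) by (meson finite_subset_image)
    have inj: "inj_on th I" using theta_inj I(1) by (rule inj_on_subset)
    have "0 = pullback x (Hol.lincomb c A)" using A(3) pullback_zero[OF x(1)] by (simp add: Hol_simps)
    also have "\<dots> = (\<Sum>v\<in>A. fls_const (c v) * pullback x v)"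
      by (rule pullback_lincomb[OF x(1) A(1)]) (use A(2) sub in auto)
    also have "\<dots> = (\<Sum>i\<in>I. fls_const (c (th i)) * theta_coeff x i)"
      unfolding I(2) sum.reindex[OF inj] using L I(1) by (intro sum.cong refl) auto
    finally have z: "(\<Sum>i\<in>I. fls_const (c (th i)) * theta_coeff x i) = 0" by simp
    obtain i where i: "i \<in> I" "v = th i" using A(4) I(2) by auto
    have "c (th i) = 0" by (rule theta_coeff_independent[OF I(3,1) x(1) z i(1)])
    then show False using A(5) i(2) by simp
  qed
  moreover have "Hol.span (th ` Idx) = carrier Hol"
  proof
    note S = Hol.span_is_submodule[OF sub]
    show sC: "Hol.span (th ` Idx) \<subseteq> carrier Hol" by (rule submodule.subset[OF S])
    show "carrier Hol \<subseteq> Hol.span (th ` Idx)"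
    proof
      fix \<omega> assume "\<omega> \<in> carrier Hol"
      then have \<omega>: "\<omega> \<in> carrier Om" "\<And>P. P \<in> C \<Longrightarrow> regular_at n C \<omega> P" by (auto simp: carrier_Hol)
      show "\<omega> \<in> Hol.span (th ` Idx)"
      proof (rule regular_in_W[OF _ _ _ _ _ \<omega>])
        show "Hol.span (th ` Idx) \<subseteq> carrier Om" using sC by (auto simp: carrier_Hol)
        show "\<zero>\<^bsub>Om\<^esub> \<in> Hol.span (th ` Idx)" using submodule.zero_closed[OF S] by (simp add: Hol_simps)
        show "\<omega> \<oplus>\<^bsub>Om\<^esub> \<eta> \<in> Hol.span (th ` Idx)" if "\<omega> \<in> Hol.span (th ` Idx)" "\<eta> \<in> Hol.span (th ` Idx)" for \<omega> \<eta>
          using submodule.m_closed[OF S that] by (simp add: Hol_simps)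
        show "const_fun n C c \<odot>\<^bsub>Om\<^esub> \<omega> \<in> Hol.span (th ` Idx)" if "\<omega> \<in> Hol.span (th ` Idx)" for c \<omega>
          using submodule.smult_closed[OF S _ that, of c] by (simp add: Hol_simps)
        show "th i \<in> Hol.span (th ` Idx)" if "i \<in> Idx" for i
          using Hol.in_own_span[OF sub] that by auto
      qed
    qed
  qed
  ultimately show ?thesis unfolding Hol.basis_def using sub by blast
qed

end

theorem theorem3p1:
  fixes k n :: nat and lam :: "nat \<Rightarrow> 'a::alg_closed_field"
  assumes "k \<ge> 2" and "n \<ge> 2" and "(k - 1) * (n - 1) \<ge> 2"
    and "CHAR('a) > 0 \<longrightarrow> coprime k CHAR('a)"
    and "\<forall>i\<in>{1..n-2}. lam i \<noteq> 0 \<and> lam i \<noteq> 1"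
    and "inj_on lam {1..n-2}"
  shows "let C = gen_fermat_curve k n lam; H = holomorphic_forms n C in
    vectorspace class_ring H \<and>
    inj_on (theta n C) (theta_index k n) \<and>
    vectorspace.basis class_ring H (theta n C ` theta_index k n)"
proof -
  have "of_nat k \<noteq> (0 :: 'a)"
  proof
    assume "of_nat k = (0 :: 'a)"
    then have dvd: "CHAR('a) dvd k" by (simp add: of_nat_eq_0_iff_char_dvd)
    then have pos: "CHAR('a) > 0" using assms(1) by (cases "CHAR('a) = 0") auto
    then have "coprime k CHAR('a)" using assms(4) by blast
    then have "CHAR('a) = 1" using dvd by (metis coprime_absorb_right is_unit_gcd_iff gcd_nat.absorb2 nat_dvd_1_iff_1 coprime_iff_gcd_eq_1)
    then show False using CHAR_not_1'[where ?'a = 'a] by simp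
  qed
  then interpret gen_fermat k n lam
    using assms by (intro gen_fermat.intro) auto
  show ?thesis unfolding Let_def using vectorspace_Hol theta_inj theta_basis by blast
qed

end
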